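(* Let $n,k,t$ be positive integers with $k\ge t+3$ and $n\ge \binom{t+3}{2}(k-t+1)^4$. Let $\mathcal F\subseteq\binom{[n]}{k}$ be a $t$-intersecting family with $\tau_t(\mathcal F)\ge t+2$. Then $$|\mathcal F|\le \max\{f_1(n,k,t),f_2(n,k,t),f_3(n,k,t)\},$$ where $$f_1(n,k,t)=\binom{n-t}{k-t}-3\binom{n-k-1}{k-t}+\binom{n-k-2}{k-t}+\binom{n-2k+t-1}{k-t}+3,$$ $$f_2(n,k,t)=\binom{n-t-2}{k-t-2}+(t+2)\left(\binom{n-t-2}{k-t-1}-\binom{n-k-2}{k-t-1}\right)+\binom{t+2}{2},$$ $$f_3(n,k,t)=\binom{t+4}{2}\binom{n-t-4}{k-t-2}+(t+4)\binom{n-t-4}{k-t-3}+\binom{n-t-4}{k-t-4}.$$ Moreover, if equality holds, then $\mathcal F$ is a Type I, Type II or Type III family (as defined in the context).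
   Context: $[n]=\{1,\dots,n\}$ and $\binom{X}{k}$ is the set of $k$-subsets of $X$. A family $\mathcal F$ of sets is $t$-intersecting if $|F\cap F'|\ge t$ for all $F,F'\in\mathcal F$. A $t$-cover of $\mathcal F$ is a set $S\subseteq[n]$ with $|S\cap F|\ge t$ for every $F\in\mathcal F$; the $t$-covering number $\tau_t(\mathcal F)$ is the minimum size of a $t$-cover of $\mathcal F$. Type I family: choose $T,A\in\binom{[n]}{t}$ and $B,C\in\binom{[n]}{k-t}$ with $|T\cap A|=t-1$, $T\cap(B\cup C)=\emptyset$, and $A,B,C$ pairwise disjoint; choose $u\in C$; put $G_1=A\cup B$, $G_2=A\cup C$, $G_3=(T\cap A)\cup B\cup\{u\}$. The family is $\{F\in\binom{[n]}{k}: F\cap(A\cup T)=T,\ F\cap B\ne\emptyset,\ F\cap C\neq\emptyset\}\cup\{F\in\binom{[n]}{k}: A\cup T\subseteq F,\ F\cap(B\cup\{u\})\neq\emptyset\}\cup\{G_1,G_2,G_3\}$; its size is $f_1(n,k,t)$ (for $n>2k$, $k\ge t+3$). Type II family: choose $M\in\binom{[n]}{k+2}$ and $W\in\binom{M}{t+2}$; the family is $\{F\in\binom{[n]}{k}: W\subseteq F\}\cup\{F\in\binom{[n]}{k}: |F\cap W|=t+1,\ F\cap(M\setminus W)\neq\emptyset\}\cup\{F\in\binom{M}{k}: |F\cap W|=t\}$; its size is $f_2(n,k,t)$. Type III family: choose $Z\in\binom{[n]}{t+4}$; the family is $\{F\in\binom{[n]}{k}: |F\cap Z|\ge t+2\}$;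 its size is $f_3(n,k,t)$. *)

theory Defs
  imports Main
begin

definition ksets :: "nat \<Rightarrow> nat \<Rightarrow> nat set set" where
  "ksets n k = {F. F \<subseteq> {1..n} \<and> card F = k}"

definition t_intersecting :: "nat \<Rightarrow> nat set set \<Rightarrow> bool" where
  "t_intersecting t \<F> \<longleftrightarrow> (\<forall>F\<in>\<F>. \<forall>F'\<in>\<F>. card (F \<inter> F') \<ge> t)"

definition t_cover :: "nat \<Rightarrow> nat \<Rightarrow> nat set set \<Rightarrow> nat set \<Rightarrow> bool" where
  "t_cover n t \<F> S \<longleftrightarrow> S \<subseteq> {1..n} \<and> (\<forall>F\<in>\<F>. card (S \<inter> F) \<ge> t)"

definition tau :: "nat \<Rightarrow> nat \<Rightarrow> nat set set \<Rightarrow> nat" where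
  "tau n t \<F> = (LEAST m. \<exists>S. t_cover n t \<F> S \<and> card S = m)"

definition ibinom :: "int \<Rightarrow> int \<Rightarrow> int" where
  "ibinom a b = (if a < 0 \<or> b < 0 then 0 else int (nat a choose nat b))"

definition f1 :: "nat \<Rightarrow> nat \<Rightarrow> nat \<Rightarrow> int" where
  "f1 n k t = (let n = int n; k = int k; t = int t in
     ibinom (n-t) (k-t) - 3 * ibinom (n-k-1) (k-t) + ibinom (n-k-2) (k-t)
     + ibinom (n-2*k+t-1) (k-t) + 3)"

definition f2 :: "nat \<Rightarrow> nat \<Rightarrow> nat \<Rightarrow> int" where
  "f2 n k t = (let n = int n; k = int k; t = int t in
     ibinom (n-t-2) (k-t-2) + (t+2) * (ibinom (n-t-2) (k-t-1) - ibinom (n-k-2) (k-t-1))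
     + ibinom (t+2) 2)"

definition f3 :: "nat \<Rightarrow> nat \<Rightarrow> nat \<Rightarrow> int" where
  "f3 n k t = (let n = int n; k = int k; t = int t in
     ibinom (t+4) 2 * ibinom (n-t-4) (k-t-2) + (t+4) * ibinom (n-t-4) (k-t-3)
     + ibinom (n-t-4) (k-t-4))"

definition type1_family :: "nat \<Rightarrow> nat \<Rightarrow> nat set \<Rightarrow> nat set \<Rightarrow> nat set \<Rightarrow> nat set \<Rightarrow> nat \<Rightarrow> nat set set" where
  "type1_family n k T A B C u =
     {F \<in> ksets n k. F \<inter> (A \<union> T) = T \<and> F \<inter> B \<noteq> {} \<and> F \<inter> C \<noteq> {}}
     \<union> {F \<in> ksets n k. A \<union> T \<subseteq> F \<and> F \<inter> (B \<union> {u}) \<noteq> {}}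
     \<union> {A \<union> B, A \<union> C, (T \<inter> A) \<union> B \<union> {u}}"

definition is_type1 :: "nat \<Rightarrow> nat \<Rightarrow> nat \<Rightarrow> nat set set \<Rightarrow> bool" where
  "is_type1 n k t \<F> \<longleftrightarrow> (\<exists>T A B C u.
     T \<subseteq> {1..n} \<and> A \<subseteq> {1..n} \<and> B \<subseteq> {1..n} \<and> C \<subseteq> {1..n} \<and>
     card T = t \<and> card A = t \<and> card B = k - t \<and> card C = k - t \<and>
     card (T \<inter> A) = t - 1 \<and> T \<inter> (B \<union> C) = {} \<and>
     A \<inter> B = {} \<and> A \<inter> C = {} \<and> B \<inter> C = {} \<and> u \<in> C \<and>
     \<F> = type1_family n k T A B C u)"

definition type2_family :: "nat \<Rightarrow> nat \<Rightarrow> nat \<Rightarrow> nat set \<Rightarrow> nat set \<Rightarrow> nat set set" where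
  "type2_family n k t M W =
     {F \<in> ksets n k. W \<subseteq> F}
     \<union> {F \<in> ksets n k. card (F \<inter> W) = t + 1 \<and> F \<inter> (M - W) \<noteq> {}}
     \<union> {F. F \<subseteq> M \<and> card F = k \<and> card (F \<inter> W) = t}"

definition is_type2 :: "nat \<Rightarrow> nat \<Rightarrow> nat \<Rightarrow> nat set set \<Rightarrow> bool" where
  "is_type2 n k t \<F> \<longleftrightarrow> (\<exists>M W.
     M \<subseteq> {1..n} \<and> card M = k + 2 \<and> W \<subseteq> M \<and> card W = t + 2 \<and>
     \<F> = type2_family n k t M W)"

definition type3_family :: "nat \<Rightarrow> nat \<Rightarrow> nat \<Rightarrow> nat set \<Rightarrow> nat set set" where
  "type3_family n k t Z = {F \<in> ksets n k. card (F \<inter> Z) \<ge> t + 2}"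

definition is_type3 :: "nat \<Rightarrow> nat \<Rightarrow> nat \<Rightarrow> nat set set \<Rightarrow> bool" where
  "is_type3 n k t \<F> \<longleftrightarrow> (\<exists>Z. Z \<subseteq> {1..n} \<and> card Z = t + 4 \<and> \<F> = type3_family n k t Z)"

end

theory Submission
  imports Defs
begin

text \<open>
  Put \<open>m = k - t\<close> and extend \<open>\<F>\<close> to a maximal \<open>t\<close>-intersecting family. If \<open>S\<close> is not a \<open>t\<close>-cover, the members
  of \<open>\<F>\<close> containing \<open>S\<close> number at most \<open>m + 1\<close> times those containing \<open>S\<close> and one further point. Starting
  from the \<open>t\<close>-subsets of a minimum cover, this shows that \<open>\<F>\<close> is too small unless the family \<open>TT\<close> of
  \<open>t\<close>-covers of size \<open>t + 2\<close> is nonempty, and otherwise \<open>|\<F>|\<close> is at most \<open>|TT|\<close> times \<open>(n-t-2 choose m-2)\<close>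
  up to less than one further such binomial. The three extremal sizes have leading coefficients
  \<open>m\<^sup>2 + m + 1\<close>, \<open>(t + 2) m + 1\<close> and \<open>(t+4 choose 2)\<close>, so it remains to show that \<open>TT\<close> is smaller than the
  largest of them or that \<open>\<F>\<close> lies in an extremal family.

  By maximality \<open>TT\<close> is itself \<open>t\<close>-intersecting. If its members share a \<open>t\<close>-set \<open>X\<close>, they correspond to the
  pairs meeting every \<open>F - X\<close> with \<open>F\<close> not containing \<open>X\<close>, and these \<open>(m + 1)\<close>-sets are intersecting without common point.
  If they all meet a \<open>(t + 2)\<close>-set \<open>W\<close> in \<open>t + 1\<close> points, degree counting applies. If they only all meet
  a \<open>(t + 1)\<close>-set \<open>S\<close> in \<open>t\<close> points, their traces outside \<open>S\<close> are cross-intersecting graphs. Otherwise every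
  \<open>(t + 1)\<close>-set lies in at most three members of \<open>TT\<close>, and counting around one member gives
  \<open>(t+4 choose 2)\<close>, attained only by all \<open>(t + 2)\<close>-subsets of a \<open>(t + 4)\<close>-set.
\<close>

section \<open>Counting\<close>

text \<open>Write \<open>D = (n-t-2 choose m-2)\<close> and \<open>D' = (n-t-3 choose m-3)\<close>.
  All error terms are multiples of \<open>D'\<close>, and \<open>(m - 2) D = (n - t - 2) D'\<close>,
  so the bound on \<open>n\<close> is used to make one \<open>D\<close> outweigh all of them.
  Splitting \<open>(t+3 choose 2)\<close> as \<open>(t+2 choose 2) + (t + 2)\<close>, the first
  summand pays for the members that contain no cover of size \<open>t + 2\<close>, the second, up to
  some slack, for the gap between an extremal size and its leading term. What remains is a problem
  about the integer \<open>|TT|\<close>, in which being short by one is enough.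

  The obstacle is that none of the three leading coefficients dominates the others. Every structural
  case has to be compared with their maximum, and for small \<open>t\<close> and \<open>m\<close>
  some cases come within one of it.

  Uniqueness does not require the exact size of an extremal family. The critical cases yield
  containment of the maximal family in an extremal one, whose size is at most the corresponding
  \<open>f1\<close>, \<open>f2\<close> or \<open>f3\<close>; a family of maximum size inside it must
  then be all of it.\<close>

lemma card_ksubsets_trace:
  assumes "finite V" "Q \<subseteq> V" "P \<subseteq> Q" "card P \<le> k"
  shows "card {F. F \<subseteq> V \<and> card F = k \<and> F \<inter> Q = P} = (card V - card Q) choose (k - card P)"
proof -
  have fQ: "finite Q" using finite_subset[OF assms(2,1)] .
  have fP: "finite P" using finite_subset[OF assms(3) fQ] .
  have "bij_betw (\<lambda>G. G \<union> P) {G. G \<subseteq> V - Q \<and> card G = k - card P}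
          {F. F \<subseteq> V \<and> card F = k \<and> F \<inter> Q = P}"
  proof (rule bij_betw_byWitness[where f' = "\<lambda>F. F - P"])
    show "(\<lambda>G. G \<union> P) ` {G. G \<subseteq> V - Q \<and> card G = k - card P} \<subseteq> {F. F \<subseteq> V \<and> card F = k \<and> F \<inter> Q = P}"
    proof (rule image_subsetI)
      fix G assume "G \<in> {G. G \<subseteq> V - Q \<and> card G = k - card P}"
      then have G: "G \<subseteq> V - Q" "card G = k - card P" by auto
      have "finite G" using G assms(1) finite_subset by blast
      moreover have "G \<inter> P = {}" using G assms by auto
      ultimately have "card (G \<union> P) = k" using G fP assms(4) by (simp add: card_Un_disjoint)
      then show "G \<union> P \<in> {F. F \<subseteq> V \<and> card F = k \<and> F \<inter> Q = P}" using G assms by auto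
    qed
    show "(\<lambda>F. F - P) ` {F. F \<subseteq> V \<and> card F = k \<and> F \<inter> Q = P} \<subseteq> {G. G \<subseteq> V - Q \<and> card G = k - card P}"
    proof (rule image_subsetI)
      fix F assume "F \<in> {F. F \<subseteq> V \<and> card F = k \<and> F \<inter> Q = P}"
      then have F: "F \<subseteq> V" "card F = k" "F \<inter> Q = P" by blast+
      have "P \<subseteq> F" using F(3) by blast
      then have "card (F - P) = k - card P" using fP F(2) by (simp add: card_Diff_subset)
      moreover have "F - P \<subseteq> V - Q" using F by blast
      ultimately show "F - P \<in> {G. G \<subseteq> V - Q \<and> card G = k - card P}" by blast
    qed
  qed (use assms(3) in blast)+
  then have "card {F. F \<subseteq> V \<and> card F = k \<and> F \<inter> Q = P} = card {G. G \<subseteq> V - Q \<and> card G = k - card P}"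
    by (simp add: bij_betw_same_card)
  also have "\<dots> = (card V - card Q) choose (k - card P)"
    using assms fQ by (simp add: n_subsets card_Diff_subset)
  finally show ?thesis .
qed

lemma card_ksubsets_superset:
  assumes "finite V" "S \<subseteq> V" "card S \<le> k"
  shows "card {F. F \<subseteq> V \<and> card F = k \<and> S \<subseteq> F} = (card V - card S) choose (k - card S)"
proof -
  have "{F. F \<subseteq> V \<and> card F = k \<and> S \<subseteq> F} = {F. F \<subseteq> V \<and> card F = k \<and> F \<inter> S = S}" by auto
  then show ?thesis using card_ksubsets_trace[OF assms(1,2) subset_refl assms(3)] by simp
qed

text \<open>The sets with trace \<open>P\<close> on \<open>Q\<close> that avoid \<open>B\<close> are
  those with trace \<open>P\<close> on the larger set \<open>Q \<union> B\<close>, so a difference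
  of two trace counts remains.\<close>

lemma card_ksubsets_trace_hit:
  assumes "finite V" "Q \<subseteq> V" "P \<subseteq> Q" "card P \<le> k" "B \<subseteq> V" "B \<inter> Q = {}"
  shows "int (card {F. F \<subseteq> V \<and> card F = k \<and> F \<inter> Q = P \<and> F \<inter> B \<noteq> {}}) =
    int ((card V - card Q) choose (k - card P)) - int ((card V - card Q - card B) choose (k - card P))"
proof -
  let ?A = "{F. F \<subseteq> V \<and> card F = k \<and> F \<inter> Q = P}"
  let ?B = "{F. F \<subseteq> V \<and> card F = k \<and> F \<inter> (Q \<union> B) = P}"
  have fin: "finite ?A" using assms(1) by (auto intro: finite_subset[of _ "Pow V"])
  have fQ: "finite Q" "finite B" using finite_subset[OF _ assms(1)] assms(2,5) by auto
  have sub: "?B \<subseteq> ?A" using assms by blast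
  have eq: "{F. F \<subseteq> V \<and> card F = k \<and> F \<inter> Q = P \<and> F \<inter> B \<noteq> {}} = ?A - ?B"
    using assms by blast
  have "card (Q \<union> B) = card Q + card B" using fQ assms by (simp add: card_Un_disjoint Int_commute)
  then have "card ?B = (card V - card Q - card B) choose (k - card P)"
    using card_ksubsets_trace[of V "Q \<union> B" P k] assms by auto
  moreover have "card ?A = (card V - card Q) choose (k - card P)"
    using card_ksubsets_trace[of V Q P k] assms by auto
  moreover have "card (?A - ?B) = card ?A - card ?B"
    using sub fin by (simp add: card_Diff_subset finite_subset)
  moreover have "card ?B \<le> card ?A" using sub fin by (rule card_mono[rotated])
  ultimately show ?thesis using eq by (simp add: of_nat_diff)
qed

text \<open>Double counting of the pairs \<open>(F, x)\<close> with \<open>S \<subseteq> F\<close>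
  and \<open>x \<in> F \<inter> F' - S\<close>. If \<open>S \<inter> F'\<close> is \<open>i\<close>
  points short of \<open>t\<close>, each \<open>F\<close> yields at least \<open>i\<close> pairs,
  while \<open>F' - S\<close> has \<open>k - t + i\<close> points. Dividing by \<open>i\<close>
  gives the factor \<open>(k - t + i) / i\<close>, which is at most
  \<open>k - t + 1\<close>.\<close>

lemma branching:
  fixes \<G> :: "'a set set"
  assumes "finite \<G>" "finite F'" "card F' = k" "t \<le> k" "card (S \<inter> F') < t"
    and inter: "\<And>F. F \<in> \<G> \<Longrightarrow> t \<le> card (F \<inter> F')"
    and bound: "\<And>x. x \<notin> S \<Longrightarrow> card {F \<in> \<G>. insert x S \<subseteq> F} \<le> b"
  shows "card {F \<in> \<G>. S \<subseteq> F} \<le> (k - t + 1) * b"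
proof -
  define i where "i = t - card (S \<inter> F')"
  define Y where "Y = F' - S"
  let ?H = "{F \<in> \<G>. S \<subseteq> F}"
  have i: "i \<ge> 1" using assms(5) by (simp add: i_def)
  have fY: "finite Y" using assms(2) by (simp add: Y_def)
  have "card F' = card (S \<inter> F') + card Y"
    unfolding Y_def using assms(2) by (metis Int_commute card_Int_Diff)
  then have cY: "card Y = (k - t) + i" using assms(3,4,5) by (simp add: i_def)
  have fH: "finite ?H" using assms(1) by simp
  have lower: "i \<le> card {x \<in> Y. x \<in> F}" if "F \<in> ?H" for F
  proof -
    have "F \<inter> F' = (S \<inter> F') \<union> {x \<in> Y. x \<in> F}" using that by (auto simp: Y_def)
    then have "card (F \<inter> F') \<le> card (S \<inter> F') + card {x \<in> Y. x \<in> F}"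
      by (metis card_Un_le)
    then show ?thesis using inter[of F] that by (simp add: i_def)
  qed
  have "i * card ?H = (\<Sum>F\<in>?H. i)" by simp
  also have "\<dots> \<le> (\<Sum>F\<in>?H. card {x \<in> Y. x \<in> F})" using lower by (intro sum_mono) auto
  also have "\<dots> = (\<Sum>x\<in>Y. card {F \<in> ?H. x \<in> F})"
    using sum_multicount_gen[OF fH fY, of "\<lambda>F x. x \<in> F" "\<lambda>x. card {F \<in> ?H. x \<in> F}"] by simp
  also have "\<dots> \<le> (\<Sum>x\<in>Y. b)"
  proof (rule sum_mono)
    fix x assume "x \<in> Y"
    then have "x \<notin> S" by (simp add: Y_def)
    moreover have "{F \<in> ?H. x \<in> F} = {F \<in> \<G>. insert x S \<subseteq> F}" by auto
    ultimately show "card {F \<in> ?H. x \<in> F} \<le> b" using bound by simp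
  qed
  also have "\<dots> = (k - t + i) * b" using cY by simp
  also have "\<dots> \<le> i * ((k - t + 1) * b)"
  proof -
    have "k - t \<le> i * (k - t)" using i by simp
    then have "k - t + i \<le> i * (k - t + 1)" by simp
    then show ?thesis by (metis mult.assoc mult_le_mono1)
  qed
  finally show ?thesis using i by simp
qed

lemma card_supersets_le:
  assumes "\<G> \<subseteq> ksets n k" "finite S" "card S \<le> k"
  shows "card {F \<in> \<G>. S \<subseteq> F} \<le> (n - card S) choose (k - card S)"
proof (cases "S \<subseteq> {1..n}")
  case True
  have "card {F \<in> \<G>. S \<subseteq> F} \<le> card {F. F \<subseteq> {1..n} \<and> card F = k \<and> S \<subseteq> F}"
    by (rule card_mono) (use assms in \<open>auto simp: ksets_def intro: finite_subset[of _ "Pow {1..n}"]\<close>)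
  then show ?thesis using card_ksubsets_superset[of "{1..n}" S k] True assms by simp
next
  case False
  then have "{F \<in> \<G>. S \<subseteq> F} = {}" using assms by (auto simp: ksets_def)
  then have "card {F \<in> \<G>. S \<subseteq> F} = 0" by (metis card.empty)
  then show ?thesis by linarith
qed

lemma finite_ksets: "finite (ksets n k)"
  by (rule finite_subset[of _ "Pow {1..n}"]) (auto simp: ksets_def)

text \<open>Pascal's rule \<open>j\<close> times, each difference bounded by the largest one.
  Truncated subtraction covers \<open>j > N\<close>: once the upper index is 0, nothing more is
  lost.\<close>

lemma choose_le_shift:
  assumes "0 < r"
  shows "N choose r \<le> ((N - j) choose r) + j * ((N - 1) choose (r - 1))"
proof (induction j)
  case (Suc j)
  show ?case
  proof (cases "N - j")
    case 0
    then show ?thesis using Suc by simp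
  next
    case (Suc p)
    have "(N - j) choose r = (p choose r) + (p choose (r - 1))"
      using assms Suc by (cases r) auto
    moreover have "p choose (r - 1) \<le> (N - 1) choose (r - 1)"
      using Suc by (intro binomial_right_mono) auto
    moreover have "N - Suc j = p" using Suc by simp
    ultimately show ?thesis using Suc.IH by simp
  qed
qed simp

text \<open>The same telescoping, each difference bounded by the smallest one.\<close>

lemma choose_ge_shift:
  assumes "0 < r" "j \<le> N"
  shows "((N - j) choose r) + j * ((N - j) choose (r - 1)) \<le> N choose r"
  using assms(2)
proof (induction j)
  case (Suc j)
  obtain p where p: "N - j = Suc p" using Suc.prems by (metis Suc_diff_Suc Suc_le_lessD)
  have "(N - j) choose r = (p choose r) + (p choose (r - 1))"
    using assms(1) p by (cases r) auto
  moreover have "p choose (r - 1) \<le> (N - j) choose (r - 1)" using p by (intro binomial_right_mono) auto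
  moreover have "N - Suc j = p" using p by simp
  moreover have "j * (p choose (r - 1)) \<le> j * ((N - j) choose (r - 1))"
    using calculation(2) by simp
  moreover have "(N - j choose r) + j * (N - j choose (r - 1)) \<le> N choose r" using Suc by simp
  moreover have "Suc j * (p choose (r - 1)) = (p choose (r - 1)) + j * (p choose (r - 1))" by simp
  ultimately show ?case by (simp only:)
qed simp

section \<open>Lower bounds for the three extremal sizes\<close>

lemma choose_eq_sum_shift:
  assumes "0 < r" "j \<le> N"
  shows "N choose r = ((N - j) choose r) + (\<Sum>i<j. (N - 1 - i) choose (r - 1))"
  using assms(2)
proof (induction j)
  case (Suc j)
  obtain p where p: "N - j = Suc p" using Suc.prems by (metis Suc_diff_Suc Suc_le_lessD)
  have "(N - j) choose r = (p choose r) + (p choose (r - 1))"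
    using assms(1) p by (cases r) auto
  moreover have "N - Suc j = p" "N - 1 - j = p" using p by simp_all
  ultimately show ?case using Suc by simp
qed simp

text \<open>A discrete second derivative: the \<open>j\<close> summands of
  \<open>choose_eq_sum_shift\<close> for \<open>N\<close> and for \<open>N - j\<close> are compared
  one by one, and each gap is again at least \<open>j\<close> binomials with lower index
  \<open>r - 2\<close>. This supplies the coefficient \<open>m^2\<close> in the size of a Type I
  family.\<close>

lemma choose_second_difference:
  assumes "2 \<le> r" "2 * j \<le> N"
  shows "2 * ((N - j) choose r) + j^2 * ((N - 2*j) choose (r - 2)) \<le> (N choose r) + ((N - 2*j) choose r)"
proof -
  have e1: "N choose r = ((N - j) choose r) + (\<Sum>i<j. (N - 1 - i) choose (r - 1))"
    using assms by (intro choose_eq_sum_shift) auto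
  have "(N - j) choose r = ((N - j - j) choose r) + (\<Sum>i<j. (N - j - 1 - i) choose (r - 1))"
    using assms by (intro choose_eq_sum_shift) auto
  then have e2: "(N - j) choose r = ((N - 2*j) choose r) + (\<Sum>i<j. (N - j - 1 - i) choose (r - 1))"
    by (simp add: mult_2)
  have "(\<Sum>i<j. (N - j - 1 - i) choose (r - 1)) + j^2 * ((N - 2*j) choose (r - 2))
      = (\<Sum>i<j. ((N - j - 1 - i) choose (r - 1)) + j * ((N - 2*j) choose (r - 2)))"
    by (simp add: sum.distrib power2_eq_square)
  also have "\<dots> \<le> (\<Sum>i<j. (N - 1 - i) choose (r - 1))"
  proof (rule sum_mono)
    fix i assume "i \<in> {..<j}"
    then have i: "i < j" by simp
    have "((N - 1 - i - j) choose (r - 1)) + j * ((N - 1 - i - j) choose (r - 1 - 1)) \<le> (N - 1 - i) choose (r - 1)"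
      using assms i by (intro choose_ge_shift) auto
    moreover have "(N - 2*j) choose (r - 2) \<le> (N - 1 - i - j) choose (r - 1 - 1)"
      using i assms by (simp add: numeral_2_eq_2 binomial_right_mono)
    then have "j * ((N - 2*j) choose (r - 2)) \<le> j * ((N - 1 - i - j) choose (r - 1 - 1))" by (rule mult_le_mono2)
    ultimately have "((N - 1 - i - j) choose (r - 1)) + j * ((N - 2*j) choose (r - 2)) \<le> (N - 1 - i) choose (r - 1)"
      by linarith
    moreover have "N - 1 - i - j = N - j - 1 - i" by simp
    ultimately show "((N - j - 1 - i) choose (r - 1)) + j * ((N - 2*j) choose (r - 2)) \<le> (N - 1 - i) choose (r - 1)"
      by (simp only:)
  qed
  finally show ?thesis using e1 e2 by linarith
qed

lemma ibinom_of_nat: "ibinom (int a) (int b) = int (a choose b)"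
  by (simp add: ibinom_def)

text \<open>With \<open>N = n - t - 1\<close> the summands follow the parts of a Type I family: the
  second difference belongs to the sets that meet both \<open>B\<close> and \<open>C\<close>, the
  next difference to the sets that contain \<open>A \<union> T\<close> and meet
  \<open>B \<union> {u}\<close>, and 3 to the exceptional sets.\<close>

lemma f1_eq:
  assumes "1 \<le> m" "2 * m \<le> N"
  shows "f1 (N + t + 1) (t + m) t =
    (int (N choose m) - 2 * int ((N - m) choose m) + int ((N - 2*m) choose m))
    + (int (N choose (m - 1)) - int ((N - m - 1) choose (m - 1))) + 3"
proof -
  have e: "int (N + t + 1) - int t = int (N + 1)" "int (t + m) - int t = int m"
    "int (N + t + 1) - int (t + m) - 1 = int (N - m)"
    "int (N + t + 1) - int (t + m) - 2 = int (N - m - 1)"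
    "int (N + t + 1) - 2 * int (t + m) + int t - 1 = int (N - 2*m)"
    using assms by auto
  obtain p where p: "m = Suc p" using assms(1) by (cases m) auto
  have "(N + 1) choose m = (N choose m) + (N choose (m - 1))" using p by simp
  moreover have "(N - m) choose m = ((N - m - 1) choose m) + ((N - m - 1) choose (m - 1))"
  proof -
    obtain q where "N - m = Suc q" using assms by (cases "N - m") auto
    then show ?thesis using p by simp
  qed
  ultimately show ?thesis unfolding f1_def Let_def e ibinom_of_nat by linarith
qed

lemma f2_eq:
  assumes "2 \<le> m" "m \<le> N"
  shows "f2 (N + t + 2) (t + m) t = int (N choose (m - 2))
    + int (t + 2) * (int (N choose (m - 1)) - int ((N - m) choose (m - 1))) + int ((t + 2) choose 2)"
proof -
  have e: "int (N + t + 2) - int t - 2 = int N" "int (t + m) - int t - 2 = int (m - 2)"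
    "int (t + m) - int t - 1 = int (m - 1)"
    "int (N + t + 2) - int (t + m) - 2 = int (N - m)" "int t + 2 = int (t + 2)"
    using assms by auto
  have "ibinom (int (t + 2)) 2 = int ((t + 2) choose 2)" using ibinom_of_nat[of "t + 2" 2] by simp
  then show ?thesis unfolding f2_def Let_def e ibinom_of_nat by simp
qed

text \<open>For \<open>m = 3\<close> the last \<open>ibinom\<close> has lower index -1 and vanishes,
  whereas the natural number \<open>m - 4\<close> is 0 and would give 1; hence the case
  distinction.\<close>

lemma f3_eq:
  assumes "3 \<le> m"
  shows "f3 (N + t + 4) (t + m) t = int ((t + 4) choose 2) * int (N choose (m - 2))
    + int (t + 4) * int (N choose (m - 3)) + (if m = 3 then 0 else int (N choose (m - 4)))"
proof -
  have e: "int (N + t + 4) - int t - 4 = int N" "int (t + m) - int t - 2 = int (m - 2)"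
    "int (t + m) - int t - 3 = int (m - 3)" "int t + 4 = int (t + 4)"
    using assms by auto
  have "ibinom (int (t + 4)) 2 = int ((t + 4) choose 2)" using ibinom_of_nat[of "t + 4" 2] by simp
  moreover have "ibinom (int N) (int (t + m) - int t - 4) = (if m = 3 then 0 else int (N choose (m - 4)))"
  proof (cases "m = 3")
    case True
    then show ?thesis by (simp add: ibinom_def)
  next
    case False
    then have "int (t + m) - int t - 4 = int (m - 4)" using assms by simp
    then have "ibinom (int N) (int (t + m) - int t - 4) = int (N choose (m - 4))"
      by (simp only: ibinom_of_nat)
    then show ?thesis using False by (simp only: if_False)
  qed
  ultimately show ?thesis unfolding f3_def Let_def e ibinom_of_nat by (simp only:)
qed

text \<open>\<open>m^2\<close> comes from the second difference and \<open>m + 1\<close> from the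
  sets meeting \<open>B \<union> {u}\<close>. Raising the upper indices to \<open>n - t - 2\<close>
  costs \<open>m^2 (2m - 1) + (m + 1) m = 2m^3 + m\<close> copies of the binomial with both indices
  one smaller.\<close>

lemma f1_lower:
  assumes "3 \<le> m" "t + 2 * m + 1 \<le> n"
  shows "int ((m^2 + m + 1) * ((n - t - 2) choose (m - 2)))
    \<le> f1 n (t + m) t + int ((2 * m^3 + m) * ((n - t - 3) choose (m - 3)))"
proof -
  define N where "N = n - t - 1"
  have n: "n = N + t + 1" and N: "2 * m \<le> N" using assms by (auto simp: N_def)
  define D where "D = (N - 1) choose (m - 2)"
  define D' where "D' = (N - 2) choose (m - 3)"
  have D: "(n - t - 2) choose (m - 2) = D" "(n - t - 3) choose (m - 3) = D'"
    unfolding D_def D'_def n by (simp_all add: numeral_2_eq_2 numeral_3_eq_3)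
  have idx: "m - 2 - 1 = m - 3" "N - 1 - 1 = N - 2" "m - 1 - 1 = m - 2" using assms by auto
  have a1: "2 * ((N - m) choose m) + m^2 * ((N - 2*m) choose (m - 2)) \<le> (N choose m) + ((N - 2*m) choose m)"
    using assms N by (intro choose_second_difference) auto
  have a2: "D \<le> ((N - 2*m) choose (m - 2)) + (2*m - 1) * D'"
  proof -
    have "N - 1 - (2*m - 1) = N - 2*m" using assms by simp
    then show ?thesis using choose_le_shift[of "m - 2" "N - 1" "2*m - 1"] assms
      unfolding D_def D'_def idx by simp
  qed
  have a3: "((N - m - 1) choose (m - 1)) + (m + 1) * ((N - m - 1) choose (m - 2)) \<le> N choose (m - 1)"
    using choose_ge_shift[of "m - 1" "m + 1" N] assms N unfolding idx by simp
  have a4: "D \<le> ((N - m - 1) choose (m - 2)) + m * D'"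
  proof -
    have "N - 1 - m = N - m - 1" by simp
    then show ?thesis using choose_le_shift[of "m - 2" "N - 1" "m"] assms
      unfolding D_def D'_def idx by simp
  qed
  have "m^2 * D \<le> m^2 * ((N - 2*m) choose (m - 2)) + m^2 * ((2*m - 1) * D')"
    using a2 by (metis add_mult_distrib2 mult_le_mono2)
  moreover have "(m + 1) * D \<le> (m + 1) * ((N - m - 1) choose (m - 2)) + (m + 1) * (m * D')"
    using a4 by (metis add_mult_distrib2 mult_le_mono2)
  moreover have "m^2 * ((2*m - 1) * D') + (m + 1) * (m * D') = (2 * m^3 + m) * D'"
  proof -
    obtain p where "m = Suc p" using assms by (cases m) auto
    then show ?thesis by (simp add: algebra_simps power2_eq_square power3_eq_cube)
  qed
  moreover have "(m^2 + m + 1) * D = m^2 * D + (m + 1) * D" by (simp add: algebra_simps)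
  ultimately have "(m^2 + m + 1) * D + 2 * ((N - m) choose m) + ((N - m - 1) choose (m - 1))
     \<le> (N choose m) + ((N - 2*m) choose m) + (N choose (m - 1)) + (2 * m^3 + m) * D'"
    using a1 a3 by linarith
  then have "int ((m^2 + m + 1) * D + 2 * ((N - m) choose m) + ((N - m - 1) choose (m - 1)))
     \<le> int ((N choose m) + ((N - 2*m) choose m) + (N choose (m - 1)) + (2 * m^3 + m) * D')"
    by (simp only: of_nat_le_iff)
  then have "int ((m^2 + m + 1) * D) + 2 * int ((N - m) choose m) + int ((N - m - 1) choose (m - 1))
     \<le> int (N choose m) + int ((N - 2*m) choose m) + int (N choose (m - 1)) + int ((2 * m^3 + m) * D')"
    by (simp only: of_nat_add of_nat_mult of_nat_numeral)
  moreover have "f1 n (t + m) t = (int (N choose m) - 2 * int ((N - m) choose m) + int ((N - 2*m) choose m))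
    + (int (N choose (m - 1)) - int ((N - m - 1) choose (m - 1))) + 3"
    unfolding n using assms N by (intro f1_eq) auto
  ultimately show ?thesis unfolding D by linarith
qed

lemma f2_lower:
  assumes "3 \<le> m" "t + m + 2 \<le> n"
  shows "int (((t + 2) * m + 1) * ((n - t - 2) choose (m - 2)))
    \<le> f2 n (t + m) t + int ((t + 2) * m^2 * ((n - t - 3) choose (m - 3)))"
proof -
  define N where "N = n - t - 2"
  have n: "n = N + t + 2" and N: "m \<le> N" using assms by (auto simp: N_def)
  define D where "D = N choose (m - 2)"
  define D' where "D' = (N - 1) choose (m - 3)"
  have D: "(n - t - 2) choose (m - 2) = D" "(n - t - 3) choose (m - 3) = D'"
    unfolding D_def D'_def n by (simp_all add: numeral_2_eq_2 numeral_3_eq_3)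
  have idx: "m - 2 - 1 = m - 3" "m - 1 - 1 = m - 2" using assms by auto
  have a3: "((N - m) choose (m - 1)) + m * ((N - m) choose (m - 2)) \<le> N choose (m - 1)"
    using choose_ge_shift[of "m - 1" "m" N] assms N unfolding idx by simp
  have a4: "D \<le> ((N - m) choose (m - 2)) + m * D'"
    using choose_le_shift[of "m - 2" "N" "m"] assms unfolding D_def D'_def idx by simp
  have "m * D \<le> m * ((N - m) choose (m - 2)) + m * (m * D')"
    using a4 by (metis add_mult_distrib2 mult_le_mono2)
  then have "((N - m) choose (m - 1)) + m * D \<le> (N choose (m - 1)) + m^2 * D'"
    using a3 by (simp add: power2_eq_square)
  then have "int (m * D) \<le> (int (N choose (m - 1)) - int ((N - m) choose (m - 1))) + int (m^2 * D')"
    by linarith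
  then have "int (t + 2) * int (m * D) \<le> int (t + 2) * ((int (N choose (m - 1)) - int ((N - m) choose (m - 1))) + int (m^2 * D'))"
    by (intro mult_left_mono) auto
  also have "\<dots> = int (t + 2) * (int (N choose (m - 1)) - int ((N - m) choose (m - 1))) + int ((t + 2) * m^2 * D')"
    by (simp add: algebra_simps)
  finally have "int (t + 2) * int (m * D) \<le> \<dots>" .
  moreover have "int (((t + 2) * m + 1) * D) = int (t + 2) * int (m * D) + int D"
    by (simp add: algebra_simps)
  moreover have "f2 n (t + m) t = int (N choose (m - 2))
    + int (t + 2) * (int (N choose (m - 1)) - int ((N - m) choose (m - 1))) + int ((t + 2) choose 2)"
    unfolding n using assms N by (intro f2_eq) auto
  ultimately show ?thesis unfolding D D_def by linarith
qed

lemma f3_lower: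
  assumes "3 \<le> m" "t + 4 \<le> n"
  shows "int (((t + 4) choose 2) * ((n - t - 2) choose (m - 2)))
    \<le> f3 n (t + m) t + int (2 * ((t + 4) choose 2) * ((n - t - 3) choose (m - 3)))"
proof -
  define N where "N = n - t - 4"
  have n: "n = N + t + 4" using assms by (auto simp: N_def)
  have a: "(N + 2) choose (m - 2) \<le> (N choose (m - 2)) + 2 * ((N + 1) choose (m - 3))"
    using choose_le_shift[of "m - 2" "N + 2" 2] assms by (simp add: numeral_3_eq_3)
  have D: "(n - t - 2) choose (m - 2) = (N + 2) choose (m - 2)" "(n - t - 3) choose (m - 3) = (N + 1) choose (m - 3)"
  proof -
    have "n - t - 2 = N + 2" "n - t - 3 = N + 1" unfolding n by auto
    then show "(n - t - 2) choose (m - 2) = (N + 2) choose (m - 2)"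
      "(n - t - 3) choose (m - 3) = (N + 1) choose (m - 3)" by simp_all
  qed
  have "((t + 4) choose 2) * ((N + 2) choose (m - 2)) \<le> ((t + 4) choose 2) * ((N choose (m - 2)) + 2 * ((N + 1) choose (m - 3)))"
    using a by (rule mult_le_mono2)
  then have "int (((t + 4) choose 2) * ((N + 2) choose (m - 2))) \<le> int (((t + 4) choose 2) * ((N choose (m - 2)) + 2 * ((N + 1) choose (m - 3))))"
    by (simp only: of_nat_le_iff)
  also have "\<dots> = int ((t + 4) choose 2) * int (N choose (m - 2)) + int (2 * ((t + 4) choose 2) * ((N + 1) choose (m - 3)))"
    by (simp only: of_nat_add of_nat_mult of_nat_numeral) (simp add: algebra_simps)
  finally have "int (((t + 4) choose 2) * ((N + 2) choose (m - 2))) \<le> \<dots>" .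
  moreover have "f3 n (t + m) t \<ge> int ((t + 4) choose 2) * int (N choose (m - 2))"
    unfolding n f3_eq[OF assms(1)] by simp
  ultimately show ?thesis unfolding D by linarith
qed

section \<open>Error terms against the main term\<close>

lemma choose_two_step: "(t + 3) choose 2 = ((t + 2) choose 2) + (t + 2)"
  by (simp add: numeral_2_eq_2 numeral_3_eq_3)

lemma choose_two_step2: "(t + 4) choose 2 = ((t + 2) choose 2) + 2 * (t + 2) + 1"
  by (simp add: numeral_2_eq_2 numeral_3_eq_3 eval_nat_numeral)

text \<open>After multiplication by \<open>m - 2\<close> the claim compares the factor on the left
  with \<open>n - t - 2\<close>. Of the four factors \<open>m + 1\<close> in the bound on
  \<open>n\<close>, three are the cube on the left, and the fourth exceeds \<open>m - 2\<close> by
  3. This excess makes room for the summand \<open>2 * ((t + 2) choose 2)\<close> of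
  \<open>loss\<close>, which the third extremal size requires.\<close>

lemma main_term_dominates:
  assumes "3 \<le> m" "((t + 3) choose 2) * (m + 1)^4 \<le> n"
    and "loss \<le> (t + 2) * (m + 1)^3 + 2 * ((t + 2) choose 2)"
  shows "(((t + 2) choose 2) * (m + 1)^3 + loss) * ((n - t - 3) choose (m - 3)) < (n - t - 2) choose (m - 2)"
proof -
  define a where "a = (t + 2) choose 2"
  define q where "q = (m + 1)^3"
  define D where "D = (n - t - 2) choose (m - 2)"
  define D' where "D' = (n - t - 3) choose (m - 3)"
  obtain p where p: "m = p + 3" using assms(1) by (metis le_add_diff_inverse2)
  have q: "q \<ge> m + 1" unfolding q_def using self_le_power[of "m + 1" 3] by simp
  have n: "(a + t + 2) * (q * (p + 4)) \<le> n"
    using assms(2) unfolding choose_two_step a_def q_def p by (simp add: power4_eq_xxxx power3_eq_cube algebra_simps)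
  have "(a * q + loss) * (p + 1) + (t + 2) \<le> (a * q + ((t + 2) * q + 2 * a)) * (p + 1) + (t + 2)"
    using assms(3) unfolding a_def q_def by (intro add_le_mono mult_le_mono) auto
  also have "\<dots> = a * q * (p + 1) + (t + 2) * q * (p + 1) + 2 * (a * (p + 1)) + (t + 2)"
    by (simp add: algebra_simps)
  finally have "(a * q + loss) * (p + 1) + (t + 2) \<le> \<dots>" .
  moreover have "a * (p + 1) \<le> a * q" using q p by (intro mult_le_mono2) simp
  moreover have "t + 2 \<le> (t + 2) * q" using q mult_le_mono2[of 1 q "t + 2"] by simp
  ultimately have "(a * q + loss) * (p + 1) + (t + 2) \<le> a * q * (p + 1) + (t + 2) * q * (p + 1) + 2 * (a * q) + (t + 2) * q"
    by linarith
  also have "\<dots> < a * q * (p + 4) + (t + 2) * q * (p + 4)"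
  proof -
    have "0 < (t + 2) * q" using q by simp
    then show ?thesis by (simp add: algebra_simps)
  qed
  also have "\<dots> = (a + t + 2) * (q * (p + 4))" by (simp add: algebra_simps)
  finally have less: "(a * q + loss) * (p + 1) + (t + 2) < n" using n by simp
  have D'pos: "0 < D'"
  proof -
    have "n > (t + 2) + p"
    proof -
      have "p + t + 2 < (a + t + 2) * (q * (p + 4))"
      proof -
        have "p + (t + 2) < (t + 2) * (p + 4)" by (simp add: algebra_simps)
        also have "\<dots> \<le> (a + t + 2) * (q * (p + 4))" using q by (intro mult_le_mono) auto
        finally show ?thesis by simp
      qed
      then show ?thesis using n by simp
    qed
    then show ?thesis unfolding D'_def p by (intro zero_less_binomial) simp
  qed
  have absorb: "(p + 1) * D = (n - t - 2) * D'"
  proof -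
    obtain r where r: "n - t - 2 = Suc r" using less by (metis Suc_diff_Suc add.commute diff_diff_left less_add_same_cancel2 not_less_eq zero_less_diff add_lessD1)
    have "n - t - 3 = r" using r by simp
    then show ?thesis unfolding D_def D'_def p r using Suc_times_binomial_eq[of r p] by (simp add: mult.commute)
  qed
  have "(p + 1) * ((a * q + loss) * D') < (p + 1) * D"
  proof -
    have "(a * q + loss) * (p + 1) < n - t - 2" using less by simp
    then have "(a * q + loss) * (p + 1) * D' < (n - t - 2) * D'" using D'pos by simp
    then show ?thesis unfolding absorb by (simp add: ac_simps)
  qed
  then have "(a * q + loss) * D' < D" by (metis mult_less_cancel1)
  then show ?thesis unfolding a_def q_def D_def D'_def .
qed

text \<open>A deficit of one in the coefficient leaves a whole \<open>D\<close>, which pays for the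
  error \<open>r * D'\<close> of the upper bound and the error \<open>l * D'\<close> of the lower
  bound together.\<close>

lemma lt_of_lower_bound:
  fixes f :: int
  assumes "int (c * D) \<le> f + int (l * D')" "(r + l) * D' < D" "s \<le> c' * D + r * D'" "c' < c"
  shows "int s < f"
proof -
  have "c' * D + D \<le> c * D" using assms(4) by (metis Suc_leI add.commute mult_Suc mult_le_mono1)
  moreover have "r * D' + l * D' < D" using assms(2) by (simp add: add_mult_distrib)
  ultimately have "int s + int (l * D') < int (c * D)" using assms(3) by (simp only: of_nat_add[symmetric] of_nat_less_iff)
  then show ?thesis using assms(1) by linarith
qed

text \<open>Turns a comparison of sizes into a comparison of coefficients; \<open>c\<close> will be
  the number of covers of size \<open>t + 2\<close>. It is enough to beat one of the three extremal
  sizes, and the error of each fits into the \<open>loss\<close> of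
  \<open>main_term_dominates\<close>.\<close>

lemma few_covers_imp_small:
  assumes "3 \<le> m" "((t + 3) choose 2) * (m + 1)^4 \<le> n" "0 < t"
    and s: "s \<le> c * ((n - t - 2) choose (m - 2)) + ((t + 2) choose 2) * (m + 1)^3 * ((n - t - 3) choose (m - 3))"
    and c: "c < max (m^2 + m + 1) (max ((t + 2) * m + 1) ((t + 4) choose 2))"
  shows "int s < max (f1 n (t + m) t) (max (f2 n (t + m) t) (f3 n (t + m) t))"
proof -
  have n: "t + 2 * m + 4 \<le> n"
  proof -
    have "(t + 2 * m + 4) \<le> (t + 2) * (m + 1)"
      using mult_le_mono[of 3 m 1 t] assms(1,3) by (simp add: algebra_simps)
    also have "\<dots> \<le> ((t + 3) choose 2) * (m + 1)^4"
      unfolding choose_two_step by (intro mult_le_mono) (use self_le_power[of "m + 1" 4] in auto)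
    finally show ?thesis using assms(2) by simp
  qed
  consider "c < m^2 + m + 1" | "c < (t + 2) * m + 1" | "c < (t + 4) choose 2" using c by linarith
  then show ?thesis
  proof cases
    case 1
    have "2 * m^3 + m \<le> 2 * (m + 1)^3" by (simp add: power3_eq_cube algebra_simps)
    also have "\<dots> \<le> (t + 2) * (m + 1)^3" by simp
    finally have "2 * m^3 + m \<le> (t + 2) * (m + 1)^3 + 2 * ((t + 2) choose 2)" by simp
    from main_term_dominates[OF assms(1,2) this]
    have "int s < f1 n (t + m) t"
      by (rule lt_of_lower_bound[OF f1_lower[OF assms(1)] _ s 1, rotated]) (use n in simp)
    then show ?thesis by simp
  next
    case 2
    have "m^2 \<le> (m + 1)^3" by (simp add: power3_eq_cube power2_eq_square algebra_simps)
    then have "(t + 2) * m^2 \<le> (t + 2) * (m + 1)^3" by (rule mult_le_mono2)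
    then have "(t + 2) * m^2 \<le> (t + 2) * (m + 1)^3 + 2 * ((t + 2) choose 2)" by linarith
    from main_term_dominates[OF assms(1,2) this]
    have "int s < f2 n (t + m) t"
      by (rule lt_of_lower_bound[OF f2_lower[OF assms(1)] _ s 2, rotated]) (use n in simp)
    then show ?thesis by simp
  next
    case 3
    have "6 \<le> (m + 1)^3" using power_mono[of 4 "m + 1" 3] assms(1) by simp
    then have "(t + 2) * 6 \<le> (t + 2) * (m + 1)^3" by (rule mult_le_mono2)
    then have "4 * (t + 2) + 2 \<le> (t + 2) * (m + 1)^3" by (rule le_trans[rotated]) simp
    then have "4 * (t + 2) + 2 + 2 * ((t + 2) choose 2) \<le> (t + 2) * (m + 1)^3 + 2 * ((t + 2) choose 2)"
      by (rule add_le_mono1)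
    moreover have "2 * ((t + 4) choose 2) = 4 * (t + 2) + 2 + 2 * ((t + 2) choose 2)"
      unfolding choose_two_step2 by simp
    ultimately have "2 * ((t + 4) choose 2) \<le> (t + 2) * (m + 1)^3 + 2 * ((t + 2) choose 2)" by (simp only:)
    from main_term_dominates[OF assms(1,2) this]
    have "int s < f3 n (t + m) t"
      by (rule lt_of_lower_bound[OF f3_lower[OF assms(1)] _ s 3, rotated]) (use n in simp)
    then show ?thesis by simp
  qed
qed

text \<open>The bound on \<open>s\<close> is what repeated branching gives when the smallest cover
  has \<open>t + j\<close> points. It does not increase with \<open>j\<close>, so
  \<open>j = 3\<close> is the worst case, and there
  \<open>3 * (t+3 choose 3) = (t + 3) * (t+2 choose 2)\<close> leaves fewer than
  \<open>(t+4 choose 2)\<close> copies of the main binomial.\<close>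

lemma large_tau_bound_small:
  assumes "3 \<le> m" "((t + 3) choose 2) * (m + 1)^4 \<le> n" "0 < t" "3 \<le> j" "j \<le> m"
    and s: "s \<le> ((t + j) choose j) * ((m + 1)^j * ((n - t - j) choose (m - j)))"
  shows "int s < max (f1 n (t + m) t) (max (f2 n (t + m) t) (f3 n (t + m) t))"
proof -
  define g where "g j = ((t + j) choose j) * ((m + 1)^j * ((n - t - j) choose (m - j)))" for j
  \<comment> \<open>The ratio \<open>g (i + 1) / g i\<close> is
    \<open>(t + i + 1) (m + 1) (m - i) / ((i + 1) (n - t - i))\<close>, at most
    \<open>(t + 1) (m + 1) m / (n - t - m)\<close>; this inequality makes it at most 1.\<close>
  have n: "t + m + (t + 1) * (m + 1) * m \<le> n"
  proof -
    have b: "t + 2 \<le> (t + 3) choose 2" unfolding choose_two_step by simp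
    have "t + m + (t + 1) * (m + 1) * m \<le> (t + 2) * (m + 1)^2" by (simp add: power2_eq_square algebra_simps)
    also have "\<dots> \<le> ((t + 3) choose 2) * (m + 1)^4" using b by (intro mult_le_mono power_increasing) auto
    finally show ?thesis using assms(2) by simp
  qed
  have step: "g (Suc i) \<le> g i" if i: "i < m" for i
  proof -
    obtain b where b: "n - t - i = Suc b" using i n by (metis Suc_diff_Suc diff_diff_left le_add1 le_less_trans add_less_cancel_left less_le_trans)
    obtain p where p: "m - i = Suc p" using i by (metis Suc_diff_Suc)
    have b': "n - t - Suc i = b" "m - Suc i = p" using b p by auto
    have e1: "Suc i * ((t + Suc i) choose Suc i) = (t + Suc i) * ((t + i) choose i)"
      using Suc_times_binomial_eq[of "t + i" i] by (simp add: mult.commute)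
    have e2: "Suc b * (b choose p) = Suc p * (Suc b choose Suc p)" using Suc_times_binomial_eq[of b p] by (simp add: mult.commute)
    have "(t + Suc i) * (m + 1) * Suc p \<le> Suc i * Suc b"
    proof -
      have "(t + Suc i) * (m + 1) * Suc p \<le> (Suc i * (t + 1)) * (m + 1) * m"
        using p by (intro mult_le_mono) auto
      also have "\<dots> = Suc i * ((t + 1) * (m + 1) * m)" by (simp add: algebra_simps)
      also have "\<dots> \<le> Suc i * Suc b" using n b i by (intro mult_le_mono2) linarith
      finally show ?thesis .
    qed
    have "Suc i * Suc b * g (Suc i) = (Suc i * ((t + Suc i) choose Suc i)) * ((m + 1)^Suc i * (Suc b * (b choose p)))"
      unfolding g_def b' by (simp only: ac_simps)
    also have "\<dots> = (t + Suc i) * ((t + i) choose i) * ((m + 1)^Suc i * (Suc p * (Suc b choose Suc p)))"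
      unfolding e1 e2 ..
    also have "\<dots> = ((t + Suc i) * (m + 1) * Suc p) * g i"
      unfolding g_def b p power_Suc by (simp only: ac_simps)
    also have "\<dots> \<le> Suc i * Suc b * g i" using \<open>(t + Suc i) * (m + 1) * Suc p \<le> Suc i * Suc b\<close> by (rule mult_le_mono1)
    finally show ?thesis by (metis mult_le_cancel1 nat_0_less_mult_iff zero_less_Suc)
  qed
  have "g j \<le> g 3" using assms(4,5)
  proof (induction j rule: dec_induct)
    case (step i)
    then show ?case using \<open>\<And>i. i < m \<Longrightarrow> g (Suc i) \<le> g i\<close>[of i] by simp
  qed simp
  define D where "D = (n - t - 2) choose (m - 2)"
  define D' where "D' = (n - t - 3) choose (m - 3)"
  have dom: "((t + 2) choose 2) * (m + 1)^3 * D' < D"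
    using main_term_dominates[OF assms(1,2), of 0] by (simp add: D_def D'_def)
  have "3 * ((t + 3) choose 3) = (t + 3) * ((t + 2) choose 2)"
    using Suc_times_binomial_eq[of "t + 2" 2] by (simp add: eval_nat_numeral algebra_simps)
  then have "3 * g 3 = (t + 3) * (((t + 2) choose 2) * (m + 1)^3 * D')"
    unfolding g_def D'_def by (metis mult.assoc)
  also have "\<dots> \<le> (t + 3) * D" using dom by (intro mult_le_mono2) simp
  also have "\<dots> \<le> 3 * ((((t + 4) choose 2) - 1) * D)" unfolding choose_two_step2 by (simp add: algebra_simps)
  finally have "g 3 \<le> (((t + 4) choose 2) - 1) * D" by simp
  then have "s \<le> (((t + 4) choose 2) - 1) * ((n - t - 2) choose (m - 2)) + ((t + 2) choose 2) * (m + 1)^3 * ((n - t - 3) choose (m - 3))"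
    using s \<open>g j \<le> g 3\<close> unfolding g_def D_def by linarith
  moreover have "((t + 4) choose 2) - 1 < max (m^2 + m + 1) (max ((t + 2) * m + 1) ((t + 4) choose 2))"
    unfolding choose_two_step2 by simp
  ultimately show ?thesis by (rule few_covers_imp_small[OF assms(1,2,3)])
qed

section \<open>Pairs meeting an intersecting family\<close>

lemma pair_eqI:
  assumes "card e = 2" "p \<in> e" "q \<in> e" "p \<noteq> q"
  shows "e = {p, q}"
  using assms by (auto simp: card_2_iff)

lemma other_of_pair:
  assumes "card e = 2" "p \<in> e"
  obtains q where "q \<noteq> p" "e = {p, q}"
  using assms by (metis card_2_iff insert_commute insert_iff singletonD)

lemma card_pairs_between_le:
  assumes "finite B" "finite C"
  shows "finite {{b, c} |b c. b \<in> B \<and> c \<in> C}" "card {{b, c} |b c. b \<in> B \<and> c \<in> C} \<le> card B * card C"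
proof -
  have eq: "{{b, c} |b c. b \<in> B \<and> c \<in> C} = (\<lambda>(b, c). {b, c}) ` (B \<times> C)" by auto
  show "finite {{b, c} |b c. b \<in> B \<and> c \<in> C}" unfolding eq using assms by simp
  show "card {{b, c} |b c. b \<in> B \<and> c \<in> C} \<le> card B * card C"
    unfolding eq using card_image_le[of "B \<times> C" "\<lambda>(b, c). {b, c}"] assms by (simp add: card_cartesian_product)
qed

text \<open>A graph \<open>E\<close> whose edges are transversals of an intersecting
  \<open>(m + 1)\<close>-uniform system without common point. It is used for covers sharing a
  \<open>t\<close>-set and, with \<open>m = 2\<close>, for the triples of
  \<open>link_system\<close>.\<close>

locale pair_cover =
  fixes m :: nat and \<H> :: "'a set set" and E :: "'a set set"
  assumes m: "2 \<le> m"
    and \<H>_ne: "\<H> \<noteq> {}"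
    and card_\<H>: "H \<in> \<H> \<Longrightarrow> card H = m + 1"
    and inter: "H \<in> \<H> \<Longrightarrow> H' \<in> \<H> \<Longrightarrow> H \<inter> H' \<noteq> {}"
    and no_common: "\<exists>H\<in>\<H>. v \<notin> H"
    and card_E: "e \<in> E \<Longrightarrow> card e = 2"
    and hit: "e \<in> E \<Longrightarrow> H \<in> \<H> \<Longrightarrow> e \<inter> H \<noteq> {}"
begin

definition avoid :: "'a \<Rightarrow> 'a set" where
  "avoid v = (SOME H. H \<in> \<H> \<and> v \<notin> H)"

lemma avoid: "avoid v \<in> \<H>" "v \<notin> avoid v"
  using someI_ex[of "\<lambda>H. H \<in> \<H> \<and> v \<notin> H"] no_common[of v] by (auto simp: avoid_def)

lemma finite_\<H>: "H \<in> \<H> \<Longrightarrow> finite H"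
  using card_\<H>[of H] by (metis card.infinite add_is_0 one_neq_zero)

definition crossing :: "'a set \<Rightarrow> 'a set \<Rightarrow> 'a set set" where
  "crossing H1 H2 = {{b, c} |b c. b \<in> H1 - H2 \<and> c \<in> H2 - H1}"

definition fan :: "'a \<Rightarrow> 'a set set" where
  "fan y = (\<lambda>h. {y, h}) ` avoid y"

text \<open>An edge through \<open>y\<close> has to meet \<open>avoid y\<close>, necessarily at its
  other end; so \<open>y\<close> has at most \<open>m + 1\<close> neighbours.\<close>

lemma edge_in_fan:
  assumes "e \<in> E" "y \<in> e"
  shows "e \<in> fan y"
proof -
  obtain z where z: "z \<noteq> y" "e = {y, z}" using other_of_pair[OF card_E[OF assms(1)] assms(2)] by blast
  have "z \<in> avoid y" using hit[OF assms(1) avoid(1)[of y]] avoid(2)[of y] z by auto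
  then show ?thesis using z by (auto simp: fan_def)
qed

lemma E_subset:
  assumes "H1 \<in> \<H>" "H2 \<in> \<H>"
  shows "E \<subseteq> crossing H1 H2 \<union> (\<Union>y\<in>H1 \<inter> H2. fan y)"
proof
  fix e assume e: "e \<in> E"
  show "e \<in> crossing H1 H2 \<union> (\<Union>y\<in>H1 \<inter> H2. fan y)"
  proof (cases "e \<inter> (H1 \<inter> H2) = {}")
    case True
    obtain b where b: "b \<in> e" "b \<in> H1" using hit[OF e assms(1)] by blast
    obtain c where c: "c \<in> e" "c \<in> H2" using hit[OF e assms(2)] by blast
    have bc: "b \<in> H1 - H2" "c \<in> H2 - H1" using b c True by auto
    then have "b \<noteq> c" by auto
    then have "e = {b, c}" using pair_eqI[OF card_E[OF e] b(1) c(1)] by simp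
    then have "e \<in> crossing H1 H2" unfolding crossing_def using bc by blast
    then show ?thesis by blast
  next
    case False
    then obtain y where "y \<in> e" "y \<in> H1 \<inter> H2" by blast
    then show ?thesis using edge_in_fan[OF e] by blast
  qed
qed

lemma card_fan: "finite (fan y)" "card (fan y) \<le> m + 1"
  using finite_\<H>[OF avoid(1)[of y]] card_\<H>[OF avoid(1)[of y]] card_image_le[of "avoid y" "\<lambda>h. {y, h}"]
  by (auto simp: fan_def)

lemma card_crossing:
  assumes "H1 \<in> \<H>" "H2 \<in> \<H>"
  shows "finite (crossing H1 H2)" "card (crossing H1 H2) \<le> (m + 1 - card (H1 \<inter> H2))^2"
proof -
  have fin: "finite H1" "finite H2" using assms finite_\<H> by auto
  have "card (H1 - H2) = m + 1 - card (H1 \<inter> H2)" "card (H2 - H1) = m + 1 - card (H1 \<inter> H2)"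
    using card_Diff_subset_Int[of H1 H2] card_Diff_subset_Int[of H2 H1] fin card_\<H> assms
    by (auto simp: Int_commute)
  then show "finite (crossing H1 H2)" "card (crossing H1 H2) \<le> (m + 1 - card (H1 \<inter> H2))^2"
    using card_pairs_between_le[of "H1 - H2" "H2 - H1"] fin by (auto simp: crossing_def power2_eq_square)
qed

lemma card_inter_bounds:
  assumes "H1 \<in> \<H>" "H2 \<in> \<H>" "H1 \<noteq> H2"
  shows "1 \<le> card (H1 \<inter> H2)" "card (H1 \<inter> H2) \<le> m"
proof -
  show "1 \<le> card (H1 \<inter> H2)" using inter[OF assms(1,2)] finite_\<H>[OF assms(1)]
    by (simp add: Suc_leI card_gt_0_iff)
  have "H1 \<inter> H2 \<subset> H1"
  proof -
    have "\<not> H1 \<subseteq> H2"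
      using card_subset_eq[OF finite_\<H>[OF assms(2)], of H1] card_\<H> assms by auto
    then show ?thesis by blast
  qed
  then have "card (H1 \<inter> H2) < card H1" by (rule psubset_card_mono[OF finite_\<H>[OF assms(1)]])
  then show "card (H1 \<inter> H2) \<le> m" using card_\<H>[OF assms(1)] by simp
qed

text \<open>With \<open>s = card (H1 \<inter> H2)\<close> there are at most
  \<open>(m + 1 - s)^2\<close> crossing edges and \<open>s (m + 1)\<close> edges at common points.
  Their sum is exactly \<open>(s - 1) (m - s)\<close> below \<open>m^2 + m + 1\<close>; the product
  is kept for the case of equality.\<close>

lemma card_E_add:
  assumes "H1 \<in> \<H>" "H2 \<in> \<H>" "H1 \<noteq> H2"
  shows "card E + (card (H1 \<inter> H2) - 1) * (m - card (H1 \<inter> H2)) \<le> m^2 + m + 1"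
proof -
  define s where "s = card (H1 \<inter> H2)"
  have s: "1 \<le> s" "s \<le> m" using card_inter_bounds[OF assms] by (auto simp: s_def)
  have fin: "finite (H1 \<inter> H2)" using finite_\<H>[OF assms(1)] by simp
  have fu: "finite (\<Union>y\<in>H1 \<inter> H2. fan y)" using fin card_fan by auto
  have "card (\<Union>y\<in>H1 \<inter> H2. fan y) \<le> (\<Sum>y\<in>H1 \<inter> H2. card (fan y))" by (rule card_UN_le[OF fin])
  also have "\<dots> \<le> (\<Sum>y\<in>H1 \<inter> H2. m + 1)" by (rule sum_mono) (rule card_fan)
  also have "\<dots> = s * (m + 1)" by (simp add: s_def)
  finally have fans: "card (\<Union>y\<in>H1 \<inter> H2. fan y) \<le> s * (m + 1)" .
  have "card E \<le> card (crossing H1 H2 \<union> (\<Union>y\<in>H1 \<inter> H2. fan y))"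
    using E_subset[OF assms(1,2)] card_crossing[OF assms(1,2)] fu by (intro card_mono) auto
  also have "\<dots> \<le> card (crossing H1 H2) + card (\<Union>y\<in>H1 \<inter> H2. fan y)" by (rule card_Un_le)
  also have "\<dots> \<le> (m + 1 - s)^2 + s * (m + 1)" using fans card_crossing[OF assms(1,2)] by (simp add: s_def)
  finally have E: "card E \<le> (m + 1 - s)^2 + s * (m + 1)" .
  obtain a where a: "s = 1 + a" using s(1) by (metis le_Suc_ex)
  obtain b where b: "m = s + b" using s(2) by (metis le_Suc_ex)
  have "(m + 1 - s)^2 + s * (m + 1) + (s - 1) * (m - s) = m^2 + m + 1"
    unfolding b a by (simp add: power2_eq_square algebra_simps)
  then show ?thesis using E by (simp add: s_def)
qed

lemma card_E_le: "card E \<le> m^2 + m + 1"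
proof -
  obtain H where H: "H \<in> \<H>" using \<H>_ne by blast
  then obtain v where "v \<in> H" using inter[of H H] by blast
  then show ?thesis using card_E_add[OF H avoid(1)[of v]] avoid(2)[of v] by (metis add_leD1)
qed

text \<open>
  Equality in \<open>card_E_add\<close> forces any two members of \<open>\<H>\<close> to meet in \<open>1\<close> or \<open>m\<close> points; if it is always \<open>m\<close>, all pairs
  lie in a set of \<open>m + 2\<close> points and are too few.
\<close>

lemma exists_singleton_inter:
  assumes "card E = m^2 + m + 1"
  shows "\<exists>H1\<in>\<H>. \<exists>H2\<in>\<H>. card (H1 \<inter> H2) = 1"
proof (rule ccontr)
  assume none: "\<not> ?thesis"
  have all_m: "card (H \<inter> H') = m" if "H \<in> \<H>" "H' \<in> \<H>" "H \<noteq> H'" for H H'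
  proof -
    have "(card (H \<inter> H') - 1) * (m - card (H \<inter> H')) = 0" using card_E_add[OF that] assms by simp
    moreover have "1 < card (H \<inter> H')" using none that card_inter_bounds(1)[OF that] by (metis le_neq_implies_less)
    ultimately show ?thesis using card_inter_bounds(2)[OF that] by simp
  qed
  obtain H1 where H1: "H1 \<in> \<H>" using \<H>_ne by blast
  then obtain v where v: "v \<in> H1" using inter[of H1 H1] by blast
  define H2 where "H2 = avoid v"
  have H2: "H2 \<in> \<H>" "H1 \<noteq> H2" using avoid[of v] v by (auto simp: H2_def)
  have fin: "finite H1" "finite H2" using finite_\<H> H1 H2 by auto
  have cU: "card (H1 \<union> H2) = m + 2"
    using card_Un_Int[OF fin] card_\<H>[OF H1] card_\<H>[OF H2(1)] all_m[OF H1 H2] by simp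
  \<comment> \<open>\<open>avoid y\<close> meets each of \<open>H1\<close> and \<open>H2\<close> in
    \<open>m\<close> points but misses \<open>y\<close>, so it equals
    \<open>(H1 \<union> H2) - {y}\<close>.\<close>
  have avoid_sub: "avoid y \<subseteq> H1 \<union> H2" if y: "y \<in> H1 \<inter> H2" for y
  proof -
    let ?H = "avoid y"
    have eqs: "?H \<inter> K = K - {y}" if "K \<in> \<H>" "y \<in> K" for K
    proof (rule card_subset_eq)
      show "finite (K - {y})" using finite_\<H> that by simp
      show "?H \<inter> K \<subseteq> K - {y}" using avoid(2)[of y] by auto
      have "?H \<noteq> K" using that avoid(2)[of y] by auto
      then show "card (?H \<inter> K) = card (K - {y})"
        using all_m[OF avoid(1)[of y] that(1)] card_\<H>[OF that(1)] that(2) by simp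
    qed
    have "(H1 \<union> H2) - {y} \<subseteq> ?H" using eqs[OF H1] eqs[OF H2(1)] y by blast
    moreover have "card ((H1 \<union> H2) - {y}) = card ?H" using cU y fin card_\<H>[OF avoid(1)[of y]] by simp
    ultimately have "(H1 \<union> H2) - {y} = ?H"
      using card_subset_eq[OF finite_\<H>[OF avoid(1)[of y]]] by blast
    then show ?thesis by blast
  qed
  have "E \<subseteq> {e. e \<subseteq> H1 \<union> H2 \<and> card e = 2}"
  proof
    fix e assume e: "e \<in> E"
    then consider "e \<in> crossing H1 H2" | y where "y \<in> H1 \<inter> H2" "e \<in> fan y" using E_subset[OF H1 H2(1)] by blast
    then have "e \<subseteq> H1 \<union> H2"
    proof cases
      case 1
      then show ?thesis by (auto simp: crossing_def)
    next
      case 2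
      then show ?thesis using avoid_sub[of y] by (auto simp: fan_def)
    qed
    then show "e \<in> {e. e \<subseteq> H1 \<union> H2 \<and> card e = 2}" using card_E[OF e] by simp
  qed
  moreover have "finite {e. e \<subseteq> H1 \<union> H2 \<and> card e = 2}" using fin by simp
  ultimately have "card E \<le> card {e. e \<subseteq> H1 \<union> H2 \<and> card e = 2}" by (rule card_mono[rotated])
  also have "\<dots> = (m + 2) choose 2" using n_subsets[of "H1 \<union> H2" 2] fin cU by simp
  also have "\<dots> = (m + 2) * (m + 1) div 2" by (simp add: choose_two)
  finally have "2 * card E \<le> 2 * ((m + 2) * (m + 1) div 2)" by (rule mult_le_mono2)
  also have "\<dots> \<le> (m + 2) * (m + 1)" by (rule times_div_less_eq_dividend)
  finally have "2 * (m^2 + m + 1) \<le> (m + 2) * (m + 1)" using assms by (simp only:)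
  moreover have "2 * m \<le> m * m" using m by simp
  ultimately show False using m by (simp add: power2_eq_square algebra_simps)
qed

text \<open>Equality makes \<open>E\<close> the full union of \<open>crossing H1 H2\<close> and the
  fan at the single common point \<open>y\<close>. The set \<open>avoid y\<close> then has to
  contain \<open>H1 - {y}\<close> or \<open>H2 - {y}\<close>, and it has one further point
  \<open>u\<close>. These sets and \<open>u\<close> become \<open>B\<close>, \<open>C\<close> and
  \<open>u\<close> of a Type I family.\<close>

lemma extremal_structure:
  assumes "card E = m^2 + m + 1"
  obtains y B C u where "insert y B \<in> \<H>" "insert y C \<in> \<H>" "insert u B \<in> \<H>" "card B = m" "card C = m"
    "B \<inter> C = {}" "y \<notin> B \<union> C" "u \<in> C" "\<And>b c. b \<in> B \<Longrightarrow> c \<in> C \<Longrightarrow> {b, c} \<in> E"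
    "\<And>h. h \<in> insert u B \<Longrightarrow> {y, h} \<in> E"
proof -
  note result = that
  obtain H1 H2 where H: "H1 \<in> \<H>" "H2 \<in> \<H>" "card (H1 \<inter> H2) = 1"
    using exists_singleton_inter[OF assms] by blast
  then obtain y where y: "H1 \<inter> H2 = {y}" by (metis card_1_singletonE)
  have sub: "E \<subseteq> crossing H1 H2 \<union> fan y" using E_subset[OF H(1,2)] y by simp
  have fin: "finite (crossing H1 H2 \<union> fan y)" using card_crossing[OF H(1,2)] card_fan by simp
  have "card (crossing H1 H2 \<union> fan y) \<le> m^2 + (m + 1)"
    using card_Un_le[of "crossing H1 H2" "fan y"] card_crossing(2)[OF H(1,2)] card_fan(2)[of y] H(3) by simp
  then have E: "E = crossing H1 H2 \<union> fan y" using card_seteq[OF fin sub] assms by simp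
  \<comment> \<open>\<open>H1\<close> and \<open>H2\<close> play symmetric roles; \<open>K1\<close>
    stands for the one whose remainder lies in \<open>avoid y\<close>.\<close>
  have build: thesis if K: "K1 \<in> \<H>" "K2 \<in> \<H>" "K1 \<inter> K2 = {y}" "E = crossing K1 K2 \<union> fan y"
      "K1 - {y} \<subseteq> avoid y" for K1 K2
  proof -
    define B where "B = K1 - {y}"
    define C where "C = K2 - {y}"
    have yK: "y \<in> K1" "y \<in> K2" using K(3) by auto
    have fK: "finite K1" "finite K2" using finite_\<H> K by auto
    have cB: "card B = m" "card C = m" using yK card_\<H> K fK by (auto simp: B_def C_def)
    have BC: "B = K1 - K2" "C = K2 - K1" using K(3) by (auto simp: B_def C_def)
    have "card (avoid y - B) = 1"
      using K(5) cB card_\<H>[OF avoid(1)[of y]] fK by (simp add: card_Diff_subset B_def)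
    then obtain u where "avoid y - B = {u}" by (metis card_1_singletonE)
    then have u: "avoid y = insert u B" "u \<notin> B" using K(5) by (auto simp: B_def)
    have "u \<noteq> y" using u avoid(2)[of y] by auto
    \<comment> \<open>\<open>B\<close> is disjoint from \<open>K2\<close>, so only \<open>u\<close>
      can be a common point of \<open>avoid y\<close> and \<open>K2\<close>.\<close>
    moreover have "u \<in> K2" using inter[OF avoid(1)[of y] K(2)] u(1) BC by auto
    ultimately have uC: "u \<in> C" by (simp add: C_def)
    show thesis
    proof (rule result[of y B C u])
      show "insert y B \<in> \<H>" "insert y C \<in> \<H>" using yK K by (auto simp: B_def C_def insert_absorb)
      show "insert u B \<in> \<H>" using u(1) avoid(1)[of y] by simp
      show "card B = m" "card C = m" "u \<in> C" using cB uC by auto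
      show "B \<inter> C = {}" "y \<notin> B \<union> C" using BC yK by auto
      show "{b, c} \<in> E" if "b \<in> B" "c \<in> C" for b c
        using that unfolding K(4) crossing_def BC by blast
      show "{y, h} \<in> E" if "h \<in> insert u B" for h
        using that unfolding K(4) fan_def u(1) by blast
    qed
  qed
  show thesis
  proof (cases "H1 - {y} \<subseteq> avoid y")
    case True
    then show ?thesis using build[OF H(1,2) y E] by simp
  next
    case False
    then obtain b where b: "b \<in> H1 - {y}" "b \<notin> avoid y" by blast
    \<comment> \<open>\<open>b\<close> is joined to all of \<open>H2 - {y}\<close>; as
      \<open>b\<close> is not in \<open>avoid y\<close>, the other end of each of these edges must
      be.\<close>
    have "c \<in> avoid y" if c: "c \<in> H2 - {y}" for c
    proof -
      have "b \<in> H1 - H2" "c \<in> H2 - H1" using b c y by auto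
      then have "{b, c} \<in> E" unfolding E crossing_def by blast
      then show ?thesis using hit[OF _ avoid(1)[of y]] b by blast
    qed
    moreover have "crossing H1 H2 = crossing H2 H1" by (auto simp: crossing_def insert_commute)
    ultimately show ?thesis using build[OF H(2,1)] y E by (auto simp: Int_commute)
  qed
qed

end

section \<open>Cross-intersecting graphs\<close>

text \<open>The pairs \<open>{z, x}\<close>, \<open>{x, y}\<close>, \<open>{y, w}\<close> form a
  path, or a triangle if \<open>z = w\<close>, which is allowed; both shapes are used below.\<close>

lemma covers_of_path:
  assumes "card f = 2" "f \<inter> {x, y} \<noteq> {}" "f \<inter> {x, z} \<noteq> {}" "f \<inter> {w, y} \<noteq> {}"
    "x \<noteq> w" "y \<noteq> z" "x \<noteq> y"
  shows "f \<in> {{x, y}, {x, w}, {z, y}}"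
proof (cases "x \<in> f")
  case True
  then obtain q where q: "f = {x, q}" using other_of_pair[OF assms(1)] by blast
  then have "q = w \<or> q = y" using assms(4,5,7) by auto
  then show ?thesis using q by auto
next
  case False
  then have "y \<in> f" "z \<in> f" using assms by auto
  then have "f = {z, y}" using pair_eqI[OF assms(1), of z y] assms(6) by blast
  then show ?thesis by simp
qed

text \<open>Pairwise intersecting pairs form a star or a triangle, and a triangle has only three
  edges.\<close>

lemma intersecting_pairs_star:
  assumes pairs: "\<And>e. e \<in> E \<Longrightarrow> card e = 2"
    and inter: "\<And>e f. e \<in> E \<Longrightarrow> f \<in> E \<Longrightarrow> e \<inter> f \<noteq> {}"
    and big: "4 \<le> card E"
  obtains v where "\<And>e. e \<in> E \<Longrightarrow> v \<in> e"
proof (rule ccontr)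
  assume "\<not> thesis"
  then have no: "\<exists>e\<in>E. v \<notin> e" for v using that by blast
  have "E \<noteq> {}" using big by auto
  then obtain e where e: "e \<in> E" by blast
  obtain a b where ab: "e = {a, b}" "a \<noteq> b" using pairs[OF e] by (auto simp: card_2_iff)
  obtain f where f: "f \<in> E" "a \<notin> f" using no by blast
  obtain g where g: "g \<in> E" "b \<notin> g" using no by blast
  have bf: "b \<in> f" using inter[OF e f(1)] ab f by auto
  have ag: "a \<in> g" using inter[OF e g(1)] ab g by auto
  obtain c where c: "c \<noteq> b" "f = {b, c}" using other_of_pair[OF pairs[OF f(1)] bf] by blast
  have cg: "c \<in> g" using inter[OF f(1) g(1)] c g by auto
  have ca: "c \<noteq> a" using c f by auto
  have gg: "g = {a, c}" using pair_eqI[OF pairs[OF g(1)] ag cg] ca by auto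
  have "E \<subseteq> {{a, b}, {a, c}, {b, c}}"
  proof
    fix h assume h: "h \<in> E"
    have "h \<inter> {a, b} \<noteq> {}" "h \<inter> {a, c} \<noteq> {}" "h \<inter> {c, b} \<noteq> {}"
      using inter[OF h e] inter[OF h f(1)] inter[OF h g(1)] ab c gg by auto
    from covers_of_path[OF pairs[OF h] this] ca c(1) ab(2) show "h \<in> {{a, b}, {a, c}, {b, c}}" by auto
  qed
  then have "card E \<le> card {{a, b}, {a, c}, {b, c}}" by (rule card_mono[rotated]) simp
  also have "\<dots> \<le> 3" by (auto simp: card_insert_if)
  finally show False using big by simp
qed

text \<open>Two disjoint edges of \<open>E\<close> confine \<open>E'\<close> to the edges of a
  4-cycle. Any three of those form a path, and \<open>covers_of_path\<close> leaves three candidates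
  for the edges of \<open>E\<close>.\<close>

lemma many_covers_of_matching:
  assumes pairs: "\<And>e. e \<in> E \<Longrightarrow> card e = 2" and pairs': "\<And>e. e \<in> E' \<Longrightarrow> card e = 2"
    and cross: "\<And>e f. e \<in> E \<Longrightarrow> f \<in> E' \<Longrightarrow> e \<inter> f \<noteq> {}"
    and e: "{a, b} \<in> E" "{c, d} \<in> E" "{a, b} \<inter> {c, d} = {}"
    and big: "3 \<le> card E'"
  shows "card E \<le> 3"
proof -
  have dist: "a \<noteq> b" "c \<noteq> d" "a \<noteq> c" "a \<noteq> d" "b \<noteq> c" "b \<noteq> d"
    using pairs[OF e(1)] pairs[OF e(2)] e(3) by (auto simp: card_insert_if split: if_splits)
  define C where "C = {{a, c}, {a, d}, {b, c}, {b, d}}"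
  have sub: "E' \<subseteq> C"
  proof
    fix f assume f: "f \<in> E'"
    obtain p where p: "p \<in> f" "p = a \<or> p = b" using cross[OF e(1) f] by blast
    obtain q where q: "q \<in> f" "q = c \<or> q = d" using cross[OF e(2) f] by blast
    have "f = {p, q}" using pair_eqI[OF pairs'[OF f] p(1) q(1)] p q dist by auto
    then show "f \<in> C" using p q by (auto simp: C_def)
  qed
  have cC: "card C \<le> 4" by (auto simp: C_def card_insert_if)
  have finC: "finite C" by (simp add: C_def)
  have "card (C - E') \<le> Suc 0"
    using card_Diff_subset[OF finite_subset[OF sub finC] sub] cC big by simp
  then have "\<forall>x\<in>C - E'. \<forall>y\<in>C - E'. x = y" using finC by (subst card_le_Suc0_iff_eq[symmetric]) auto
  then have miss: "x \<in> E' \<or> y \<in> E'" if "x \<in> C" "y \<in> C" "x \<noteq> y" for x y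
    using that by blast
  have path: "card E \<le> 3" if "{x, y} \<in> E'" "{x, z} \<in> E'" "{w, y} \<in> E'" "x \<noteq> w" "y \<noteq> z" "x \<noteq> y" for x y z w
  proof -
    have "E \<subseteq> {{x, y}, {x, w}, {z, y}}"
    proof
      fix f assume f: "f \<in> E"
      show "f \<in> {{x, y}, {x, w}, {z, y}}"
        using covers_of_path[OF pairs[OF f] cross[OF f that(1)] cross[OF f that(2)] cross[OF f that(3)] that(4,5,6)] .
    qed
    then have "card E \<le> card {{x, y}, {x, w}, {z, y}}" by (rule card_mono[rotated]) simp
    also have "\<dots> \<le> 3" by (auto simp: card_insert_if)
    finally show ?thesis .
  qed
  have neq: "{a, c} \<noteq> {a, d}" "{a, c} \<noteq> {b, c}" "{a, c} \<noteq> {b, d}" "{a, d} \<noteq> {b, c}" "{a, d} \<noteq> {b, d}" "{b, c} \<noteq> {b, d}"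
    using dist by (auto simp: doubleton_eq_iff)
  have inC: "{a, c} \<in> C" "{a, d} \<in> C" "{b, c} \<in> C" "{b, d} \<in> C" by (auto simp: C_def)
  consider "{a, c} \<in> E'" "{a, d} \<in> E'" "{b, c} \<in> E'" | "{a, c} \<in> E'" "{a, d} \<in> E'" "{b, d} \<in> E'"
    | "{a, c} \<in> E'" "{b, c} \<in> E'" "{b, d} \<in> E'" | "{a, d} \<in> E'" "{b, c} \<in> E'" "{b, d} \<in> E'"
    using miss[OF inC(1,2) neq(1)] miss[OF inC(1,3) neq(2)] miss[OF inC(1,4) neq(3)]
      miss[OF inC(2,3) neq(4)] miss[OF inC(2,4) neq(5)] miss[OF inC(3,4) neq(6)] by argo
  then show ?thesis
  proof cases
    case 1
    then show ?thesis using path[of a c d b] dist by blast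
  next
    case 2
    then show ?thesis using path[of a d c b] dist by blast
  next
    case 3
    then show ?thesis using path[of b c d a] dist by blast
  next
    case 4
    then show ?thesis using path[of b d c a] dist by blast
  qed
qed

text \<open>If \<open>g\<close> and \<open>h\<close> are disjoint, only four pairs meet both, and
  \<open>3 \<le> d\<close> takes care of them. If they share a point, the only pair outside the star
  at that point joins the two other ends.\<close>

lemma card_pairs_hitting_two:
  assumes pairs: "\<And>e. e \<in> E \<Longrightarrow> card e = 2" and fin: "finite E"
    and deg: "\<And>v. card {e \<in> E. v \<in> e} \<le> d" and d: "3 \<le> d"
    and gh: "card g = 2" "card h = 2" "g \<noteq> h"
    and hit: "\<And>e. e \<in> E \<Longrightarrow> e \<inter> g \<noteq> {}" "\<And>e. e \<in> E \<Longrightarrow> e \<inter> h \<noteq> {}"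
  shows "card E \<le> d + 1"
proof (cases "g \<inter> h = {}")
  case True
  have fin: "finite g" "finite h" using gh card.infinite by fastforce+
  have "E \<subseteq> {{b, c} |b c. b \<in> g \<and> c \<in> h}"
  proof
    fix e assume e: "e \<in> E"
    obtain b c where "b \<in> e" "b \<in> g" "c \<in> e" "c \<in> h" using hit[OF e] by blast
    moreover have "e = {b, c}" using pair_eqI[OF pairs[OF e]] calculation True by blast
    ultimately show "e \<in> {{b, c} |b c. b \<in> g \<and> c \<in> h}" by blast
  qed
  then have "card E \<le> card g * card h"
    using card_pairs_between_le[OF fin] card_mono[of "{{b, c} |b c. b \<in> g \<and> c \<in> h}" E] by linarith
  then show ?thesis using gh d by simp
next
  case False
  then obtain x where x: "x \<in> g" "x \<in> h" by blast
  obtain y where y: "y \<noteq> x" "g = {x, y}" using other_of_pair[OF gh(1) x(1)] by blast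
  obtain z where z: "z \<noteq> x" "h = {x, z}" using other_of_pair[OF gh(2) x(2)] by blast
  have yz: "y \<noteq> z" using y z gh(3) by auto
  have "E \<subseteq> insert {y, z} {e \<in> E. x \<in> e}"
  proof
    fix e assume e: "e \<in> E"
    show "e \<in> insert {y, z} {e \<in> E. x \<in> e}"
    proof (cases "x \<in> e")
      case False
      then have "y \<in> e" "z \<in> e" using hit[OF e] y z by auto
      then show ?thesis using pair_eqI[OF pairs[OF e]] yz by blast
    qed (use e in simp)
  qed
  then have "card E \<le> card (insert {y, z} {e \<in> E. x \<in> e})" using fin by (intro card_mono) auto
  also have "\<dots> \<le> Suc (card {e \<in> E. x \<in> e})" by (rule card_insert_le_m1) auto
  finally show ?thesis using deg[of x] by simp
qed

text \<open>A star with four edges is impossible, since an edge of another graph that misses the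
  centre allows only two. So a graph with four edges contains two disjoint ones and leaves at most
  two edges to every other graph. If some other graph has exactly two,
  \<open>card_pairs_hitting_two\<close> applies. The third alternative carries no number: the large
  graph is bounded later, together with the covers containing \<open>S\<close>.\<close>

lemma cross_intersecting_graphs:
  fixes E :: "'i \<Rightarrow> 'a set set"
  assumes finI: "finite I"
    and fin: "\<And>i. i \<in> I \<Longrightarrow> finite (E i)"
    and pairs: "\<And>i e. i \<in> I \<Longrightarrow> e \<in> E i \<Longrightarrow> card e = 2"
    and cross: "\<And>i j e f. i \<in> I \<Longrightarrow> j \<in> I \<Longrightarrow> i \<noteq> j \<Longrightarrow> e \<in> E i \<Longrightarrow> f \<in> E j \<Longrightarrow> e \<inter> f \<noteq> {}"
    and deg: "\<And>i v. i \<in> I \<Longrightarrow> card {e \<in> E i. v \<in> e} \<le> d" and d: "3 \<le> d"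
    and two: "i0 \<in> I" "j0 \<in> I" "i0 \<noteq> j0" "E i0 \<noteq> {}" "E j0 \<noteq> {}"
    and no_common: "\<And>v. \<exists>i\<in>I. \<exists>e\<in>E i. v \<notin> e"
  shows "(\<Sum>i\<in>I. card (E i)) \<le> 3 * card I \<or> (\<Sum>i\<in>I. card (E i)) \<le> d + 1 + 2 * (card I - 1)
    \<or> (\<exists>p\<in>I. \<exists>j\<in>I. j \<noteq> p \<and> E j \<noteq> {} \<and> (\<forall>i\<in>I - {p}. card (E i) \<le> 1))"
proof (cases "\<forall>i\<in>I. card (E i) \<le> 3")
  case True
  then have "(\<Sum>i\<in>I. card (E i)) \<le> (\<Sum>i\<in>I. 3)" by (intro sum_mono) auto
  then show ?thesis by simp
next
  case False
  then obtain p where p: "p \<in> I" "4 \<le> card (E p)" by fastforce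
  obtain j where j: "j \<in> I" "j \<noteq> p" "E j \<noteq> {}" using two by metis
  have "\<exists>e\<in>E p. \<exists>f\<in>E p. e \<inter> f = {}"
  proof (rule ccontr)
    assume "\<not> ?thesis"
    then have "\<And>e f. e \<in> E p \<Longrightarrow> f \<in> E p \<Longrightarrow> e \<inter> f \<noteq> {}" by blast
    then obtain v where v: "\<And>e. e \<in> E p \<Longrightarrow> v \<in> e"
      using intersecting_pairs_star[of "E p"] pairs[OF p(1)] p(2) by blast
    obtain i f where f: "i \<in> I" "f \<in> E i" "v \<notin> f" using no_common by blast
    have "i \<noteq> p" using v f by auto
    have "finite f" using pairs[OF f(1,2)] card.infinite by fastforce
    have "E p \<subseteq> (\<lambda>x. {v, x}) ` f"
    proof
      fix e assume e: "e \<in> E p"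
      obtain x where x: "x \<noteq> v" "e = {v, x}" using other_of_pair[OF pairs[OF p(1) e] v[OF e]] by blast
      have "x \<in> f" using cross[OF p(1) f(1) _ e f(2)] \<open>i \<noteq> p\<close> x f(3) by auto
      then show "e \<in> (\<lambda>x. {v, x}) ` f" using x by blast
    qed
    then have "card (E p) \<le> card f" using \<open>finite f\<close> by (meson card_image_le card_mono finite_imageI le_trans)
    then show False using p(2) pairs[OF f(1,2)] by simp
  qed
  then obtain e f where ef: "e \<in> E p" "f \<in> E p" "e \<inter> f = {}" by blast
  obtain a b where ab: "e = {a, b}" using pairs[OF p(1) ef(1)] by (auto simp: card_2_iff)
  obtain a' b' where ab': "f = {a', b'}" using pairs[OF p(1) ef(2)] by (auto simp: card_2_iff)
  have le2: "card (E i) \<le> 2" if i: "i \<in> I - {p}" for i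
  proof (rule ccontr)
    assume "\<not> card (E i) \<le> 2"
    then have "card (E p) \<le> 3"
      using many_covers_of_matching[of "E p" "E i" a b a' b'] pairs[OF p(1)] pairs[of i] cross[OF p(1), of i] i ef ab ab'
      by force
    then show False using p by simp
  qed
  show ?thesis
  proof (cases "\<forall>i\<in>I - {p}. card (E i) \<le> 1")
    case True
    then show ?thesis using p j by blast
  next
    case False
    then obtain i where i: "i \<in> I" "i \<noteq> p" "card (E i) = 2" using le2 by fastforce
    obtain g h where gh: "E i = {g, h}" "g \<noteq> h" using i(3) by (auto simp: card_2_iff)
    have "card (E p) \<le> d + 1"
      using card_pairs_hitting_two[of "E p" d g h] pairs[OF p(1)] fin[OF p(1)] deg[OF p(1)] d pairs[OF i(1)] gh
        cross[OF p(1) i(1)] i(2) by auto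
    moreover have "(\<Sum>i\<in>I - {p}. card (E i)) \<le> (\<Sum>i\<in>I - {p}. 2)" using le2 by (intro sum_mono) auto
    moreover have "(\<Sum>i\<in>I. card (E i)) = card (E p) + (\<Sum>i\<in>I - {p}. card (E i))"
      using finI p(1) by (rule sum.remove)
    ultimately show ?thesis using finI p(1) by (simp add: card_Diff_singleton)
  qed
qed

section \<open>Set systems without small covers\<close>

lemma pair_meeting:
  assumes "card f = 2" "f \<inter> H \<noteq> {}"
  obtains p q where "f = {p, q}" "p \<noteq> q" "p \<in> H"
  using assms by (metis Int_iff ex_in_conv other_of_pair)

lemma triple_eqI:
  assumes "card h = 3" "p \<in> h" "q \<in> h" "r \<in> h" "p \<noteq> q" "p \<noteq> r" "q \<noteq> r"
  shows "h = {p, q, r}"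
proof -
  have "finite h" using assms(1) card.infinite by fastforce
  moreover have "card {p, q, r} = card h" using assms by simp
  ultimately show ?thesis using card_subset_eq[of h "{p, q, r}"] assms by blast
qed

lemma third_of_triple:
  assumes "card h = 3" "p \<in> h" "q \<in> h" "p \<noteq> q"
  obtains r where "h = {p, q, r}" "r \<noteq> p" "r \<noteq> q"
proof -
  have "card (h - {p, q}) = 1" using assms by (simp add: card_Diff_subset)
  then obtain r where "h - {p, q} = {r}" by (metis card_1_singletonE)
  then have "h = {p, q, r}" "r \<noteq> p" "r \<noteq> q" using assms by auto
  then show thesis by (rule that)
qed

text \<open>A transversal of three disjoint pairs is coded by three bits; disjoint transversals have opposite codes.\<close>

lemma code_no_antipodal:
  fixes S :: "(bool \<times> bool \<times> bool) set"
  assumes "\<And>i j k. (i, j, k) \<in> S \<Longrightarrow> (\<not> i, \<not> j, \<not> k) \<notin> S"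
  shows "card S \<le> 4"
proof -
  define neg :: "bool \<times> bool \<times> bool \<Rightarrow> bool \<times> bool \<times> bool" where "neg = (\<lambda>(i, j, k). (\<not> i, \<not> j, \<not> k))"
  have "inj_on neg S" by (auto simp: inj_on_def neg_def)
  then have "card (neg ` S) = card S" by (rule card_image)
  moreover have "S \<inter> neg ` S = {}" using assms by (auto simp: neg_def)
  ultimately have "2 * card S = card (S \<union> neg ` S)" by (simp add: card_Un_disjoint)
  also have "\<dots> \<le> card (UNIV :: (bool \<times> bool \<times> bool) set)" by (rule card_mono) auto
  also have "\<dots> = 8" by (simp add: card_cartesian_product flip: UNIV_Times_UNIV)
  finally show ?thesis by simp
qed

text \<open>Hamming distance at most 1 in the 3-cube; for two coded transversals it means at least
  two common points.\<close>

fun agree2 :: "bool \<times> bool \<times> bool \<Rightarrow> bool \<times> bool \<times> bool \<Rightarrow> bool" where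
  "agree2 (i, j, k) (i', j', k') \<longleftrightarrow> (i = i' \<and> j = j') \<or> (i = i' \<and> k = k') \<or> (j = j' \<and> k = k')"

text \<open>Balls of radius 1 around distinct points of the 3-cube share at most two points. This is
  checked by evaluation; quantifying over both centres makes the statement closed.\<close>

lemma code_common_ball:
  assumes "u \<noteq> w" "\<And>s. s \<in> S \<Longrightarrow> agree2 s u \<and> agree2 s w"
  shows "card S \<le> 2"
proof -
  have "\<forall>u w. u \<noteq> w \<longrightarrow> length (filter (\<lambda>s. agree2 s u \<and> agree2 s w) Enum.enum) \<le> 2"
    by code_simp
  then have "length (filter (\<lambda>s. agree2 s u \<and> agree2 s w) Enum.enum) \<le> 2" using assms(1) by blast
  moreover have "S \<subseteq> set (filter (\<lambda>s. agree2 s u \<and> agree2 s w) Enum.enum)" using assms(2) by (auto simp: enum_UNIV)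
  then have "card S \<le> card (set (filter (\<lambda>s. agree2 s u \<and> agree2 s w) Enum.enum))" by (intro card_mono) auto
  ultimately show ?thesis using card_length le_trans by blast
qed

text \<open>
  For a \<open>t\<close>-set \<open>X = I\<close>, the pairs in \<open>E\<close> are the sets \<open>T - X\<close> for members \<open>T \<supseteq> X\<close> of a \<open>t\<close>-intersecting system,
  and the triples in \<open>Hs x\<close> are the sets \<open>T - X\<close> for members missing exactly the point \<open>x\<close> of \<open>X\<close>.
\<close>

locale link_system =
  fixes I :: "'i set" and Hs :: "'i \<Rightarrow> 'a set set" and E :: "'a set set"
  assumes finI: "finite I"
    and card_Hs: "x \<in> I \<Longrightarrow> h \<in> Hs x \<Longrightarrow> card h = 3"
    and fin_Hs: "x \<in> I \<Longrightarrow> finite (Hs x)"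
    and card_E: "e \<in> E \<Longrightarrow> card e = 2"
    and hit: "e \<in> E \<Longrightarrow> x \<in> I \<Longrightarrow> h \<in> Hs x \<Longrightarrow> e \<inter> h \<noteq> {}"
    and same: "x \<in> I \<Longrightarrow> h \<in> Hs x \<Longrightarrow> h' \<in> Hs x \<Longrightarrow> h \<inter> h' \<noteq> {}"
    and cross: "x \<in> I \<Longrightarrow> y \<in> I \<Longrightarrow> x \<noteq> y \<Longrightarrow> h \<in> Hs x \<Longrightarrow> h' \<in> Hs y \<Longrightarrow> 2 \<le> card (h \<inter> h')"
    and no_common: "\<exists>x\<in>I. \<exists>h\<in>Hs x. v \<notin> h"
    and codeg: "x \<in> I \<Longrightarrow> card p = 2 \<Longrightarrow> card {h \<in> Hs x. p \<subseteq> h} \<le> 3"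
begin

text \<open>The bound \<open>m^2 + m + 1\<close> of \<open>pair_cover\<close> for
  \<open>m = 2\<close>, with all triples together as the intersecting system.\<close>

lemma card_E_le_7: "card E \<le> 7"
proof -
  interpret pair_cover 2 "\<Union>(Hs ` I)" E
  proof
    show "\<Union>(Hs ` I) \<noteq> {}" using no_common by blast
    show "H \<inter> H' \<noteq> {}" if "H \<in> \<Union>(Hs ` I)" "H' \<in> \<Union>(Hs ` I)" for H H'
    proof -
      obtain x y where x: "x \<in> I" "H \<in> Hs x" "y \<in> I" "H' \<in> Hs y" using \<open>H \<in> \<Union>(Hs ` I)\<close> \<open>H' \<in> \<Union>(Hs ` I)\<close> by blast
      show ?thesis
      proof (cases "x = y")
        case True
        then show ?thesis using same x by blast
      next
        case False
        then have "2 \<le> card (H \<inter> H')" using cross x by blast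
        then show ?thesis by auto
      qed
    qed
  qed (use card_Hs card_E hit no_common in auto)
  show ?thesis using card_E_le by (simp add: power2_eq_square)
qed

text \<open>With three disjoint edges every triple is a transversal and hence a code. Opposite codes
  are disjoint, so \<open>Hs x\<close> has at most 4 triples, and triples for different
  \<open>x\<close>, \<open>y\<close> have codes at distance at most 1. The latter is needed for
  \<open>card I = 2\<close>, where the plain count 4 + 4 + 7 would reach
  \<open>(6 choose 2) = 15\<close>.\<close>

lemma matching_case:
  assumes e: "{a, b} \<in> E" "{c, d} \<in> E" "{p, q} \<in> E" and dist: "distinct [a, b, c, d, p, q]"
    and I: "I \<noteq> {}"
  shows "card E + (\<Sum>x\<in>I. card (Hs x)) \<le> 12 \<or> card E + (\<Sum>x\<in>I. card (Hs x)) < (card I + 4) choose 2"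
proof -
  have dist': "a \<noteq> b" "a \<noteq> c" "a \<noteq> d" "a \<noteq> p" "a \<noteq> q" "b \<noteq> c" "b \<noteq> d" "b \<noteq> p" "b \<noteq> q"
    "c \<noteq> d" "c \<noteq> p" "c \<noteq> q" "d \<noteq> p" "d \<noteq> q" "p \<noteq> q" using dist by simp_all
  define code where "code h = (a \<in> h, c \<in> h, p \<in> h)" for h
  have trans: "h \<subseteq> {a, b, c, d, p, q} \<and> (b \<in> h \<longleftrightarrow> a \<notin> h) \<and> (d \<in> h \<longleftrightarrow> c \<notin> h) \<and> (q \<in> h \<longleftrightarrow> p \<notin> h)"
    if x: "x \<in> I" and h: "h \<in> Hs x" for x h
  proof -
    obtain u where u: "u \<in> h" "u = a \<or> u = b" using hit[OF e(1) x h] by blast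
    obtain v where v: "v \<in> h" "v = c \<or> v = d" using hit[OF e(2) x h] by blast
    obtain w where w: "w \<in> h" "w = p \<or> w = q" using hit[OF e(3) x h] by blast
    have "u \<noteq> v" "u \<noteq> w" "v \<noteq> w" using u v w dist by auto
    then have "h = {u, v, w}" using triple_eqI[OF card_Hs[OF x h] u(1) v(1) w(1)] by simp
    then show ?thesis using u(2) v(2) w(2) dist' by (elim disjE) simp_all
  qed
  have inj: "inj_on code (Hs x)" if x: "x \<in> I" for x
  proof (rule inj_onI)
    fix h h' assume h: "h \<in> Hs x" "h' \<in> Hs x" "code h = code h'"
    show "h = h'" using trans[OF x h(1)] trans[OF x h(2)] h(3) unfolding code_def by blast
  qed
  have agree: "agree2 (code h) (code h')" if "x \<in> I" "y \<in> I" "x \<noteq> y" "h \<in> Hs x" "h' \<in> Hs y" for x y h h'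
  proof (rule ccontr)
    assume no: "\<not> agree2 (code h) (code h')"
    note tr = trans[OF that(1,4)] trans[OF that(2,5)]
    have "\<exists>z. h \<inter> h' \<subseteq> {z}"
    proof -
      consider "(a \<in> h) \<noteq> (a \<in> h')" "(c \<in> h) \<noteq> (c \<in> h')" | "(a \<in> h) \<noteq> (a \<in> h')" "(p \<in> h) \<noteq> (p \<in> h')"
        | "(c \<in> h) \<noteq> (c \<in> h')" "(p \<in> h) \<noteq> (p \<in> h')" using no by (auto simp: code_def)
      then show ?thesis
      proof cases
        case 1
        then have "h \<inter> h' \<subseteq> {if p \<in> h then p else q}" using tr by auto
        then show ?thesis by blast
      next
        case 2
        then have "h \<inter> h' \<subseteq> {if c \<in> h then c else d}" using tr by auto
        then show ?thesis by blast
      next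
        case 3
        then have "h \<inter> h' \<subseteq> {if a \<in> h then a else b}" using tr by auto
        then show ?thesis by blast
      qed
    qed
    then obtain z where "h \<inter> h' \<subseteq> {z}" by blast
    then have "card (h \<inter> h') \<le> 1" using card_mono[of "{z}" "h \<inter> h'"] by simp
    then show False using cross[OF that] by simp
  qed
  have le4: "card (Hs x) \<le> 4" if x: "x \<in> I" for x
  proof -
    have "card (code ` Hs x) \<le> 4"
    proof (rule code_no_antipodal)
      fix i j k assume "(i, j, k) \<in> code ` Hs x"
      then obtain h where h: "h \<in> Hs x" "code h = (i, j, k)" by force
      show "(\<not> i, \<not> j, \<not> k) \<notin> code ` Hs x"
      proof
        assume "(\<not> i, \<not> j, \<not> k) \<in> code ` Hs x"
        then obtain h' where h': "h' \<in> Hs x" "code h' = (\<not> i, \<not> j, \<not> k)" by force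
        have "a \<in> h' \<longleftrightarrow> a \<notin> h" "c \<in> h' \<longleftrightarrow> c \<notin> h" "p \<in> h' \<longleftrightarrow> p \<notin> h"
          using h(2) h'(2) by (auto simp: code_def)
        then have "h \<inter> h' = {}" using trans[OF x h(1)] trans[OF x h'(1)] by blast
        then show False using same[OF x h(1) h'(1)] by simp
      qed
    qed
    then show ?thesis using card_image[OF inj[OF x]] by simp
  qed
  have sum4: "(\<Sum>x\<in>I. card (Hs x)) \<le> 4 * card I"
    using sum_mono[of I "\<lambda>x. card (Hs x)" "\<lambda>_. 4"] le4 by simp
  have cI: "1 \<le> card I" using I finI by (simp add: Suc_leI card_gt_0_iff)
  consider "card I = 1" | "card I = 2" | "3 \<le> card I" using cI by linarith
  then show ?thesis
  proof cases
    case 1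
    then show ?thesis using sum4 card_E_le_7 by simp
  next
    case 2
    then obtain x y where xy: "I = {x, y}" "x \<noteq> y" by (auto simp: card_2_iff)
    \<comment> \<open>Two different codes for \<open>x\<close> confine the codes for
      \<open>y\<close> to the intersection of two balls.\<close>
    have "card (Hs x) \<le> 1 \<or> card (Hs y) \<le> 2"
    proof (rule disjCI)
      assume "\<not> card (Hs y) \<le> 2"
      show "card (Hs x) \<le> 1"
      proof (rule ccontr)
        assume "\<not> card (Hs x) \<le> 1"
        then obtain u w where uw: "u \<in> Hs x" "w \<in> Hs x" "u \<noteq> w"
          using card_le_Suc0_iff_eq[of "Hs x"] fin_Hs[of x] xy(1) by auto
        have "code u \<noteq> code w" using inj[of x] uw xy(1) by (auto simp: inj_on_def)
        then have "card (code ` Hs y) \<le> 2"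
        proof (rule code_common_ball)
          fix s assume "s \<in> code ` Hs y"
          then obtain h where h: "h \<in> Hs y" "s = code h" by blast
          show "agree2 s (code u) \<and> agree2 s (code w)"
            using agree[of y x h u] agree[of y x h w] h uw xy by auto
        qed
        then show False using card_image[OF inj[of y]] xy(1) \<open>\<not> card (Hs y) \<le> 2\<close> by simp
      qed
    qed
    then have "(\<Sum>x\<in>I. card (Hs x)) \<le> 7" using le4[of x] le4[of y] xy by auto
    moreover have "(card I + 4) choose 2 = 15" using 2 by (simp add: choose_two)
    ultimately show ?thesis using card_E_le_7 by linarith
  next
    case 3
    have "8 + 4 * card I \<le> (card I + 4) choose 2"
    proof -
      obtain r where r: "card I = r + 3" using 3 by (metis le_add_diff_inverse2)
      have "2 * (8 + 4 * card I) \<le> (card I + 4) * (card I + 3)" unfolding r by (simp add: algebra_simps)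
      then have "8 + 4 * card I \<le> (card I + 4) * (card I + 3) div 2" by simp
      moreover have "(card I + 4) choose 2 = (card I + 4) * (card I + 3) div 2"
        unfolding choose_two r by simp
      ultimately show ?thesis by simp
    qed
    then show ?thesis using sum4 card_E_le_7 by linarith
  qed
qed

end

section \<open>A cherry and an edge disjoint from it\<close>

lemma card_le_one_of_subset: "A \<subseteq> {z} \<Longrightarrow> card A \<le> 1"
  using card_mono[of "{z}" A] by simp

lemma card_set_le_length: "A \<subseteq> set xs \<Longrightarrow> card A \<le> length xs"
  by (meson List.finite_set card_length card_mono le_trans)

text \<open>The second and third hypotheses encode that \<open>h\<close> meets the two edges
  \<open>{c, d}\<close>, \<open>{c, e}\<close> of a cherry and the disjoint edge
  \<open>{a, b}\<close>. A triple missing the centre \<open>c\<close> contains \<open>d\<close> and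
  \<open>e\<close>; one containing \<open>c\<close> has only two more points, and both must lie in
  \<open>{a, d, e}\<close>.\<close>

lemma triple_meeting_ade:
  assumes "card h = 3" "c \<in> h \<or> d \<in> h \<and> e \<in> h" "a \<in> h \<or> b \<in> h"
    and dist: "a \<noteq> b" "a \<noteq> c" "a \<noteq> d" "a \<noteq> e" "b \<noteq> c" "b \<noteq> d" "b \<noteq> e" "c \<noteq> d" "c \<noteq> e" "d \<noteq> e"
    and two: "2 \<le> card (h \<inter> {a, d, e})"
  shows "h = {a, d, e} \<or> h = {b, d, e} \<or> h = {a, c, d} \<or> h = {a, c, e}"
proof (cases "c \<in> h")
  case False
  then have de: "d \<in> h" "e \<in> h" using assms(2) by auto
  from assms(3) show ?thesis
  proof
    assume "a \<in> h"
    then have "h = {a, d, e}" using triple_eqI[OF assms(1) _ de] dist by simp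
    then show ?thesis by simp
  next
    assume "b \<in> h"
    then have "h = {b, d, e}" using triple_eqI[OF assms(1) _ de] dist by simp
    then show ?thesis by simp
  qed
next
  case c: True
  show ?thesis
  proof (cases "a \<in> h")
    case True
    obtain r where r: "h = {a, c, r}" using third_of_triple[OF assms(1) True c] dist by blast
    have "r = d \<or> r = e"
    proof (rule ccontr)
      assume "\<not> ?thesis"
      then have "h \<inter> {a, d, e} \<subseteq> {a}" using r dist by auto
      then have "card (h \<inter> {a, d, e}) \<le> 1" by (rule card_le_one_of_subset)
      then show False using two by linarith
    qed
    then show ?thesis using r by auto
  next
    case False
    then have "b \<in> h" using assms(3) by simp
    then obtain r where r: "h = {b, c, r}" using third_of_triple[OF assms(1) _ c] dist by blast
    then have "h \<inter> {a, d, e} \<subseteq> {r}" using dist by auto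
    then have "card (h \<inter> {a, d, e}) \<le> 1" by (rule card_le_one_of_subset)
    then show ?thesis using two by linarith
  qed
qed

lemma triple_meeting_acd:
  assumes "card h = 3" "c \<in> h \<or> d \<in> h \<and> e \<in> h" "a \<in> h \<or> b \<in> h"
    and dist: "a \<noteq> b" "a \<noteq> c" "a \<noteq> d" "a \<noteq> e" "b \<noteq> c" "b \<noteq> d" "b \<noteq> e" "c \<noteq> d" "c \<noteq> e" "d \<noteq> e"
    and two: "2 \<le> card (h \<inter> {a, c, d})"
  shows "h = {a, d, e} \<or> h = {b, c, d} \<or> {a, c} \<subseteq> h"
proof (cases "c \<in> h")
  case False
  then have de: "d \<in> h" "e \<in> h" using assms(2) by auto
  have "a \<in> h"
  proof (rule ccontr)
    assume "a \<notin> h"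
    then have "h \<inter> {a, c, d} \<subseteq> {d}" using False by auto
    then show False using card_le_one_of_subset two by fastforce
  qed
  then show ?thesis using triple_eqI[OF assms(1) _ de] dist by simp
next
  case c: True
  show ?thesis
  proof (cases "a \<in> h")
    case False
    then have "b \<in> h" using assms(3) by simp
    then obtain r where r: "h = {b, c, r}" using third_of_triple[OF assms(1) _ c] dist by blast
    have "r = d"
    proof (rule ccontr)
      assume "r \<noteq> d"
      then have "h \<inter> {a, c, d} \<subseteq> {c}" using r dist False by auto
      then show False using card_le_one_of_subset two by fastforce
    qed
    then show ?thesis using r by simp
  qed (use c in simp)
qed

context link_system
begin

text \<open>The triple \<open>{a, d, e}\<close> restricts \<open>Hs y\<close> to four triples. If
  \<open>ade\<close> or \<open>bde\<close> is present there, it restricts \<open>Hs x\<close> to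
  four in turn, and the combinations add up to at most 7. Otherwise \<open>Hs y\<close> has at most
  two triples, and \<open>codeg\<close> for \<open>{a, c}\<close> bounds \<open>Hs x\<close> by
  5.\<close>

lemma cherry_pair_bound:
  assumes E: "{a, b} \<in> E" "{c, d} \<in> E" "{c, e} \<in> E"
    and dist: "a \<noteq> b" "a \<noteq> c" "a \<noteq> d" "a \<noteq> e" "b \<noteq> c" "b \<noteq> d" "b \<noteq> e" "c \<noteq> d" "c \<noteq> e" "d \<noteq> e"
    and x: "x \<in> I" "{a, d, e} \<in> Hs x" and y: "y \<in> I" "y \<noteq> x" "Hs y \<noteq> {}"
  shows "card (Hs x) + card (Hs y) \<le> 7"
proof -
  have shape: "card h = 3" "c \<in> h \<or> d \<in> h \<and> e \<in> h" "a \<in> h \<or> b \<in> h" if "z \<in> I" "h \<in> Hs z" for z h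
    using hit[OF E(1) that] hit[OF E(2) that] hit[OF E(3) that] card_Hs[OF that] by auto
  define ade bde acd ace bcd bce where sets: "ade = {a, d, e}" "bde = {b, d, e}" "acd = {a, c, d}" "ace = {a, c, e}"
    "bcd = {b, c, d}" "bce = {b, c, e}"
  have neq: "acd \<noteq> bcd" "acd \<noteq> bce" "ace \<noteq> bcd" "ace \<noteq> bce" unfolding sets using dist by blast+
  have Q: "Hs y \<subseteq> set [ade, bde, acd, ace]"
  proof
    fix h assume h: "h \<in> Hs y"
    have "2 \<le> card (h \<inter> {a, d, e})" using cross[OF y(1) x(1) y(2) h x(2)] .
    from triple_meeting_ade[OF shape[OF y(1) h] dist this, folded sets]
    show "h \<in> set [ade, bde, acd, ace]" by auto
  qed
  have y4: "card (Hs y) \<le> 4" using card_set_le_length[OF Q] by simp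
  have ade: "Hs x \<subseteq> set [ade, bde, acd, ace]" if "ade \<in> Hs y"
  proof
    fix h assume h: "h \<in> Hs x"
    have "2 \<le> card (h \<inter> {a, d, e})" using cross[OF x(1) y(1) y(2)[symmetric] h that] unfolding sets .
    from triple_meeting_ade[OF shape[OF x(1) h] dist this, folded sets]
    show "h \<in> set [ade, bde, acd, ace]" by auto
  qed
  have bde: "Hs x \<subseteq> set [bde, ade, bcd, bce]" if "bde \<in> Hs y"
  proof
    fix h assume h: "h \<in> Hs x"
    have "2 \<le> card (h \<inter> {b, d, e})" using cross[OF x(1) y(1) y(2)[symmetric] h that] unfolding sets .
    moreover have "b \<in> h \<or> a \<in> h" using shape(3)[OF x(1) h] by blast
    ultimately have "h = {b, d, e} \<or> h = {a, d, e} \<or> h = {b, c, d} \<or> h = {b, c, e}"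
      using triple_meeting_ade[OF shape(1,2)[OF x(1) h], of b a] dist by metis
    then show "h \<in> set [bde, ade, bcd, bce]" unfolding sets[symmetric] by auto
  qed
  show ?thesis
  proof (cases "ade \<in> Hs y \<or> bde \<in> Hs y")
    case True
    then have x4: "card (Hs x) \<le> 4" using card_set_le_length[OF ade] card_set_le_length[OF bde] by auto
    show ?thesis
    proof (cases "ade \<in> Hs y \<and> bde \<in> Hs y")
      case True
      then have "Hs x \<subseteq> set [ade, bde]" using ade bde neq by auto
      from card_set_le_length[OF this] show ?thesis using y4 by simp
    next
      case False
      have "card (Hs y) \<le> 3"
      proof (cases "ade \<in> Hs y")
        case True
        then have "Hs y \<subseteq> set [ade, acd, ace]" using False Q by auto
        from card_set_le_length[OF this] show ?thesis by simp
      next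
        case F: False
        then have "Hs y \<subseteq> set [bde, acd, ace]" using Q by auto
        from card_set_le_length[OF this] show ?thesis by simp
      qed
      then show ?thesis using x4 by simp
    qed
  next
    case False
    then have sub: "Hs y \<subseteq> set [acd, ace]" using Q by auto
    have y2: "card (Hs y) \<le> 2" using card_set_le_length[OF sub] by simp
    define A where "A = {h \<in> Hs x. {a, c} \<subseteq> h}"
    have ac: "card A \<le> 3" unfolding A_def using codeg[OF x(1), of "{a, c}"] dist by simp
    have bound: "card (Hs x) \<le> 5" if "Hs x \<subseteq> {p, q} \<union> A" for p q
    proof -
      have "card (Hs x) \<le> card ({p, q} \<union> A)"
        using that fin_Hs[OF x(1)] by (intro card_mono) (auto simp: A_def)
      also have "\<dots> \<le> card {p, q} + card A" by (rule card_Un_le)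
      also have "card {p, q} \<le> 2" by (simp add: card_insert_if)
      finally show ?thesis using ac by simp
    qed
    from y(3) sub consider "acd \<in> Hs y" | "ace \<in> Hs y" by auto
    then have "card (Hs x) \<le> 5"
    proof cases
      case 1
      have "Hs x \<subseteq> {ade, bcd} \<union> A"
      proof
        fix h assume h: "h \<in> Hs x"
        have "2 \<le> card (h \<inter> {a, c, d})" using cross[OF x(1) y(1) y(2)[symmetric] h 1] unfolding sets .
        from triple_meeting_acd[OF shape[OF x(1) h] dist this, folded sets]
        show "h \<in> {ade, bcd} \<union> A" using h by (auto simp: A_def)
      qed
      then show ?thesis by (rule bound)
    next
      case 2
      have "Hs x \<subseteq> {{a, e, d}, bce} \<union> A"
      proof
        fix h assume h: "h \<in> Hs x"
        have "2 \<le> card (h \<inter> {a, c, e})" using cross[OF x(1) y(1) y(2)[symmetric] h 2] unfolding sets .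
        moreover have "c \<in> h \<or> e \<in> h \<and> d \<in> h" using shape(2)[OF x(1) h] by blast
        ultimately have "h = {a, e, d} \<or> h = bce \<or> {a, c} \<subseteq> h"
          unfolding sets using triple_meeting_acd[OF shape(1)[OF x(1) h], of c e d a b] shape(3)[OF x(1) h] dist by metis
        then show "h \<in> {{a, e, d}, bce} \<union> A" using h unfolding A_def by (elim disjE) simp_all
      qed
      then show ?thesis by (rule bound)
    qed
    then show ?thesis using y2 by simp
  qed
qed

text \<open>12 is 5 + 7 in two ways: either \<open>Hs x\<close> has at most 5 triples and
  \<open>E\<close> at most 7 edges, or six triples are present and exclude all but 5 edges.\<close>

lemma cherry_single_bound:
  assumes E: "{a, b} \<in> E" "{c, d} \<in> E" "{c, e} \<in> E"
    and dist: "a \<noteq> b" "a \<noteq> c" "a \<noteq> d" "a \<noteq> e" "b \<noteq> c" "b \<noteq> d" "b \<noteq> e" "c \<noteq> d" "c \<noteq> e" "d \<noteq> e"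
    and x: "x \<in> I" "{a, d, e} \<in> Hs x"
  shows "card E + card (Hs x) \<le> 12"
proof (cases "card (Hs x) \<le> 5")
  case True
  then show ?thesis using card_E_le_7 by simp
next
  case False
  define ade bde abc acd ace bcd bce where sets: "ade = {a, d, e}" "bde = {b, d, e}" "abc = {a, c, b}"
    "acd = {a, c, d}" "ace = {a, c, e}" "bcd = {b, c, d}" "bce = {b, c, e}"
  define ab ac bd cd de be ce where pairs: "ab = {a, b}" "ac = {a, c}" "bd = {b, d}" "cd = {c, d}"
    "de = {d, e}" "be = {b, e}" "ce = {c, e}"
  \<comment> \<open>For triples containing \<open>a\<close> and \<open>c\<close> the bound comes
    from \<open>codeg\<close>; all other triples are among \<open>ade\<close>, \<open>bde\<close>,
    \<open>bcd\<close>, \<open>bce\<close>.\<close>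
  define A where "A = {h \<in> Hs x. {a, c} \<subseteq> h}"
  have A3: "card A \<le> 3" unfolding A_def using codeg[OF x(1), of "{a, c}"] dist by simp
  have finA: "finite A" unfolding A_def using fin_Hs[OF x(1)] by simp
  have sub: "Hs x \<subseteq> set [ade, bde, bcd, bce] \<union> A"
  proof
    fix h assume h: "h \<in> Hs x"
    have s: "card h = 3" "c \<in> h \<or> d \<in> h \<and> e \<in> h" "a \<in> h \<or> b \<in> h"
      using hit[OF E(1) x(1) h] hit[OF E(2) x(1) h] hit[OF E(3) x(1) h] card_Hs[OF x(1) h] by auto
    show "h \<in> set [ade, bde, bcd, bce] \<union> A"
    proof (cases "c \<in> h")
      case False
      then have de: "d \<in> h" "e \<in> h" using s(2) by auto
      from s(3) have "h = ade \<or> h = bde"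
        using triple_eqI[OF s(1) _ de, of a] triple_eqI[OF s(1) _ de, of b] dist unfolding sets by blast
      then show ?thesis by auto
    next
      case c: True
      show ?thesis
      proof (cases "a \<in> h")
        case True
        then show ?thesis using h c by (simp add: A_def)
      next
        case False
        then have "b \<in> h" using s(3) by simp
        then obtain r where r: "h = {b, c, r}" using third_of_triple[OF s(1) _ c] dist by blast
        have "r \<noteq> a" using False r by auto
        then have "r = d \<or> r = e" using same[OF x(1) h x(2)] r dist by auto
        then have "h = bcd \<or> h = bce" using r unfolding sets by (elim disjE) simp_all
        then show ?thesis by auto
      qed
    qed
  qed
  have third: "\<exists>r. h = {a, c, r} \<and> h \<in> Hs x" if "h \<in> A" for h
  proof -
    have h: "h \<in> Hs x" "a \<in> h" "c \<in> h" using that by (auto simp: A_def)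
    show ?thesis using third_of_triple[OF card_Hs[OF x(1) h(1)] h(2,3)] dist(2) h(1) by metis
  qed
  have bound: "card (Hs x) \<le> length xs + card A" if "Hs x \<subseteq> set xs \<union> A" for xs :: "'a set list"
  proof -
    have "card (Hs x) \<le> card (set xs \<union> A)" using that finA by (intro card_mono) auto
    also have "\<dots> \<le> card (set xs) + card A" by (rule card_Un_le)
    finally show ?thesis using card_length[of xs] by simp
  qed
  have x7: "card (Hs x) \<le> 7" using bound[OF sub] A3 by simp
  have E_hit: "f \<inter> h \<noteq> {}" if "f \<in> E" "h \<in> Hs x" for f h using hit[OF that(1) x(1) that(2)] .
  have A_sub: "A \<subseteq> set [abc, acd, ace]" if bde: "bde \<in> Hs x"
  proof
    fix h assume "h \<in> A"
    from third[OF this] obtain r where r: "h = {a, c, r}" "h \<in> Hs x" by blast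
    have "r = b \<or> r = d \<or> r = e" using same[OF x(1) r(2) bde] r dist unfolding sets by auto
    then have "h = abc \<or> h = acd \<or> h = ace" using r unfolding sets by (elim disjE) simp_all
    then show "h \<in> set [abc, acd, ace]" by auto
  qed
  have "card E \<le> 5"
  proof (cases "bcd \<in> Hs x \<and> bce \<in> Hs x")
    case bc: True
    \<comment> \<open>An edge has an end in \<open>{a, d, e}\<close> and meets both
      \<open>bcd\<close> and \<open>bce\<close>, which leaves seven candidates. In each subcase the
      remaining triples exclude two of them.\<close>
    have E7: "E \<subseteq> set [ab, ac, bd, cd, de, be, ce]"
    proof
      fix f assume f: "f \<in> E"
      obtain p q where pq: "f = {p, q}" "p \<noteq> q" "p \<in> {a, d, e}"
        using pair_meeting[OF card_E[OF f] E_hit[OF f x(2)]] by blast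
      have h: "{p, q} \<inter> {b, c, d} \<noteq> {}" "{p, q} \<inter> {b, c, e} \<noteq> {}"
        using E_hit[OF f] bc pq(1) unfolding sets by auto
      from pq(3) consider "p = a" | "p = d" | "p = e" by blast
      then have "f = ab \<or> f = ac \<or> f = bd \<or> f = cd \<or> f = de \<or> f = be \<or> f = ce"
      proof cases
        case 1
        then have "q = b \<or> q = c" using h dist by auto
        then show ?thesis using 1 pq(1) unfolding pairs by (elim disjE) (simp_all add: insert_commute)
      next
        case 2
        then have "q = b \<or> q = c \<or> q = e" using h dist by auto
        then show ?thesis using 2 pq(1) unfolding pairs by (elim disjE) (simp_all add: insert_commute)
      next
        case 3
        then have "q = b \<or> q = c \<or> q = d" using h dist by auto
        then show ?thesis using 3 pq(1) unfolding pairs by (elim disjE) (simp_all add: insert_commute)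
      qed
      then show "f \<in> set [ab, ac, bd, cd, de, be, ce]" by auto
    qed
    show ?thesis
    proof (cases "bde \<in> Hs x")
      case bde: True
      have nac: "ac \<notin> E" using E_hit[OF _ bde, of ac] dist unfolding sets pairs by auto
      have A2: "2 \<le> card A" using bound[OF sub] False by simp
      show ?thesis
      proof (cases "abc \<in> Hs x")
        case True
        have "de \<notin> E" using E_hit[OF _ True, of de] dist unfolding sets pairs by auto
        then have "E \<subseteq> set [ab, bd, cd, be, ce]" using E7 nac by auto
        from card_set_le_length[OF this] show ?thesis by simp
      next
        case F: False
        have "ace \<in> Hs x"
        proof (rule ccontr)
          assume "ace \<notin> Hs x"
          then have "A \<subseteq> set [acd]" using A_sub[OF bde] F by (auto simp: A_def)
          from card_set_le_length[OF this] show False using A2 by simp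
        qed
        then have "bd \<notin> E" using E_hit[of bd ace] dist unfolding sets pairs by auto
        then have "E \<subseteq> set [ab, cd, de, be, ce]" using E7 nac by auto
        from card_set_le_length[OF this] show ?thesis by simp
      qed
    next
      case nbde: False
      then have "Hs x \<subseteq> set [ade, bcd, bce] \<union> A" using sub by auto
      from bound[OF this] have A3': "3 \<le> card A" using False by simp
      \<comment> \<open>Such an edge would confine the third points of the triples in
        \<open>A\<close> to \<open>b\<close> and \<open>z\<close>, but here \<open>A\<close> has
        three members.\<close>
      have excl: "{b, z} \<notin> E" if z: "z = d \<or> z = e" for z
      proof
        assume bz: "{b, z} \<in> E"
        have "A \<subseteq> set [{a, c, b}, {a, c, z}]"
        proof
          fix h assume "h \<in> A"
          from third[OF this] obtain r where r: "h = {a, c, r}" "h \<in> Hs x" by blast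
          have "r = b \<or> r = z" using E_hit[OF bz r(2)] r dist z by auto
          then show "h \<in> set [{a, c, b}, {a, c, z}]" using r by (elim disjE) simp_all
        qed
        from card_set_le_length[OF this] show False using A3' by simp
      qed
      then have "bd \<notin> E" "be \<notin> E" unfolding pairs by blast+
      then have "E \<subseteq> set [ab, ac, cd, de, ce]" using E7 by auto
      from card_set_le_length[OF this] show ?thesis by simp
    qed
  next
    case nbc: False
    \<comment> \<open>At most one of \<open>bcd\<close> and \<open>bce\<close> is present;
      \<open>z\<close> is the point of \<open>{d, e}\<close> for which \<open>bcz\<close> can be,
      and \<open>w\<close> is the other one, so that the symmetric cases are treated at once. Six
      triples then force \<open>bde\<close>, \<open>bcz\<close> and a full \<open>A\<close> to be
      present.\<close>
    define z where "z = (if bcd \<in> Hs x then d else e)"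
    define w where "w = (if bcd \<in> Hs x then e else d)"
    define bcz acw where sets': "bcz = {b, c, z}" "acw = {a, c, w}"
    have zw: "z \<noteq> w" "z \<noteq> a" "z \<noteq> b" "z \<noteq> c" "w \<noteq> a" "w \<noteq> b" "w \<noteq> c"
      using dist by (auto simp: z_def w_def)
    have zw': "{a, d, e} = {a, z, w}" "{b, d, e} = {b, z, w}" by (auto simp: z_def w_def)
    have bcz': "bcz = (if bcd \<in> Hs x then bcd else bce)" by (simp add: sets' sets z_def)
    have acw': "acw = (if bcd \<in> Hs x then ace else acd)" by (simp add: sets' sets w_def)
    have sub1: "Hs x \<subseteq> set [ade, bde, bcz] \<union> A" using sub nbc by (auto simp: bcz')
    have A3': "3 \<le> card A" using bound[OF sub1] False by simp
    have bde: "bde \<in> Hs x"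
    proof (rule ccontr)
      assume "bde \<notin> Hs x"
      then have "Hs x \<subseteq> set [ade, bcz] \<union> A" using sub1 by auto
      from bound[OF this] show False using False A3 by simp
    qed
    have bcz: "bcz \<in> Hs x"
    proof (rule ccontr)
      assume "bcz \<notin> Hs x"
      then have "Hs x \<subseteq> set [ade, bde] \<union> A" using sub1 by auto
      from bound[OF this] show False using False A3 by simp
    qed
    have "A = set [abc, acd, ace]"
    proof (rule card_seteq[OF _ A_sub[OF bde]])
      show "card (set [abc, acd, ace]) \<le> card A"
        using card_length[of "[abc, acd, ace]"] A3' by simp
    qed simp
    then have inA: "abc \<in> A" "acw \<in> A" by (auto simp: acw')
    then have acb: "abc \<in> Hs x" and acw: "acw \<in> Hs x" by (auto simp: A_def)
    have "E \<subseteq> set [{a, b}, {a, z}, {c, z}, {b, w}, {c, w}]"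
    proof
      fix f assume f: "f \<in> E"
      obtain p q where pq: "f = {p, q}" "p \<noteq> q" "p \<in> {a, c, b}"
        using pair_meeting[OF card_E[OF f] E_hit[OF f acb]] unfolding sets by blast
      have h: "{p, q} \<inter> {a, z, w} \<noteq> {}" "{p, q} \<inter> {b, z, w} \<noteq> {}" "{p, q} \<inter> {b, c, z} \<noteq> {}" "{p, q} \<inter> {a, c, w} \<noteq> {}"
        using E_hit[OF f x(2)] E_hit[OF f bde] E_hit[OF f bcz] E_hit[OF f acw] unfolding pq(1) zw' sets sets' by blast+
      from pq(3) consider "p = a" | "p = b" | "p = c" by blast
      then have "f = {a, b} \<or> f = {a, z} \<or> f = {c, z} \<or> f = {b, w} \<or> f = {c, w}"
      proof cases
        case 1
        then have "q = b \<or> q = z" using h zw dist by auto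
        then show ?thesis using 1 pq(1) by (elim disjE) simp_all
      next
        case 2
        then have "q = a \<or> q = w" using h zw dist by auto
        then show ?thesis using 2 pq(1) by (elim disjE) (simp_all add: insert_commute)
      next
        case 3
        then have "q = z \<or> q = w" using h zw dist by auto
        then show ?thesis using 3 pq(1) by (elim disjE) simp_all
      qed
      then show "f \<in> set [{a, b}, {a, z}, {c, z}, {b, w}, {c, w}]" by (simp only: list.set insert_iff empty_iff simp_thms)
    qed
    from card_set_le_length[OF this] show ?thesis by simp
  qed
  then show ?thesis using x7 by simp
qed

text \<open>If no other point of \<open>I\<close> contributes triples, the bound 12 holds. Otherwise
  \<open>x\<close> and \<open>y\<close> contribute at most 7 together and each further point at most
  4; with \<open>r = card I - 2\<close> the total \<open>14 + 4 r\<close> stays below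
  \<open>(r + 6 choose 2)\<close>.\<close>

lemma cherry_case_aux:
  assumes E: "{a, b} \<in> E" "{c, d} \<in> E" "{c, e} \<in> E"
    and dist: "a \<noteq> b" "a \<noteq> c" "a \<noteq> d" "a \<noteq> e" "b \<noteq> c" "b \<noteq> d" "b \<noteq> e" "c \<noteq> d" "c \<noteq> e" "d \<noteq> e"
    and x: "x \<in> I" "{a, d, e} \<in> Hs x"
  shows "card E + (\<Sum>x\<in>I. card (Hs x)) \<le> 12 \<or> card E + (\<Sum>x\<in>I. card (Hs x)) < (card I + 4) choose 2"
proof (cases "\<exists>y\<in>I. y \<noteq> x \<and> Hs y \<noteq> {}")
  case False
  then have "(\<Sum>y\<in>I - {x}. card (Hs y)) = 0" by (intro sum.neutral) auto
  then have "(\<Sum>x\<in>I. card (Hs x)) = card (Hs x)" using sum.remove[OF finI x(1), of "\<lambda>x. card (Hs x)"] by simp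
  then show ?thesis using cherry_single_bound[OF assms] by simp
next
  case True
  then obtain y where y: "y \<in> I" "y \<noteq> x" "Hs y \<noteq> {}" by blast
  have xy: "card (Hs x) + card (Hs y) \<le> 7" by (rule cherry_pair_bound[OF assms y])
  have le4: "card (Hs z) \<le> 4" if z: "z \<in> I - {x}" for z
  proof -
    have "Hs z \<subseteq> set [{a, d, e}, {b, d, e}, {a, c, d}, {a, c, e}]"
    proof
      fix h assume h: "h \<in> Hs z"
      have zI: "z \<in> I" using z by simp
      have "2 \<le> card (h \<inter> {a, d, e})" using cross[OF zI x(1) _ h x(2)] z by simp
      moreover have "c \<in> h \<or> d \<in> h \<and> e \<in> h" "a \<in> h \<or> b \<in> h"
        using hit[OF E(1) zI h] hit[OF E(2) zI h] hit[OF E(3) zI h] by auto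
      ultimately show "h \<in> set [{a, d, e}, {b, d, e}, {a, c, d}, {a, c, e}]"
        using triple_meeting_ade[OF card_Hs[OF zI h] _ _ dist] by (simp only: list.set insert_iff empty_iff simp_thms)
    qed
    from card_set_le_length[OF this] show ?thesis by simp
  qed
  have "(\<Sum>z\<in>I. card (Hs z)) = card (Hs x) + (card (Hs y) + (\<Sum>z\<in>I - {x} - {y}. card (Hs z)))"
    using sum.remove[OF finI x(1), of "\<lambda>x. card (Hs x)"] sum.remove[of "I - {x}" y "\<lambda>x. card (Hs x)"] finI y by simp
  also have "(\<Sum>z\<in>I - {x} - {y}. card (Hs z)) \<le> (\<Sum>z\<in>I - {x} - {y}. 4)" using le4 by (intro sum_mono) auto
  also have "\<dots> = 4 * (card I - 2)" using finI x(1) y by (simp add: card_Diff_singleton)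
  finally have sum: "(\<Sum>z\<in>I. card (Hs z)) \<le> 7 + 4 * (card I - 2)" using xy by simp
  have "2 \<le> card I" using card_mono[OF finI, of "{x, y}"] x(1) y by simp
  then obtain r where r: "card I = r + 2" by (metis le_add_diff_inverse2)
  have "2 * (15 + 4 * r) \<le> (r + 6) * (r + 5)" by (simp add: algebra_simps)
  then have "15 + 4 * r \<le> (r + 6) * (r + 5) div 2" by simp
  moreover have "(card I + 4) choose 2 = (r + 6) * (r + 5) div 2"
    unfolding choose_two r by (simp add: add.commute)
  ultimately have "15 + 4 * r \<le> (card I + 4) choose 2" by simp
  then show ?thesis using sum card_E_le_7 r by simp
qed

lemma cherry_case:
  assumes E: "{a, b} \<in> E" "{c, d} \<in> E" "{c, e} \<in> E"
    and dist: "a \<noteq> b" "a \<noteq> c" "a \<noteq> d" "a \<noteq> e" "b \<noteq> c" "b \<noteq> d" "b \<noteq> e" "c \<noteq> d" "c \<noteq> e" "d \<noteq> e"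
  shows "card E + (\<Sum>x\<in>I. card (Hs x)) \<le> 12 \<or> card E + (\<Sum>x\<in>I. card (Hs x)) < (card I + 4) choose 2"
proof -
  \<comment> \<open>\<open>no_common\<close> is applied to the centre of the cherry: a triple
    missing \<open>c\<close> contains \<open>d\<close>, \<open>e\<close> and one of
    \<open>a\<close>, \<open>b\<close>, which are interchangeable.\<close>
  obtain x h where h: "x \<in> I" "h \<in> Hs x" "c \<notin> h" using no_common by blast
  have de: "d \<in> h" "e \<in> h" using hit[OF E(2) h(1,2)] hit[OF E(3) h(1,2)] h(3) by auto
  have "a \<in> h \<or> b \<in> h" using hit[OF E(1) h(1,2)] by auto
  then show ?thesis
  proof
    assume "a \<in> h"
    then have "h = {a, d, e}" using triple_eqI[OF card_Hs[OF h(1,2)] _ de] dist by simp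
    then show ?thesis using cherry_case_aux[OF assms h(1)] h(2) by simp
  next
    assume "b \<in> h"
    then have "h = {b, d, e}" using triple_eqI[OF card_Hs[OF h(1,2)] _ de] dist by simp
    then show ?thesis using cherry_case_aux[of b a c d e x] E dist h(1,2) by (auto simp: insert_commute)
  qed
qed

lemma two_edges_avoiding_third:
  assumes e: "e1 \<in> E" "e2 \<in> E" "e3 \<in> E" "e1 \<inter> e2 = {}" "e1 \<inter> e3 = {}" "e2 \<noteq> e3" and I: "I \<noteq> {}"
  shows "card E + (\<Sum>x\<in>I. card (Hs x)) \<le> 12 \<or> card E + (\<Sum>x\<in>I. card (Hs x)) < (card I + 4) choose 2"
proof -
  obtain a b where ab: "e1 = {a, b}" "a \<noteq> b" using card_E[OF e(1)] by (auto simp: card_2_iff)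
  show ?thesis
  proof (cases "e2 \<inter> e3 = {}")
    case True
    obtain c d where cd: "e2 = {c, d}" "c \<noteq> d" using card_E[OF e(2)] by (auto simp: card_2_iff)
    obtain p q where pq: "e3 = {p, q}" "p \<noteq> q" using card_E[OF e(3)] by (auto simp: card_2_iff)
    have "distinct [a, b, c, d, p, q]" using ab cd pq e True by auto
    then show ?thesis using matching_case[of a b c d p q] e ab cd pq I by simp
  next
    case False
    then obtain c where c: "c \<in> e2" "c \<in> e3" by blast
    obtain d where d: "d \<noteq> c" "e2 = {c, d}" using other_of_pair[OF card_E[OF e(2)] c(1)] by blast
    obtain f where f: "f \<noteq> c" "e3 = {c, f}" using other_of_pair[OF card_E[OF e(3)] c(2)] by blast
    have "d \<noteq> f" using d f e(6) by auto
    then show ?thesis using cherry_case[of a b c d f] e ab d f by auto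
  qed
qed

end

text \<open>The added point must lie in \<open>F\<close> and lift the intersection to
  \<open>t\<close>, so \<open>S \<inter> F\<close> has exactly \<open>t - 1\<close> points as soon
  as \<open>G\<close> is nonempty. The exact number of candidates matters where all of them
  occur.\<close>

lemma one_point_extensions:
  assumes "finite S" "finite F" "card F = k" "t \<le> k" "card (S \<inter> F) < t"
    and G: "\<And>T. T \<in> G \<Longrightarrow> S \<subseteq> T" "\<And>T. T \<in> G \<Longrightarrow> card T = card S + 1" "\<And>T. T \<in> G \<Longrightarrow> t \<le> card (T \<inter> F)"
  shows "G \<subseteq> (\<lambda>x. insert x S) ` (F - S)" "G \<noteq> {} \<Longrightarrow> card (F - S) = k - t + 1"
    "finite G" "card G \<le> k - t + 1"
proof -
  have ext: "\<exists>x\<in>F - S. T = insert x S \<and> card (S \<inter> F) = t - 1" if T: "T \<in> G" for T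
  proof -
    have "card (T - S) = 1" using G(1,2)[OF T] assms(1) by (simp add: card_Diff_subset)
    then obtain x where "T - S = {x}" by (metis card_1_singletonE)
    then have x: "T = insert x S" "x \<notin> S" using G(1)[OF T] by auto
    have xF: "x \<in> F"
    proof (rule ccontr)
      assume "x \<notin> F"
      then have "T \<inter> F = S \<inter> F" using x by auto
      then show False using G(3)[OF T] assms(5) by simp
    qed
    have "T \<inter> F = insert x (S \<inter> F)" using x xF by auto
    then have "card (T \<inter> F) = card (S \<inter> F) + 1" using x(2) assms(1) by simp
    then show ?thesis using G(3)[OF T] assms(5) x xF by auto
  qed
  show sub: "G \<subseteq> (\<lambda>x. insert x S) ` (F - S)" using ext by blast
  show cF: "card (F - S) = k - t + 1" if "G \<noteq> {}"
  proof -
    have "card (S \<inter> F) = t - 1" using ext that by blast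
    then show ?thesis using card_Diff_subset_Int[of F S] assms by (simp add: Int_commute)
  qed
  show "finite G" using sub assms(2) finite_subset by blast
  have "card G \<le> card (F - S)" using surj_card_le[OF _ sub] assms(2) by simp
  then show "card G \<le> k - t + 1" using cF by (cases "G = {}") auto
qed

section \<open>Intersecting systems of \<open>(t + 2)\<close>-sets, seen from one member\<close>

locale t_system =
  fixes t :: nat and TT :: "'a set set"
  assumes t_pos: "0 < t" and fin_TT: "finite TT"
    and card_TT: "T \<in> TT \<Longrightarrow> card T = t + 2"
    and inter_TT: "T \<in> TT \<Longrightarrow> T' \<in> TT \<Longrightarrow> t \<le> card (T \<inter> T')"
    and no_cover: "card S = t + 1 \<Longrightarrow> \<exists>T\<in>TT. card (S \<inter> T) < t"
begin

lemma fin_T: "T \<in> TT \<Longrightarrow> finite T"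
  using card_TT[of T] card.infinite by fastforce

lemma codegree:
  assumes "card S = t + 1"
  shows "card {T \<in> TT. S \<subseteq> T} \<le> 3"
proof -
  obtain T' where T': "T' \<in> TT" "card (S \<inter> T') < t" using no_cover[OF assms] by blast
  have "finite S" using assms card.infinite by fastforce
  then have "card {T \<in> TT. S \<subseteq> T} \<le> t + 2 - t + 1"
    using fin_T[OF T'(1)] card_TT[OF T'(1)] T'(2) card_TT assms inter_TT[OF _ T'(1)]
    by (intro one_point_extensions(4)[of S T']) auto
  then show ?thesis by simp
qed

text \<open>A member other than \<open>T1\<close> meets it in \<open>t\<close> points and is counted
  by \<open>far\<close>, or in \<open>t + 1\<close> points and is counted by \<open>near\<close> at
  the missing point \<open>i\<close>.\<close>

definition far :: "'a set \<Rightarrow> 'a set \<Rightarrow> 'a set set" where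
  "far T1 X = {T \<in> TT. T \<inter> T1 = X}"

definition near :: "'a set \<Rightarrow> 'a \<Rightarrow> 'a set set" where
  "near T1 i = {T \<in> TT. T1 - {i} \<subseteq> T \<and> T \<noteq> T1}"

lemma TT_split:
  assumes T1: "T1 \<in> TT"
  shows "TT \<subseteq> insert T1 ((\<Union>i\<in>T1. near T1 i) \<union> (\<Union>X\<in>{X. X \<subseteq> T1 \<and> card X = t}. far T1 X))"
proof
  fix T assume T: "T \<in> TT"
  show "T \<in> insert T1 ((\<Union>i\<in>T1. near T1 i) \<union> (\<Union>X\<in>{X. X \<subseteq> T1 \<and> card X = t}. far T1 X))"
  proof (cases "card (T \<inter> T1) = t")
    case True
    then have "T \<in> far T1 (T \<inter> T1)" using T by (simp add: far_def)
    then show ?thesis using True by blast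
  next
    case False
    then have ge: "t + 1 \<le> card (T \<inter> T1)" using inter_TT[OF T T1] by simp
    have "card (T1 - T) \<le> 1"
      using card_Diff_subset_Int[of T1 T] fin_T[OF T1] card_TT[OF T1] ge by (simp add: Int_commute)
    moreover have fd: "finite (T1 - T)" using fin_T[OF T1] by simp
    ultimately consider "T1 - T = {}" | i where "T1 - T = {i}"
      by (metis One_nat_def card_0_eq card_1_singletonE le_Suc_eq le_zero_eq)
    then show ?thesis
    proof cases
      case 1
      then have "T = T1" using card_subset_eq[OF fin_T[OF T], of T1] card_TT[OF T] card_TT[OF T1] by auto
      then show ?thesis by simp
    next
      case 2
      then have "i \<in> T1" "T1 - {i} \<subseteq> T" "T \<noteq> T1" by auto
      then show ?thesis using T by (auto simp: near_def)
    qed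
  qed
qed

lemma card_near:
  assumes "T1 \<in> TT" "i \<in> T1"
  shows "card (near T1 i) \<le> 2"
proof -
  have "card (T1 - {i}) = t + 1" using assms card_TT[OF assms(1)] fin_T[OF assms(1)] by simp
  then have "card {T \<in> TT. T1 - {i} \<subseteq> T} \<le> 3" by (rule codegree)
  moreover have "{T \<in> TT. T1 - {i} \<subseteq> T} = insert T1 (near T1 i)" using assms by (auto simp: near_def)
  moreover have "T1 \<notin> near T1 i" "finite (near T1 i)" using fin_TT by (auto simp: near_def)
  ultimately show ?thesis by simp
qed

text \<open>With the at most two near members per point of \<open>card_near\<close> the bound
  becomes \<open>1 + 2 (t + 2) + (t+2 choose 2) = (t+4 choose 2)\<close>, so reaching that value
  forces exactly two at every point.\<close>

lemma card_TT_le_sum: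
  assumes T1: "T1 \<in> TT" and far1: "\<And>X. X \<subseteq> T1 \<Longrightarrow> card X = t \<Longrightarrow> card (far T1 X) \<le> 1"
  shows "card TT \<le> 1 + (\<Sum>i\<in>T1. card (near T1 i)) + ((t + 2) choose 2)"
proof -
  let ?P = "{X. X \<subseteq> T1 \<and> card X = t}"
  have finP: "finite ?P" using fin_T[OF T1] by simp
  have fN: "finite (near T1 i)" and fF: "finite (far T1 X)" for i X using fin_TT by (auto simp: near_def far_def)
  have "card TT \<le> card (insert T1 ((\<Union>i\<in>T1. near T1 i) \<union> (\<Union>X\<in>?P. far T1 X)))"
    using TT_split[OF T1] fin_T[OF T1] finP fN fF by (intro card_mono) auto
  also have "\<dots> \<le> 1 + card ((\<Union>i\<in>T1. near T1 i) \<union> (\<Union>X\<in>?P. far T1 X))"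
    using fin_T[OF T1] finP fN fF by (simp add: card_insert_if)
  also have "card ((\<Union>i\<in>T1. near T1 i) \<union> (\<Union>X\<in>?P. far T1 X)) \<le> card (\<Union>i\<in>T1. near T1 i) + card (\<Union>X\<in>?P. far T1 X)"
    by (rule card_Un_le)
  also have "card (\<Union>i\<in>T1. near T1 i) \<le> (\<Sum>i\<in>T1. card (near T1 i))" by (rule card_UN_le[OF fin_T[OF T1]])
  also have "card (\<Union>X\<in>?P. far T1 X) \<le> (\<Sum>X\<in>?P. card (far T1 X))" by (rule card_UN_le[OF finP])
  also have "(\<Sum>X\<in>?P. card (far T1 X)) \<le> (\<Sum>X\<in>?P. 1)" using far1 by (intro sum_mono) auto
  also have "\<dots> = (t + 2) choose 2"
    using n_subsets[OF fin_T[OF T1], of t] card_TT[OF T1] binomial_symmetric[of t "t + 2"] by simp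
  finally show ?thesis by simp
qed

text \<open>Equality provides, for each \<open>i\<close> in \<open>T1\<close>, exactly two points
  that can replace \<open>i\<close>. The hypothesis on \<open>far\<close>, applied to members other
  than \<open>T1\<close>, forces the same two points for all \<open>i\<close>; together with
  \<open>T1\<close> they form \<open>Z\<close>.\<close>

lemma far_le_one_case:
  assumes ne: "TT \<noteq> {}" and far1: "\<And>T1 X. T1 \<in> TT \<Longrightarrow> X \<subseteq> T1 \<Longrightarrow> card X = t \<Longrightarrow> card (far T1 X) \<le> 1"
  shows "card TT < (t + 4) choose 2 \<or> (\<exists>Z. card Z = t + 4 \<and> TT = {T. T \<subseteq> Z \<and> card T = t + 2})"
proof (cases "card TT < (t + 4) choose 2")
  case False
  obtain T1 where T1: "T1 \<in> TT" using ne by blast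
  note finT1 = fin_T[OF T1]
  have far_eq: "A = B" if "T' \<in> TT" "X \<subseteq> T'" "card X = t" "A \<in> TT" "A \<inter> T' = X" "B \<in> TT" "B \<inter> T' = X" for T' X A B
  proof -
    have "finite (far T' X)" using fin_TT by (simp add: far_def)
    then show ?thesis using far1[OF that(1-3)] that(4-7) card_le_Suc0_iff_eq[of "far T' X"] by (auto simp: far_def)
  qed
  have near2: "card (near T1 i) = 2" if i: "i \<in> T1" for i
  proof (rule ccontr)
    assume "card (near T1 i) \<noteq> 2"
    then have lt: "card (near T1 i) < 2" using card_near[OF T1 i] by simp
    have "(\<Sum>j\<in>T1. card (near T1 j)) < (\<Sum>j\<in>T1. 2)"
      using lt i card_near[OF T1] by (intro sum_strict_mono_ex1[OF finT1]) auto
    also have "\<dots> = 2 * (t + 2)" using card_TT[OF T1] by simp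
    finally show False using card_TT_le_sum[OF T1 far1[OF T1]] False unfolding choose_two_step2 by simp
  qed
  define N where "N i = {x. x \<notin> T1 \<and> insert x (T1 - {i}) \<in> TT}" for i
  have near_eq: "near T1 i = (\<lambda>x. insert x (T1 - {i})) ` N i" if i: "i \<in> T1" for i
  proof
    show "near T1 i \<subseteq> (\<lambda>x. insert x (T1 - {i})) ` N i"
    proof
      fix T assume "T \<in> near T1 i"
      then have T: "T \<in> TT" "T1 - {i} \<subseteq> T" "T \<noteq> T1" by (auto simp: near_def)
      have "card (T - (T1 - {i})) = 1" using T finT1 card_TT[OF T(1)] card_TT[OF T1] i by (simp add: card_Diff_subset)
      then obtain x where "T - (T1 - {i}) = {x}" by (metis card_1_singletonE)
      then have x: "T = insert x (T1 - {i})" "x \<notin> T1 - {i}" using T(2) by auto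
      moreover have "x \<noteq> i" using x T(3) i by auto
      ultimately show "T \<in> (\<lambda>x. insert x (T1 - {i})) ` N i" using T(1) by (auto simp: N_def)
    qed
    show "(\<lambda>x. insert x (T1 - {i})) ` N i \<subseteq> near T1 i" by (auto simp: N_def near_def)
  qed
  have cN: "card (N i) = 2" if i: "i \<in> T1" for i
  proof -
    have "inj_on (\<lambda>x. insert x (T1 - {i})) (N i)" by (auto simp: inj_on_def N_def)
    then show ?thesis using near2[OF i] near_eq[OF i] card_image by metis
  qed
  have cX: "card (T1 - {i, j}) = t" if "i \<in> T1" "j \<in> T1" "i \<noteq> j" for i j
    using that card_TT[OF T1] finT1 by (simp add: card_Diff_subset)
  have sub: "N i \<subseteq> N j" if ij: "i \<in> T1" "j \<in> T1" "i \<noteq> j" for i j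
  proof
    fix y assume y: "y \<in> N i"
    show "y \<in> N j"
    proof (rule ccontr)
      assume yj: "y \<notin> N j"
      \<comment> \<open>Both replacements of \<open>j\<close>, the members \<open>A\<close> and
        \<open>B\<close>, would meet \<open>T'\<close> exactly in \<open>T1 - {i, j}\<close>,
        against \<open>far_eq\<close>.\<close>
      obtain y' z' where yz: "N j = {y', z'}" "y' \<noteq> z'" using cN[OF ij(2)] by (auto simp: card_2_iff)
      define T' where "T' = insert y (T1 - {i})"
      define A where "A = insert y' (T1 - {j})"
      define B where "B = insert z' (T1 - {j})"
      have mem: "T' \<in> TT" "A \<in> TT" "B \<in> TT" "y \<notin> T1" "y' \<notin> T1" "z' \<notin> T1" "y \<noteq> y'" "y \<noteq> z'"
        using y yz yj by (auto simp: N_def T'_def A_def B_def)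
      have "A = B"
        by (rule far_eq[OF mem(1) _ cX[OF ij] mem(2) _ mem(3)]) (use mem ij in \<open>auto simp: T'_def A_def B_def\<close>)
      then show False using yz(2) mem by (auto simp: A_def B_def)
    qed
  qed
  obtain i0 where i0: "i0 \<in> T1" using card_TT[OF T1] by fastforce
  define M where "M = N i0"
  have NM: "N i = M" if "i \<in> T1" for i using sub[OF that i0] sub[OF i0 that] M_def by blast
  have cM: "card M = 2" using cN[OF i0] by (simp add: M_def)
  then have finM: "finite M" using card.infinite by fastforce
  have MT: "M \<inter> T1 = {}" by (auto simp: M_def N_def)
  define Z where "Z = T1 \<union> M"
  have cZ: "card Z = t + 4" using card_Un_disjoint[OF finT1 finM] MT cM card_TT[OF T1] by (simp add: Z_def Int_commute)
  have "TT \<subseteq> {T. T \<subseteq> Z \<and> card T = t + 2}"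
  proof
    fix T assume T: "T \<in> TT"
    then consider "T = T1" | i where "i \<in> T1" "T \<in> near T1 i" | X where "X \<subseteq> T1" "card X = t" "T \<in> far T1 X"
      using TT_split[OF T1] by blast
    then have "T \<subseteq> Z"
    proof cases
      case 1
      then show ?thesis by (simp add: Z_def)
    next
      case 2
      then show ?thesis using near_eq[of i] NM[of i] by (auto simp: Z_def)
    next
      case 3
      have "card (T1 - X) = 2" using 3 card_TT[OF T1] finT1 by (simp add: card_Diff_subset finite_subset)
      then obtain i j where ij: "T1 - X = {i, j}" "i \<noteq> j" by (auto simp: card_2_iff)
      have X: "X = T1 - {i, j}" "i \<in> T1" "j \<in> T1" using ij 3(1) by auto
      have TX: "T \<inter> T1 = X" using 3 by (simp add: far_def)
      have ijT: "i \<notin> T" "j \<notin> T" using TX X by auto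
      \<comment> \<open>If \<open>T\<close> missed a point \<open>y\<close> of \<open>M\<close>,
        then \<open>T\<close> and the member \<open>B\<close>, in which the other point of
        \<open>M\<close> replaces \<open>i\<close>, would both meet \<open>T'\<close> exactly in
        \<open>X\<close>; but \<open>B\<close> contains \<open>j\<close> and \<open>T\<close> does
        not.\<close>
      have "M \<subseteq> T"
      proof
        fix y assume y: "y \<in> M"
        show "y \<in> T"
        proof (rule ccontr)
          assume yT: "y \<notin> T"
          obtain z where z: "z \<noteq> y" "M = {y, z}" using other_of_pair[OF cM y] by blast
          define T' where "T' = insert y (T1 - {j})"
          define B where "B = insert z (T1 - {i})"
          have mem: "T' \<in> TT" "B \<in> TT" "y \<notin> T1" "z \<notin> T1"
            using NM[OF X(2)] NM[OF X(3)] y z by (auto simp: N_def T'_def B_def)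
          have "X \<subseteq> T'" "T \<inter> T' = X" "B \<inter> T' = X"
            using mem X TX yT z ijT ij(2) by (auto simp: T'_def B_def)
          then have "T = B" using far_eq[OF mem(1) _ 3(2) T _ mem(2)] by blast
          then show False using ijT X ij(2) by (auto simp: B_def)
        qed
      qed
      have "card (T - X) = 2" using TX 3(2) card_TT[OF T] card_Diff_subset_Int[of T T1] fin_T[OF T] finT1
        by (metis Diff_Int_distrib2 Int_commute Int_lower1 add_diff_cancel_left' card_Diff_subset finite_Int)
      moreover have "M \<subseteq> T - X" using \<open>M \<subseteq> T\<close> MT 3(1) by blast
      ultimately have "T - X = M" using card_subset_eq[of "T - X" M] fin_T[OF T] cM by auto
      then show ?thesis using 3(1) by (auto simp: Z_def)
    qed
    then show "T \<in> {T. T \<subseteq> Z \<and> card T = t + 2}" using card_TT[OF T] by simp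
  qed
  moreover have "finite Z" using finM finT1 by (simp add: Z_def)
  moreover have "card {T. T \<subseteq> Z \<and> card T = t + 2} = (t + 4) choose 2"
    using n_subsets[OF \<open>finite Z\<close>, of "t + 2"] cZ binomial_symmetric[of "t + 2" "t + 4"] by simp
  ultimately have "TT = {T. T \<subseteq> Z \<and> card T = t + 2}" using False by (intro card_seteq) auto
  then show ?thesis using cZ by blast
qed simp

text \<open>Two members \<open>T2\<close>, \<open>T3\<close> far from \<open>T1\<close> at
  \<open>X\<close> give pairs with \<open>e1\<close> disjoint from \<open>e2\<close> and
  \<open>e3\<close>. They force every member to contain all but at most one point of
  \<open>X\<close>, so the whole system is described by a \<open>link_system\<close> over
  \<open>X\<close>.\<close>

lemma far_two_case:
  assumes T1: "T1 \<in> TT" and X: "X \<subseteq> T1" "card X = t" and far: "\<not> card (far T1 X) \<le> 1"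
  shows "card TT \<le> 12 \<or> card TT < (t + 4) choose 2"
proof -
  have finX: "finite X" using X(1) fin_T[OF T1] finite_subset by blast
  have Xne: "X \<noteq> {}" using X(2) t_pos by auto
  have "finite (far T1 X)" using fin_TT by (simp add: far_def)
  then obtain T2 T3 where T23: "T2 \<in> TT" "T3 \<in> TT" "T2 \<inter> T1 = X" "T3 \<inter> T1 = X" "T2 \<noteq> T3"
    using far card_le_Suc0_iff_eq[of "far T1 X"] by (auto simp: far_def)
  have XT: "X \<subseteq> T2" "X \<subseteq> T3" using T23 by auto
  define E where "E = {e. e \<inter> X = {} \<and> X \<union> e \<in> TT}"
  define Hs where "Hs x = {h. h \<inter> X = {} \<and> (X - {x}) \<union> h \<in> TT}" for x
  have edge: "T - X \<in> E" if "T \<in> TT" "X \<subseteq> T" for T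
  proof -
    have "X \<union> (T - X) = T" using that(2) by blast
    then show ?thesis using that(1) by (auto simp: E_def)
  qed
  have finE: "finite e" if "e \<in> E" for e using that fin_T[of "X \<union> e"] by (simp add: E_def)
  have finH: "finite h" if "h \<in> Hs x" for h x using that fin_T[of "X - {x} \<union> h"] by (simp add: Hs_def)
  have cardE: "card e = 2" if e: "e \<in> E" for e
    using card_TT[of "X \<union> e"] card_Un_disjoint[OF finX finE[OF e]] e X(2) by (auto simp: E_def Int_commute)
  have cX1: "card (X - {x}) = t - 1" if "x \<in> X" for x using that X(2) finX by simp
  have cardH: "card h = 3" if x: "x \<in> X" and h: "h \<in> Hs x" for x h
  proof -
    have "(X - {x}) \<inter> h = {}" using h by (auto simp: Hs_def)
    then have "card (X - {x} \<union> h) = t - 1 + card h" using card_Un_disjoint[of "X - {x}" h] finX finH[OF h] cX1[OF x] by simp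
    then show ?thesis using card_TT[of "X - {x} \<union> h"] h t_pos by (simp add: Hs_def)
  qed
  define e1 e2 e3 where e_def: "e1 = T1 - X" "e2 = T2 - X" "e3 = T3 - X"
  have e: "e1 \<in> E" "e2 \<in> E" "e3 \<in> E" "e1 \<inter> e2 = {}" "e1 \<inter> e3 = {}" "e2 \<noteq> e3"
    using edge T1 X(1) T23 XT by (auto simp: e_def)
  \<comment> \<open>A member missing two points of \<open>X\<close> would have to contain
    \<open>e1\<close>, \<open>e2\<close> and \<open>e3\<close>, which together have at least five
    points, while it has room for only four outside \<open>X\<close>.\<close>
  have near_X: "t - 1 \<le> card (T \<inter> X)" if T: "T \<in> TT" for T
  proof (rule ccontr)
    assume "\<not> t - 1 \<le> card (T \<inter> X)"
    then have small: "card (T \<inter> X) + 2 \<le> t" by simp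
    have full: "f \<subseteq> T \<and> t \<le> card (T \<inter> X) + 2" if f: "f \<in> E" for f
    proof -
      have "T \<inter> (X \<union> f) = (T \<inter> X) \<union> (T \<inter> f)" by blast
      then have "t \<le> card (T \<inter> X) + card (T \<inter> f)"
        using inter_TT[OF T, of "X \<union> f"] f card_Un_le[of "T \<inter> X" "T \<inter> f"] by (simp add: E_def)
      moreover have le: "card (T \<inter> f) \<le> 2" using card_mono[OF finE[OF f], of "T \<inter> f"] cardE[OF f] by simp
      ultimately have "card (T \<inter> f) = card f" using small cardE[OF f] by simp
      then have "T \<inter> f = f" using card_subset_eq[OF finE[OF f], of "T \<inter> f"] by blast
      then show ?thesis using \<open>t \<le> card (T \<inter> X) + card (T \<inter> f)\<close> le by auto
    qed
    have "e1 \<union> (e2 \<union> e3) \<subseteq> T - X" using full[OF e(1)] full[OF e(2)] full[OF e(3)] unfolding e_def by blast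
    then have "card (e1 \<union> (e2 \<union> e3)) \<le> card (T - X)" using fin_T[OF T] by (intro card_mono) auto
    also have "\<dots> = t + 2 - card (T \<inter> X)" using card_Diff_subset_Int[of T X] fin_T[OF T] card_TT[OF T] by simp
    also have "\<dots> \<le> 4" using conjunct2[OF full[OF e(1)]] by linarith
    finally have le4: "card (e1 \<union> (e2 \<union> e3)) \<le> 4" .
    have "card (e1 \<union> (e2 \<union> e3)) = card e1 + card (e2 \<union> e3)"
      using e finE by (intro card_Un_disjoint) auto
    then have "card (e2 \<union> e3) \<le> 2" using le4 cardE[OF e(1)] by simp
    then have "e2 = e2 \<union> e3" "e3 = e2 \<union> e3"
      using card_seteq[of "e2 \<union> e3" e2] card_seteq[of "e2 \<union> e3" e3] finE e cardE by auto
    then show False using e(6) by simp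
  qed
  have TT_sub: "TT \<subseteq> (\<lambda>e. X \<union> e) ` E \<union> (\<Union>x\<in>X. (\<lambda>h. (X - {x}) \<union> h) ` Hs x)"
  proof
    fix T assume T: "T \<in> TT"
    show "T \<in> (\<lambda>e. X \<union> e) ` E \<union> (\<Union>x\<in>X. (\<lambda>h. (X - {x}) \<union> h) ` Hs x)"
    proof (cases "X \<subseteq> T")
      case True
      then have "T = X \<union> (T - X)" by blast
      then show ?thesis using edge[OF T True] by blast
    next
      case False
      have "card (X - T) \<le> 1" using card_Diff_subset_Int[of X T] finX X(2) near_X[OF T] by (simp add: Int_commute)
      moreover have "X - T \<noteq> {}" using False by blast
      ultimately obtain x where x: "X - T = {x}"
        by (metis One_nat_def card_0_eq card_1_singletonE finX finite_Diff le_Suc_eq le_zero_eq)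
      have eq: "T = (X - {x}) \<union> (T - X)" using x by blast
      then have "T - X \<in> Hs x" using T by (auto simp: Hs_def)
      then show ?thesis using eq x by blast
    qed
  qed
  have sub_img: "E \<subseteq> (\<lambda>T. T - X) ` TT"
  proof
    fix f assume "f \<in> E"
    then have "X \<union> f \<in> TT" "f = (X \<union> f) - X" by (auto simp: E_def)
    then show "f \<in> (\<lambda>T. T - X) ` TT" by blast
  qed
  have fin_E: "finite E" using finite_subset[OF sub_img] fin_TT by simp
  have fin_Hs: "finite (Hs x)" for x
  proof -
    have "Hs x \<subseteq> (\<lambda>T. T - X) ` TT"
    proof
      fix h assume "h \<in> Hs x"
      then have "X - {x} \<union> h \<in> TT" "h = (X - {x} \<union> h) - X" by (auto simp: Hs_def)
      then show "h \<in> (\<lambda>T. T - X) ` TT" by blast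
    qed
    then show ?thesis using finite_subset fin_TT by blast
  qed
  have "card TT \<le> card ((\<lambda>e. X \<union> e) ` E \<union> (\<Union>x\<in>X. (\<lambda>h. (X - {x}) \<union> h) ` Hs x))"
    using TT_sub fin_E fin_Hs finX by (intro card_mono) auto
  also have "\<dots> \<le> card ((\<lambda>e. X \<union> e) ` E) + card (\<Union>x\<in>X. (\<lambda>h. (X - {x}) \<union> h) ` Hs x)" by (rule card_Un_le)
  also have "card ((\<lambda>e. X \<union> e) ` E) \<le> card E" by (rule card_image_le[OF fin_E])
  also have "card (\<Union>x\<in>X. (\<lambda>h. (X - {x}) \<union> h) ` Hs x) \<le> (\<Sum>x\<in>X. card ((\<lambda>h. (X - {x}) \<union> h) ` Hs x))"
    by (rule card_UN_le[OF finX])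
  also have "\<dots> \<le> (\<Sum>x\<in>X. card (Hs x))" by (intro sum_mono card_image_le fin_Hs)
  finally have total: "card TT \<le> card E + (\<Sum>x\<in>X. card (Hs x))" by simp
  have inter_bound: "t \<le> card P + card Q" if "A \<in> TT" "B \<in> TT" "A \<inter> B = P \<union> Q" for A B P Q
    using inter_TT[OF that(1,2)] card_Un_le[of P Q] that(3) by simp
  interpret link_system X Hs E
  proof
    show "finite X" by (rule finX)
    show "card h = 3" if "x \<in> X" "h \<in> Hs x" for x h using cardH that by blast
    show "finite (Hs x)" for x by (rule fin_Hs)
    show "card f = 2" if "f \<in> E" for f using cardE that by blast
    show "f \<inter> h \<noteq> {}" if f: "f \<in> E" and x: "x \<in> X" and h: "h \<in> Hs x" for f x h
    proof
      assume "f \<inter> h = {}"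
      then have "t \<le> card (X - {x}) + card ({} :: 'a set)"
        using f h by (intro inter_bound[of "X \<union> f" "X - {x} \<union> h"]) (auto simp: E_def Hs_def)
      then show False using cX1[OF x] t_pos by simp
    qed
    show "h \<inter> h' \<noteq> {}" if x: "x \<in> X" and h: "h \<in> Hs x" "h' \<in> Hs x" for x h h'
    proof
      assume "h \<inter> h' = {}"
      then have "t \<le> card (X - {x}) + card ({} :: 'a set)"
        using h by (intro inter_bound[of "X - {x} \<union> h" "X - {x} \<union> h'"]) (auto simp: Hs_def)
      then show False using cX1[OF x] t_pos by simp
    qed
    show "2 \<le> card (h \<inter> h')" if xy: "x \<in> X" "y \<in> X" "x \<noteq> y" and h: "h \<in> Hs x" "h' \<in> Hs y" for x y h h'
    proof -
      have "t \<le> card (X - {x, y}) + card (h \<inter> h')"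
        using h by (intro inter_bound[of "X - {x} \<union> h" "X - {y} \<union> h'"]) (auto simp: Hs_def)
      moreover have "card (X - {x, y}) = t - 2" using xy X(2) finX by (simp add: card_Diff_subset)
      moreover have "2 \<le> t" using card_mono[OF finX, of "{x, y}"] xy X(2) by simp
      ultimately show ?thesis by simp
    qed
    show "\<exists>x\<in>X. \<exists>h\<in>Hs x. v \<notin> h" for v
    proof -
      have main: "\<exists>x\<in>X. \<exists>h\<in>Hs x. u \<notin> h" if u: "u \<notin> X" for u
      proof -
        have "card (insert u X) = t + 1" using u X(2) finX by simp
        then obtain T where T: "T \<in> TT" "card (insert u X \<inter> T) < t" using no_cover by blast
        have "\<not> X \<subseteq> T"
        proof
          assume "X \<subseteq> T"
          then have "card X \<le> card (insert u X \<inter> T)" using finX by (intro card_mono) auto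
          then show False using T(2) X(2) by simp
        qed
        then have "T \<notin> (\<lambda>e. X \<union> e) ` E" by blast
        then obtain x h where xh: "x \<in> X" "h \<in> Hs x" "T = X - {x} \<union> h" using TT_sub T(1) by blast
        have "u \<notin> h"
        proof
          assume "u \<in> h"
          then have "insert u (X - {x}) \<subseteq> insert u X \<inter> T" using xh by blast
          then have "card (insert u (X - {x})) \<le> card (insert u X \<inter> T)" using finX by (intro card_mono) auto
          then show False using T(2) u finX cX1[OF xh(1)] t_pos by simp
        qed
        then show ?thesis using xh by blast
      qed
      show ?thesis
      \<comment> \<open>Triples are disjoint from \<open>X\<close>, so for \<open>v\<close> in
        \<open>X\<close> any triple will do; one is obtained from a point of
        \<open>e1\<close>.\<close>
      proof (cases "v \<in> X")
        case True
        obtain u where "u \<in> e1" using cardE[OF e(1)] by fastforce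
        then have "u \<notin> X" by (simp add: e_def)
        from main[OF this] obtain x h where "x \<in> X" "h \<in> Hs x" by blast
        then show ?thesis using True by (auto simp: Hs_def)
      qed (rule main)
    qed
    show "card {h \<in> Hs x. p \<subseteq> h} \<le> 3" if x: "x \<in> X" and p: "card p = 2" for x p
    proof (cases "p \<inter> X = {}")
      case True
      have fp: "finite p" using p card.infinite by fastforce
      have "card (X - {x} \<union> p) = t + 1"
        using card_Un_disjoint[of "X - {x}" p] True finX fp cX1[OF x] p t_pos by (auto simp: Int_commute)
      then have c3: "card {T \<in> TT. X - {x} \<union> p \<subseteq> T} \<le> 3" by (rule codegree)
      have "inj_on (\<lambda>h. X - {x} \<union> h) {h \<in> Hs x. p \<subseteq> h}" by (auto simp: inj_on_def Hs_def)
      moreover have "(\<lambda>h. X - {x} \<union> h) ` {h \<in> Hs x. p \<subseteq> h} \<subseteq> {T \<in> TT. X - {x} \<union> p \<subseteq> T}"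
        by (auto simp: Hs_def)
      ultimately have "card {h \<in> Hs x. p \<subseteq> h} \<le> card {T \<in> TT. X - {x} \<union> p \<subseteq> T}"
        using fin_TT by (intro card_inj_on_le) auto
      then show ?thesis using c3 by simp
    next
      case False
      then have "{h \<in> Hs x. p \<subseteq> h} = {}" by (auto simp: Hs_def)
      then have "card {h \<in> Hs x. p \<subseteq> h} = 0" by (metis card.empty)
      then show ?thesis by linarith
    qed
  qed
  show ?thesis using two_edges_avoiding_third[OF e Xne] total X(2) by fastforce
qed

text \<open>The bound 12 only matters for \<open>t = 1\<close>; it suffices because \<open>m\<^sup>2 + m + 1 \<ge> 13\<close> for \<open>m \<ge> 3\<close>.\<close>

lemma card_or_complete:
  assumes "TT \<noteq> {}"
  shows "card TT \<le> 12 \<or> card TT < (t + 4) choose 2 \<or> (\<exists>Z. card Z = t + 4 \<and> TT = {T. T \<subseteq> Z \<and> card T = t + 2})"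
  using far_le_one_case[OF assms] far_two_case by blast

end

section \<open>Families and their minimal covers\<close>

lemma card_le_sum_over_subsets:
  fixes \<G> :: "'a set set"
  assumes "finite \<G>" "finite S" and cover: "\<And>F. F \<in> \<G> \<Longrightarrow> t \<le> card (S \<inter> F)"
    and bound: "\<And>X. X \<subseteq> S \<Longrightarrow> card X = t \<Longrightarrow> card {F \<in> \<G>. X \<subseteq> F} \<le> b"
  shows "card \<G> \<le> (card S choose t) * b"
proof -
  let ?P = "{X. X \<subseteq> S \<and> card X = t}"
  have finP: "finite ?P" using assms(2) by simp
  have "\<G> \<subseteq> (\<Union>X\<in>?P. {F \<in> \<G>. X \<subseteq> F})"
  proof
    fix F assume F: "F \<in> \<G>"
    obtain X where "X \<subseteq> S \<inter> F" "card X = t" using obtain_subset_with_card_n[OF cover[OF F]] by blast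
    then show "F \<in> (\<Union>X\<in>?P. {F \<in> \<G>. X \<subseteq> F})" using F by blast
  qed
  then have "card \<G> \<le> card (\<Union>X\<in>?P. {F \<in> \<G>. X \<subseteq> F})" using assms(1) finP by (intro card_mono) auto
  also have "\<dots> \<le> (\<Sum>X\<in>?P. card {F \<in> \<G>. X \<subseteq> F})" by (rule card_UN_le[OF finP])
  also have "\<dots> \<le> (\<Sum>X\<in>?P. b)" using bound by (intro sum_mono) auto
  also have "\<dots> = (card S choose t) * b" using n_subsets[OF assms(2), of t] by simp
  finally show ?thesis .
qed

locale t_family =
  fixes n m t :: nat and \<F> :: "nat set set"
  assumes t_pos: "0 < t" and m: "3 \<le> m" and n: "((t + 3) choose 2) * (m + 1)^4 \<le> n"
    and \<F>_sub: "\<F> \<subseteq> ksets n (t + m)"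
    and inter: "F \<in> \<F> \<Longrightarrow> F' \<in> \<F> \<Longrightarrow> t \<le> card (F \<inter> F')"
    and cover_ge: "t_cover n t \<F> S \<Longrightarrow> t + 2 \<le> card S"
begin

lemma F_sub: "F \<in> \<F> \<Longrightarrow> F \<subseteq> {1..n}" and F_card: "F \<in> \<F> \<Longrightarrow> card F = t + m"
  and F_fin: "F \<in> \<F> \<Longrightarrow> finite F"
proof -
  show "F \<subseteq> {1..n}" "card F = t + m" if "F \<in> \<F>" using that \<F>_sub by (auto simp: ksets_def)
  then show "finite F" if "F \<in> \<F>" using that finite_subset by blast
qed

lemma fin_\<F>: "finite \<F>"
  using \<F>_sub finite_ksets finite_subset by blast

lemma n_large: "2 * t + 2 * m + 4 \<le> n"
proof -
  obtain p where p: "m = p + 3" using m by (metis le_add_diff_inverse2)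
  have "2 * t + 2 * m + 4 \<le> (t + 2) * (m + 1)^2"
    unfolding p by (simp add: power2_eq_square algebra_simps)
  also have "\<dots> \<le> ((t + 3) choose 2) * (m + 1)^4"
    unfolding choose_two_step by (intro mult_le_mono power_increasing) auto
  finally show ?thesis using n by simp
qed

text \<open>A cover must lie in \<open>{1..n}\<close>, but branching adds arbitrary points. Cutting
  \<open>S\<close> down to \<open>{1..n}\<close> changes no intersection with a member.\<close>

lemma not_cover:
  assumes "finite S" "card S \<le> q" and q: "\<And>S. t_cover n t \<F> S \<Longrightarrow> q < card S"
  shows "\<exists>F\<in>\<F>. card (S \<inter> F) < t"
proof -
  have "card (S \<inter> {1..n}) \<le> q" using card_mono[of S "S \<inter> {1..n}"] assms by simp
  then have "\<not> t_cover n t \<F> (S \<inter> {1..n})" using q by fastforce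
  then obtain F where F: "F \<in> \<F>" "card (S \<inter> {1..n} \<inter> F) < t" unfolding t_cover_def by fastforce
  have "S \<inter> {1..n} \<inter> F = S \<inter> F" using F_sub[OF F(1)] by blast
  then show ?thesis using F by auto
qed

lemma small_not_cover:
  assumes "finite S" "card S \<le> t + 1"
  shows "\<exists>F\<in>\<F>. card (S \<inter> F) < t"
  using not_cover[OF assms] cover_ge by fastforce

lemma \<F>_ne: "\<F> \<noteq> {}"
  using small_not_cover[of "{}"] by auto

lemma branch:
  assumes "\<G> \<subseteq> \<F>" "F' \<in> \<F>" "card (S \<inter> F') < t"
    and "\<And>x. x \<notin> S \<Longrightarrow> card {F \<in> \<G>. insert x S \<subseteq> F} \<le> b"
  shows "card {F \<in> \<G>. S \<subseteq> F} \<le> (m + 1) * b"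
proof -
  have "card {F \<in> \<G>. S \<subseteq> F} \<le> (t + m - t + 1) * b"
    by (rule branching[of \<G> F']) (use assms fin_\<F> finite_subset F_fin F_card inter in auto)
  then show ?thesis by simp
qed

text \<open>\<open>q\<close> will be the least size of a cover. Smaller sets are not covers, so
  branching can be repeated up to size \<open>q\<close>, with a factor \<open>m + 1\<close> for each
  added point.\<close>

lemma supersets_le:
  assumes q: "\<And>S. t_cover n t \<F> S \<Longrightarrow> q \<le> card S" "q \<le> t + m"
  shows "finite S \<Longrightarrow> card S \<le> q \<Longrightarrow>
    card {F \<in> \<F>. S \<subseteq> F} \<le> (m + 1)^(q - card S) * ((n - q) choose (t + m - q))"
proof (induction "q - card S" arbitrary: S)
  case 0
  then have "card S = q" by simp
  then show ?case using card_supersets_le[OF \<F>_sub 0(2)] q(2) by simp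
next
  case (Suc r)
  have lt: "card S < q" using Suc(2) by simp
  obtain F' where F': "F' \<in> \<F>" "card (S \<inter> F') < t"
    using not_cover[OF Suc(3), of "q - 1"] lt q(1) by fastforce
  have "card {F \<in> \<F>. S \<subseteq> F} \<le> (m + 1) * ((m + 1)^r * ((n - q) choose (t + m - q)))"
  proof (rule branch[OF subset_refl F'])
    fix x assume x: "x \<notin> S"
    have "r = q - card (insert x S)" using Suc(2,3) x by simp
    moreover have "card (insert x S) \<le> q" using lt Suc(3) x by simp
    ultimately show "card {F \<in> \<F>. insert x S \<subseteq> F} \<le> (m + 1)^r * ((n - q) choose (t + m - q))"
      using Suc(1)[of "insert x S"] Suc(3) by simp
  qed
  then show ?case unfolding Suc(2)[symmetric] power_Suc by (simp only: mult.assoc)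
qed

definition TT :: "nat set set" where
  "TT = {S. t_cover n t \<F> S \<and> card S = t + 2}"

lemma large_tau_case:
  assumes "TT = {}"
  shows "int (card \<F>) < max (f1 n (t + m) t) (max (f2 n (t + m) t) (f3 n (t + m) t))"
proof -
  let ?P = "\<lambda>q. \<exists>S. t_cover n t \<F> S \<and> card S = q"
  obtain F where F: "F \<in> \<F>" using \<F>_ne by blast
  \<comment> \<open>Every member is itself a cover, so the least cover size is at most
    \<open>t + m\<close>.\<close>
  have PF: "?P (t + m)"
    using F F_sub[OF F] F_card[OF F] inter[OF F] unfolding t_cover_def by blast
  define q where "q = (LEAST q. ?P q)"
  have Pq: "?P q" unfolding q_def using PF by (rule LeastI)
  have q_le: "q \<le> card S" if "t_cover n t \<F> S" for S unfolding q_def using that by (intro Least_le) blast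
  have q_m: "q \<le> t + m" unfolding q_def using PF by (rule Least_le)
  obtain S where S: "t_cover n t \<F> S" "card S = q" using Pq by blast
  have finS: "finite S" using S(1) finite_subset unfolding t_cover_def by blast
  have "q \<noteq> t + 2" using S assms by (auto simp: TT_def)
  then have q3: "t + 3 \<le> q" using cover_ge[OF S(1)] S(2) by simp
  define j where "j = q - t"
  have j: "q = t + j" "3 \<le> j" "j \<le> m" using q3 q_m by (auto simp: j_def)
  have "card \<F> \<le> (card S choose t) * ((m + 1)^j * ((n - q) choose (t + m - q)))"
  proof (rule card_le_sum_over_subsets[OF fin_\<F> finS])
    show "t \<le> card (S \<inter> F)" if "F \<in> \<F>" for F using S(1) that by (simp add: t_cover_def)
    fix X assume X: "X \<subseteq> S" "card X = t"
    show "card {F \<in> \<F>. X \<subseteq> F} \<le> (m + 1)^j * ((n - q) choose (t + m - q))"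
      using supersets_le[OF q_le q_m, of X] X finite_subset[OF X(1) finS] j by simp
  qed
  then have "card \<F> \<le> ((t + j) choose j) * ((m + 1)^j * ((n - t - j) choose (m - j)))"
    using S(2) j binomial_symmetric[of t "t + j"] by simp
  then show ?thesis by (rule large_tau_bound_small[OF m n t_pos j(2,3)])
qed

lemma TT_D: "T \<in> TT \<Longrightarrow> T \<subseteq> {1..n}" "T \<in> TT \<Longrightarrow> card T = t + 2" "T \<in> TT \<Longrightarrow> F \<in> \<F> \<Longrightarrow> t \<le> card (T \<inter> F)"
  by (auto simp: TT_def t_cover_def)

lemma fin_TT: "finite TT"
  by (rule finite_subset[of _ "Pow {1..n}"]) (use TT_D in auto)

lemma fin_T: "T \<in> TT \<Longrightarrow> finite T"
  using TT_D(1) finite_subset by blast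

text \<open>Branching runs from \<open>t\<close> to \<open>t + 3\<close> points, past the size at
  which covers exist: a set in \<open>TT\<close> lies in no member of \<open>\<G>\<close>, and any
  other set of at most \<open>t + 2\<close> points can be branched. Starting from the
  \<open>t\<close>-subsets of one cover gives the factor \<open>(t+2 choose 2)\<close>.\<close>

lemma few_members_without_cover:
  assumes "TT \<noteq> {}"
  defines "\<G> \<equiv> {F \<in> \<F>. \<forall>T\<in>TT. \<not> T \<subseteq> F}"
  shows "card \<G> \<le> ((t + 2) choose 2) * (m + 1)^3 * ((n - t - 3) choose (m - 3))"
proof -
  define D where "D = (n - t - 3) choose (m - 3)"
  have sub: "\<G> \<subseteq> \<F>" by (auto simp: \<G>_def)
  have b3: "card {F \<in> \<G>. S \<subseteq> F} \<le> D" if "finite S" "card S = t + 3" for S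
    using card_supersets_le[of \<G> n "t + m" S] sub \<F>_sub that m by (auto simp: D_def diff_diff_left)
  have b2: "card {F \<in> \<G>. S \<subseteq> F} \<le> (m + 1) * D" if S: "finite S" "card S = t + 2" for S
  proof (cases "S \<in> TT \<or> \<not> S \<subseteq> {1..n}")
    case True
    then have "{F \<in> \<G>. S \<subseteq> F} = {}" using F_sub by (auto simp: \<G>_def)
    then have "card {F \<in> \<G>. S \<subseteq> F} = 0" by (metis card.empty)
    then show ?thesis by linarith
  next
    case False
    then obtain F' where F': "F' \<in> \<F>" "card (S \<inter> F') < t" using S(2) unfolding TT_def t_cover_def by fastforce
    show ?thesis
    proof (rule branch[OF sub F'])
      fix x assume "x \<notin> S"
      then show "card {F \<in> \<G>. insert x S \<subseteq> F} \<le> D" using b3[of "insert x S"] S by simp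
    qed
  qed
  have b1: "card {F \<in> \<G>. S \<subseteq> F} \<le> (m + 1) * ((m + 1) * D)" if S: "finite S" "card S = t + 1" for S
  proof -
    obtain F' where F': "F' \<in> \<F>" "card (S \<inter> F') < t" using small_not_cover[OF S(1)] S(2) by auto
    show ?thesis
    proof (rule branch[OF sub F'])
      fix x assume "x \<notin> S"
      then show "card {F \<in> \<G>. insert x S \<subseteq> F} \<le> (m + 1) * D" using b2[of "insert x S"] S by simp
    qed
  qed
  have b0: "card {F \<in> \<G>. S \<subseteq> F} \<le> (m + 1) * ((m + 1) * ((m + 1) * D))" if S: "finite S" "card S = t" for S
  proof -
    obtain F' where F': "F' \<in> \<F>" "card (S \<inter> F') < t" using small_not_cover[OF S(1)] S(2) by auto
    show ?thesis
    proof (rule branch[OF sub F'])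
      fix x assume "x \<notin> S"
      then show "card {F \<in> \<G>. insert x S \<subseteq> F} \<le> (m + 1) * ((m + 1) * D)" using b1[of "insert x S"] S by simp
    qed
  qed
  obtain T where T: "T \<in> TT" using assms(1) by blast
  have "card \<G> \<le> (card T choose t) * ((m + 1) * ((m + 1) * ((m + 1) * D)))"
  proof (rule card_le_sum_over_subsets)
    show "finite \<G>" "finite T" using sub fin_\<F> finite_subset fin_T[OF T] by auto
    show "t \<le> card (T \<inter> F)" if "F \<in> \<G>" for F using TT_D(3)[OF T] sub that by blast
    show "card {F \<in> \<G>. X \<subseteq> F} \<le> (m + 1) * ((m + 1) * ((m + 1) * D))" if "X \<subseteq> T" "card X = t" for X
      using b0[OF finite_subset[OF that(1) fin_T[OF T]] that(2)] .
  qed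
  also have "card T choose t = (t + 2) choose 2" using TT_D(2)[OF T] binomial_symmetric[of t "t + 2"] by simp
  finally show ?thesis unfolding power3_eq_cube D_def by (simp only: mult.assoc)
qed

lemma card_\<F>_le:
  assumes "TT \<noteq> {}"
  shows "card \<F> \<le> card TT * ((n - t - 2) choose (m - 2)) + ((t + 2) choose 2) * (m + 1)^3 * ((n - t - 3) choose (m - 3))"
proof -
  let ?G = "{F \<in> \<F>. \<forall>T\<in>TT. \<not> T \<subseteq> F}"
  have "\<F> = (\<Union>T\<in>TT. {F \<in> \<F>. T \<subseteq> F}) \<union> ?G" by blast
  then have "card \<F> = card ((\<Union>T\<in>TT. {F \<in> \<F>. T \<subseteq> F}) \<union> ?G)" by (rule arg_cong)
  also have "\<dots> \<le> card (\<Union>T\<in>TT. {F \<in> \<F>. T \<subseteq> F}) + card ?G" by (rule card_Un_le)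
  also have "card (\<Union>T\<in>TT. {F \<in> \<F>. T \<subseteq> F}) \<le> (\<Sum>T\<in>TT. card {F \<in> \<F>. T \<subseteq> F})" by (rule card_UN_le[OF fin_TT])
  also have "\<dots> \<le> (\<Sum>T\<in>TT. (n - t - 2) choose (m - 2))"
  proof (rule sum_mono)
    fix T assume T: "T \<in> TT"
    show "card {F \<in> \<F>. T \<subseteq> F} \<le> (n - t - 2) choose (m - 2)"
      using card_supersets_le[OF \<F>_sub fin_T[OF T]] TT_D(2)[OF T] m by (simp add: diff_diff_left)
  qed
  also have "\<dots> = card TT * ((n - t - 2) choose (m - 2))" by simp
  finally show ?thesis using few_members_without_cover[OF assms] by simp
qed

lemma degree_le:
  assumes "card U = t + 1"
  shows "card {T \<in> TT. U \<subseteq> T} \<le> m + 1"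
proof -
  have finU: "finite U" using assms card.infinite by fastforce
  obtain F where F: "F \<in> \<F>" "card (U \<inter> F) < t" using small_not_cover[OF finU] assms by auto
  have "card {T \<in> TT. U \<subseteq> T} \<le> t + m - t + 1"
    by (rule one_point_extensions(4)[OF finU F_fin[OF F(1)] F_card[OF F(1)] _ F(2)]) (use TT_D F assms in auto)
  then show ?thesis by simp
qed

end

locale maximal_t_family = t_family +
  assumes maximal: "G \<in> ksets n (t + m) \<Longrightarrow> (\<And>F. F \<in> \<F> \<Longrightarrow> t \<le> card (G \<inter> F)) \<Longrightarrow> G \<in> \<F>"
begin

text \<open>\<open>T\<close> is filled up to \<open>t + m\<close> points from outside both covers.
  The result meets every member in at least \<open>t\<close> points, so by maximality it belongs to
  the family, and the cover \<open>T'\<close> meets it only inside \<open>T\<close>.\<close>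

lemma TT_inter:
  assumes T: "T \<in> TT" "T' \<in> TT"
  shows "t \<le> card (T \<inter> T')"
proof -
  have fin: "finite T" "finite T'" using fin_T T by auto
  have "card (T \<union> T') \<le> 2 * t + 4" using card_Un_le[of T T'] TT_D(2)[OF T(1)] TT_D(2)[OF T(2)] by simp
  then have "m - 2 \<le> card ({1..n} - (T \<union> T'))"
    using card_Diff_subset[of "T \<union> T'" "{1..n}"] fin TT_D(1)[OF T(1)] TT_D(1)[OF T(2)] n_large by simp
  then obtain R where R: "R \<subseteq> {1..n} - (T \<union> T')" "card R = m - 2" "finite R"
    by (metis obtain_subset_with_card_n)
  have "T \<inter> R = {}" using R by blast
  then have "card (T \<union> R) = t + m" using card_Un_disjoint[of T R] fin R TT_D(2)[OF T(1)] m by simp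
  then have "T \<union> R \<in> ksets n (t + m)" using R TT_D(1)[OF T(1)] by (auto simp: ksets_def)
  then have "T \<union> R \<in> \<F>"
  proof (rule maximal)
    fix F assume F: "F \<in> \<F>"
    have "card (T \<inter> F) \<le> card ((T \<union> R) \<inter> F)" using fin R by (intro card_mono) auto
    then show "t \<le> card ((T \<union> R) \<inter> F)" using TT_D(3)[OF T(1) F] by simp
  qed
  from TT_D(3)[OF T(2) this] have "t \<le> card (T' \<inter> (T \<union> R))" .
  moreover have "T' \<inter> (T \<union> R) = T \<inter> T'" using R by blast
  ultimately show ?thesis by simp
qed

end

section \<open>Structure of the covers\<close>

text \<open>Containment is what the structure of the covers yields for the maximal family; equality
  for the given family follows from counting at the end.\<close>

definition sub_type1 :: "nat \<Rightarrow> nat \<Rightarrow> nat \<Rightarrow> nat set set \<Rightarrow> bool" where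
  "sub_type1 n k t \<F> \<longleftrightarrow> (\<exists>\<F>'. is_type1 n k t \<F>' \<and> \<F> \<subseteq> \<F>')"

definition sub_type2 :: "nat \<Rightarrow> nat \<Rightarrow> nat \<Rightarrow> nat set set \<Rightarrow> bool" where
  "sub_type2 n k t \<F> \<longleftrightarrow> (\<exists>\<F>'. is_type2 n k t \<F>' \<and> \<F> \<subseteq> \<F>')"

definition sub_type3 :: "nat \<Rightarrow> nat \<Rightarrow> nat \<Rightarrow> nat set set \<Rightarrow> bool" where
  "sub_type3 n k t \<F> \<longleftrightarrow> (\<exists>\<F>'. is_type3 n k t \<F>' \<and> \<F> \<subseteq> \<F>')"

context t_family
begin

text \<open>If some member \<open>F\<close> misses two points of \<open>X\<close>, all pairs lie in
  the \<open>m + 2\<close> points of \<open>F - X\<close>, and \<open>(m+2 choose 2)\<close> is at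
  most \<open>m^2 + m\<close>. Otherwise every member not containing \<open>X\<close> misses exactly
  one point of it, and the sets \<open>F - X\<close> satisfy \<open>pair_cover\<close>.\<close>

lemma common_t_set_case:
  assumes X: "card X = t" and X_sub: "\<And>T. T \<in> TT \<Longrightarrow> X \<subseteq> T" and ne: "TT \<noteq> {}"
  shows "card TT \<le> m^2 + m \<or> sub_type1 n (t + m) t \<F>"
proof -
  have finX: "finite X" using X t_pos card.infinite by fastforce
  have Xn: "X \<subseteq> {1..n}" using ne X_sub TT_D(1) by blast
  define E where "E = (\<lambda>T. T - X) ` TT"
  have TT_E: "X \<union> e \<in> TT \<and> e \<inter> X = {}" if "e \<in> E" for e
  proof -
    obtain T where T: "T \<in> TT" "e = T - X" using \<open>e \<in> E\<close> by (auto simp: E_def)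
    then have "X \<union> e = T" using X_sub[OF T(1)] by blast
    then show ?thesis using T by auto
  qed
  have "inj_on (\<lambda>T. T - X) TT" using X_sub by (auto simp: inj_on_def)
  then have card_TT: "card TT = card E" by (simp add: E_def card_image)
  have card_E: "card e = 2" if e: "e \<in> E" for e
  proof -
    obtain T where T: "T \<in> TT" "e = T - X" using e by (auto simp: E_def)
    then show ?thesis using X_sub[OF T(1)] TT_D(2)[OF T(1)] X finX by (simp add: card_Diff_subset)
  qed
  have fin_e: "finite e" if "e \<in> E" for e using card_E[OF that] card.infinite by fastforce
  have cov: "t \<le> card (X \<inter> F) + card (e \<inter> F)" if "e \<in> E" "F \<in> \<F>" for e F
  proof -
    have "(X \<union> e) \<inter> F = (X \<inter> F) \<union> (e \<inter> F)" by blast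
    then show ?thesis using TT_D(3)[of "X \<union> e" F] TT_E[OF that(1)] that(2) card_Un_le[of "X \<inter> F" "e \<inter> F"] by simp
  qed
  show ?thesis
  proof (cases "\<exists>F\<in>\<F>. card (X \<inter> F) + 2 \<le> t")
    case True
    then obtain F where F: "F \<in> \<F>" "card (X \<inter> F) + 2 \<le> t" by blast
    have full: "e \<subseteq> F - X \<and> card (X \<inter> F) + 2 = t" if e: "e \<in> E" for e
    proof -
      have le: "card (e \<inter> F) \<le> 2" using card_mono[OF fin_e[OF e], of "e \<inter> F"] card_E[OF e] by simp
      then have eq: "card (e \<inter> F) = 2" "card (X \<inter> F) + 2 = t" using cov[OF e F(1)] F(2) by auto
      then have "e \<inter> F = e" using card_subset_eq[OF fin_e[OF e], of "e \<inter> F"] card_E[OF e] by simp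
      then show ?thesis using TT_E[OF e] eq by blast
    qed
    obtain e0 where "e0 \<in> E" using ne by (auto simp: E_def)
    then have "card (X \<inter> F) + 2 = t" using full by blast
    then have cFX: "card (F - X) = m + 2"
      using card_Diff_subset_Int[of F X] F_fin[OF F(1)] F_card[OF F(1)] by (simp add: Int_commute)
    have finFX: "finite (F - X)" using F_fin[OF F(1)] by simp
    have "E \<subseteq> {e. e \<subseteq> F - X \<and> card e = 2}" using full card_E by blast
    then have "card E \<le> card {e. e \<subseteq> F - X \<and> card e = 2}" using finFX by (intro card_mono) auto
    also have "\<dots> = (m + 2) choose 2" using n_subsets[OF finFX, of 2] cFX by simp
    also have "\<dots> = (m + 2) * (m + 1) div 2" by (simp add: choose_two)
    also have "\<dots> \<le> 2 * (m^2 + m) div 2"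
    proof (rule div_le_mono)
      obtain p where p: "m = p + 3" using m by (metis le_add_diff_inverse2)
      show "(m + 2) * (m + 1) \<le> 2 * (m^2 + m)" unfolding p by (simp add: power2_eq_square algebra_simps)
    qed
    finally show ?thesis using card_TT by simp
  next
    case False
    have trace: "card (X \<inter> F) = t - 1" if F: "F \<in> \<F>" "\<not> X \<subseteq> F" for F
    proof -
      have "card (X \<inter> F) < t"
        using psubset_card_mono[OF finX, of "X \<inter> F"] F(2) X by blast
      then show ?thesis using False F(1) by fastforce
    qed
    define \<H> where "\<H> = (\<lambda>F. F - X) ` {F \<in> \<F>. \<not> X \<subseteq> F}"
    have cardH: "card (F - X) = m + 1" if "F \<in> \<F>" "\<not> X \<subseteq> F" for F
      using card_Diff_subset_Int[of F X] F_fin[OF that(1)] F_card[OF that(1)] trace[OF that] t_pos by (simp add: Int_commute)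
    have inter2: "t \<le> card (X \<inter> F \<inter> F') + card ((F - X) \<inter> (F' - X))" if "F \<in> \<F>" "F' \<in> \<F>" for F F'
    proof -
      have "F \<inter> F' = (X \<inter> F \<inter> F') \<union> ((F - X) \<inter> (F' - X))" by blast
      then show ?thesis using inter[OF that] card_Un_le[of "X \<inter> F \<inter> F'" "(F - X) \<inter> (F' - X)"] by simp
    qed
    \<comment> \<open>At most one common point outside \<open>X\<close> forces \<open>t - 1\<close>
      common points inside, hence equal traces.\<close>
    have same_trace: "X \<inter> F = X \<inter> F'" if F: "F \<in> \<F>" "\<not> X \<subseteq> F" "F' \<in> \<F>" "\<not> X \<subseteq> F'" and z: "(F - X) \<inter> (F' - X) \<subseteq> {z}" for F F' z
    proof -
      have ge: "t - 1 \<le> card (X \<inter> F \<inter> F')" using inter2[OF F(1,3)] card_le_one_of_subset[OF z] by simp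
      have "X \<inter> F \<inter> F' = X \<inter> F" using card_seteq[of "X \<inter> F" "X \<inter> F \<inter> F'"] finX ge trace[OF F(1,2)] by auto
      moreover have "X \<inter> F \<inter> F' = X \<inter> F'" using card_seteq[of "X \<inter> F'" "X \<inter> F \<inter> F'"] finX ge trace[OF F(3,4)] by auto
      ultimately show ?thesis by blast
    qed
    interpret pair_cover m \<H> E
    proof
      show "2 \<le> m" using m by simp
      show "card H = m + 1" if "H \<in> \<H>" for H using that cardH by (auto simp: \<H>_def)
      show "H \<inter> H' \<noteq> {}" if "H \<in> \<H>" "H' \<in> \<H>" for H H'
      proof
        assume empty: "H \<inter> H' = {}"
        obtain F F' where F: "F \<in> \<F>" "\<not> X \<subseteq> F" "H = F - X" "F' \<in> \<F>" "H' = F' - X" using \<open>H \<in> \<H>\<close> \<open>H' \<in> \<H>\<close> by (auto simp: \<H>_def)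
        have "t \<le> card (X \<inter> F \<inter> F')" using inter2[OF F(1,4)] empty F by simp
        also have "\<dots> \<le> card (X \<inter> F)" using finX by (intro card_mono) auto
        finally show False using trace[OF F(1,2)] t_pos by simp
      qed
      show hit: "e \<inter> H \<noteq> {}" if e: "e \<in> E" and H: "H \<in> \<H>" for e H
      proof
        assume empty: "e \<inter> H = {}"
        obtain F where F: "F \<in> \<F>" "\<not> X \<subseteq> F" "H = F - X" using H by (auto simp: \<H>_def)
        have "e \<inter> F = {}" using TT_E[OF e] empty F(3) by blast
        then show False using cov[OF e F(1)] trace[OF F(1,2)] t_pos by simp
      qed
      have main: "\<exists>H\<in>\<H>. v \<notin> H" if v: "v \<notin> X" for v
      proof -
        have "card (insert v X) = t + 1" using v X finX by simp
        then obtain F where F: "F \<in> \<F>" "card (insert v X \<inter> F) < t" using small_not_cover[of "insert v X"] finX by auto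
        have nX: "\<not> X \<subseteq> F"
        proof
          assume "X \<subseteq> F"
          then have "card X \<le> card (insert v X \<inter> F)" using finX by (intro card_mono) auto
          then show False using F(2) X by simp
        qed
        have "v \<notin> F"
        proof
          assume "v \<in> F"
          then have "insert v X \<inter> F = insert v (X \<inter> F)" by blast
          then have "card (insert v X \<inter> F) = card (X \<inter> F) + 1" using v finX by simp
          then show False using F(2) trace[OF F(1) nX] t_pos by simp
        qed
        then show ?thesis using F(1) nX by (auto simp: \<H>_def)
      qed
      obtain e0 where e0: "e0 \<in> E" using ne by (auto simp: E_def)
      then obtain v0 where "v0 \<in> e0" using card_E[OF e0] by fastforce
      then have v0: "v0 \<notin> X" using TT_E[OF e0] by blast
      show "\<H> \<noteq> {}" using main[OF v0] by blast
      show "\<exists>H\<in>\<H>. v \<notin> H" for v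
        using main[of v] main[OF v0] by (cases "v \<in> X") (auto simp: \<H>_def)
      show "card e = 2" if "e \<in> E" for e by (rule card_E[OF that])
    qed
    show ?thesis
    proof (cases "card E = m^2 + m + 1")
      case False
      then show ?thesis using card_E_le card_TT by simp
    next
      case True
      obtain y B C u where st: "insert y B \<in> \<H>" "insert y C \<in> \<H>" "insert u B \<in> \<H>" "card B = m" "card C = m"
        "B \<inter> C = {}" "y \<notin> B \<union> C" "u \<in> C" and
        bc: "\<And>b c. b \<in> B \<Longrightarrow> c \<in> C \<Longrightarrow> {b, c} \<in> E" and yh: "\<And>h. h \<in> insert u B \<Longrightarrow> {y, h} \<in> E"
        using extremal_structure[OF True] by metis
      obtain F1 where F1: "F1 \<in> \<F>" "\<not> X \<subseteq> F1" "F1 - X = insert y B" using st(1) by (auto simp: \<H>_def)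
      obtain F2 where F2: "F2 \<in> \<F>" "\<not> X \<subseteq> F2" "F2 - X = insert y C" using st(2) by (auto simp: \<H>_def)
      obtain F3 where F3: "F3 \<in> \<F>" "\<not> X \<subseteq> F3" "F3 - X = insert u B" using st(3) by (auto simp: \<H>_def)
      define X' where "X' = X \<inter> F1"
      have tr2: "X \<inter> F2 = X'"
        unfolding X'_def by (rule same_trace[OF F2(1,2) F1(1,2), of y]) (use F1(3) F2(3) st(6,7) in auto)
      have tr3: "X \<inter> F3 = X'"
        unfolding tr2[symmetric] by (rule same_trace[OF F3(1,2) F2(1,2), of u]) (use F2(3) F3(3) st(6,7) in auto)
      have cX': "card X' = t - 1" unfolding X'_def by (rule trace[OF F1(1,2)])
      have finX': "finite X'" using finX by (simp add: X'_def)
      have yX: "y \<notin> X" and BX: "B \<inter> X = {}" and CX: "C \<inter> X = {}" using F1(3) F2(3) by blast+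
      have X'X: "X' \<subseteq> X" by (auto simp: X'_def)
      \<comment> \<open>\<open>X\<close> becomes the set \<open>T\<close> of the Type I family.
        \<open>F1\<close> and \<open>F2\<close> share the trace \<open>X'\<close> on
        \<open>X\<close> and the point \<open>y\<close>, which together form
        \<open>A\<close>.\<close>
      define A where "A = insert y X'"
      have XA: "X \<inter> A = X'" using X'X yX by (auto simp: A_def)
      have finB: "finite B" "finite C" using st(4,5) m card.infinite by fastforce+
      have eq1: "A \<union> B = F1" using F1(3) by (auto simp: A_def X'_def)
      have eq2: "A \<union> C = F2" using F2(3) tr2 by (auto simp: A_def)
      have eq3: "(X \<inter> A) \<union> B \<union> {u} = F3" unfolding XA using F3(3) tr3 by auto
      have sub: "\<F> \<subseteq> type1_family n (t + m) X A B C u"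
      proof
        fix F assume F: "F \<in> \<F>"
        have Fk: "F \<in> ksets n (t + m)" using F \<F>_sub by blast
        show "F \<in> type1_family n (t + m) X A B C u"
        proof (cases "X \<subseteq> F")
          case True
          have meet: "F \<inter> H \<noteq> {}" if G: "G \<in> \<F>" "\<not> X \<subseteq> G" "G - X = H" for G H
          proof
            assume "F \<inter> H = {}"
            then have "(F - X) \<inter> (G - X) = {}" using G(3) by blast
            then have "t \<le> card (X \<inter> F \<inter> G)" using inter2[OF F G(1)] by simp
            also have "\<dots> \<le> card (X \<inter> G)" using finX by (intro card_mono) auto
            finally show False using trace[OF G(1,2)] t_pos by simp
          qed
          have h: "F \<inter> insert y B \<noteq> {}" "F \<inter> insert y C \<noteq> {}" "F \<inter> insert u B \<noteq> {}"
            using meet[OF F1] meet[OF F2] meet[OF F3] by auto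
          show ?thesis
          proof (cases "y \<in> F")
            case y: True
            have "A \<union> X \<subseteq> F" using True y X'X by (auto simp: A_def)
            moreover have "F \<inter> (B \<union> {u}) \<noteq> {}" using h(3) by auto
            ultimately show ?thesis using Fk by (simp add: type1_family_def)
          next
            case y: False
            have "F \<inter> (A \<union> X) = X" using True y X'X by (auto simp: A_def)
            moreover have "F \<inter> B \<noteq> {}" "F \<inter> C \<noteq> {}" using h(1,2) y by auto
            ultimately show ?thesis using Fk by (simp add: type1_family_def)
          qed
        next
          case nX: False
          define H where "H = F - X"
          have HH: "H \<in> \<H>" using F nX by (auto simp: \<H>_def H_def)
          have cH: "card H = m + 1" "finite H" using card_\<H>[OF HH] finite_\<H>[OF HH] by auto
          have FH: "F = (X \<inter> F) \<union> H" by (auto simp: H_def)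
          \<comment> \<open>If \<open>H\<close> missed some \<open>b\<close> in \<open>B\<close> and
            some \<open>c\<close> in \<open>C\<close>, it would miss the edge
            \<open>{b, c}\<close>.\<close>
          have BC: "B \<subseteq> H \<or> C \<subseteq> H" using hit[OF bc HH] by blast
          have yB: "y \<in> H \<or> insert u B \<subseteq> H" using hit[OF yh HH] by blast
          have full: "H = K" if "K \<subseteq> H" "card K = m + 1" for K
            using card_subset_eq[OF cH(2) that(1)] that(2) cH(1) by simp
          have cards: "card (insert y B) = m + 1" "card (insert y C) = m + 1" "card (insert u B) = m + 1"
            using card_\<H> st(1-3) by auto
          have "H = insert y B \<or> H = insert y C \<or> H = insert u B"
          proof (cases "insert u B \<subseteq> H")
            case True
            then show ?thesis using full[OF True cards(3)] by simp
          next
            case False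
            then have y: "y \<in> H" using yB by blast
            from BC show ?thesis
            proof
              assume "B \<subseteq> H"
              then show ?thesis using full[OF _ cards(1)] y by simp
            next
              assume "C \<subseteq> H"
              then show ?thesis using full[OF _ cards(2)] y by simp
            qed
          qed
          then have "F = A \<union> B \<or> F = A \<union> C \<or> F = (X \<inter> A) \<union> B \<union> {u}"
          proof (elim disjE)
            assume H: "H = insert y B"
            \<comment> \<open>The comparison is with \<open>F2\<close>, because
              \<open>insert y B\<close> meets \<open>insert y C\<close> only in \<open>y\<close>;
              the overlap with \<open>F1\<close> would be too large for
              \<open>same_trace\<close>.\<close>
            have "X \<inter> F = X \<inter> F2"
              by (rule same_trace[OF F nX F2(1,2), of y]) (use H F2(3) st(6,7) in \<open>auto simp: H_def\<close>)
            then have "F = A \<union> B" using FH H tr2 by (auto simp: A_def)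
            then show ?thesis by simp
          next
            assume H: "H = insert y C"
            have "X \<inter> F = X \<inter> F1"
              by (rule same_trace[OF F nX F1(1,2), of y]) (use H F1(3) st(6,7) in \<open>auto simp: H_def\<close>)
            then have "F = A \<union> C" using FH H by (auto simp: A_def X'_def)
            then show ?thesis by simp
          next
            assume H: "H = insert u B"
            have "X \<inter> F = X \<inter> F2"
              by (rule same_trace[OF F nX F2(1,2), of u]) (use H F2(3) st(6,7) in \<open>auto simp: H_def\<close>)
            then have "F = (X \<inter> A) \<union> B \<union> {u}" unfolding XA using FH H tr2 by auto
            then show ?thesis by simp
          qed
          then show ?thesis unfolding type1_family_def by blast
        qed
      qed
      have "is_type1 n (t + m) t (type1_family n (t + m) X A B C u)"
        unfolding is_type1_def
      proof (intro exI conjI)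
        show "X \<subseteq> {1..n}" by (rule Xn)
        show "A \<subseteq> {1..n}" using eq1 F_sub[OF F1(1)] by blast
        show "B \<subseteq> {1..n}" using eq1 F_sub[OF F1(1)] by blast
        show "C \<subseteq> {1..n}" using eq2 F_sub[OF F2(1)] by blast
        show "card X = t" by (rule X)
        show "card A = t" using finX' cX' yX X'X t_pos by (auto simp: A_def card_insert_if)
        show "card B = t + m - t" "card C = t + m - t" using st by auto
        show "card (X \<inter> A) = t - 1" using XA cX' by simp
        show "X \<inter> (B \<union> C) = {}" using BX CX by blast
        show "A \<inter> B = {}" "A \<inter> C = {}" using BX CX X'X st(7) by (auto simp: A_def)
        show "B \<inter> C = {}" "u \<in> C" using st by auto
      qed (rule refl)
      then show ?thesis using sub unfolding sub_type1_def by blast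
    qed
  qed
qed

end

text \<open>The left sides are the numbers of covers in the non-extremal cases: the first three
  belong to \<open>near_S_case\<close>, 12 to \<open>card_or_complete\<close>,
  \<open>m^2 + m\<close> to \<open>common_t_set_case\<close>, the others to
  \<open>near_W_case\<close>. For \<open>t = 1\<close> the coefficient \<open>m^2 + m + 1\<close>,
  which is at least \<open>4 m + 1\<close>, is decisive; for \<open>t = 2\<close> and
  \<open>m = 3\<close> the decisive one is \<open>(t+4 choose 2)\<close>.\<close>

lemma max_coeff_gt:
  fixes t m :: nat
  assumes "0 < t" "3 \<le> m"
  defines "c \<equiv> max (m^2 + m + 1) (max ((t + 2) * m + 1) ((t + 4) choose 2))"
  shows "m + 3 * t + 4 < c" "2 * m + 2 * t + 3 < c" "3 * m + 2 + t < c" "12 < c" "m^2 + m < c" "(t + 2) * m < c"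
    "t < 3 \<Longrightarrow> (t + 2) * m + 1 < c" "3 * (m + 1) < c"
proof -
  obtain p where p: "m = p + 3" using assms(2) by (metis le_add_diff_inverse2)
  have sq: "3 * m \<le> m^2" using assms(2) by (simp add: power2_eq_square)
  have c3: "2 * ((t + 4) choose 2) = t * t + 7 * t + 12"
  proof -
    have "even ((t + 4) * (t + 3))" by simp
    then have "2 * ((t + 4) * (t + 3) div 2) = (t + 4) * (t + 3)" by simp
    moreover have "(t + 4) choose 2 = (t + 4) * (t + 3) div 2" unfolding choose_two by (simp add: add.commute)
    ultimately show ?thesis by (simp add: algebra_simps)
  qed
  have c: "m^2 + m + 1 \<le> c" "(t + 2) * m + 1 \<le> c" "(t + 4) choose 2 \<le> c" by (auto simp: c_def)
  have c3': "t * t + 7 * t + 12 \<le> 2 * c" using c(3) c3 by linarith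
  have c2': "t * m + 2 * m + 1 \<le> c" using c(2) by (simp add: algebra_simps)
  have cm: "4 * m + 1 \<le> c" using c(1) sq by linarith
  show "12 < c" "m^2 + m < c" "(t + 2) * m < c" using cm c assms(2) by auto
  consider "t = 1" | "t = 2" | r where "t = r + 3" using assms(1)
    by (metis One_nat_def Suc_1 add.commute less_Suc_eq_le le_Suc_ex not_less_eq numeral_3_eq_3 less_one nat_neq_iff Suc_leI)
  note tc = this
  show "m + 3 * t + 4 < c" using tc
  proof cases
    case 1
    then show ?thesis using cm assms(2) by linarith
  next
    case 2
    then show ?thesis using cm c3' c2' assms(2) by (cases "m = 3") auto
  next
    case 3
    show ?thesis
    proof (cases "m = 3")
      case True
      then show ?thesis using c3' 3 by (simp add: algebra_simps)
    next
      case False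
      then have "4 \<le> m" using assms(2) by simp
      then obtain s where s: "m = s + 4" by (metis le_add_diff_inverse2)
      then show ?thesis using c2' 3 by (simp add: algebra_simps)
    qed
  qed
  show "2 * m + 2 * t + 3 < c" using tc
  proof cases
    case 1
    then show ?thesis using cm assms(2) by linarith
  next
    case 2
    then show ?thesis using cm c3' c2' assms(2) by (cases "m = 3") auto
  next
    case 3
    then show ?thesis using c2' p by (simp add: algebra_simps)
  qed
  show "3 * m + 2 + t < c" using tc
  proof cases
    case 1
    then show ?thesis using cm assms(2) by linarith
  next
    case 2
    then show ?thesis using cm c3' c2' assms(2) by (cases "m = 3") auto
  next
    case 3
    then show ?thesis using c2' p by (simp add: algebra_simps)
  qed
  have "3 * (m + 1) < 4 * m + 1" using assms(2) by simp
  then show "3 * (m + 1) < c" using cm by (rule less_le_trans)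
  show "(t + 2) * m + 1 < c" if "t < 3"
    using tc
  proof cases
    case 1
    then show ?thesis using cm assms(2) by simp
  next
    case 2
    show ?thesis
    proof (cases "m = 3")
      case True
      then show ?thesis using 2 c3' by simp
    next
      case False
      then have "4 * m \<le> m^2" using assms(2) by (simp add: power2_eq_square)
      then show ?thesis using 2 c(1) assms(2) by simp
    qed
  qed (use that in simp)
qed

context t_family
begin

definition cmax :: nat where
  "cmax = max (m^2 + m + 1) (max ((t + 2) * m + 1) ((t + 4) choose 2))"

lemmas cmax_gt = max_coeff_gt[OF t_pos m, folded cmax_def]

text \<open>If \<open>W\<close> is not a cover, some member \<open>F\<close> meets it in fewer than
  \<open>t\<close> points; only points of \<open>W - F\<close> can be exchanged, and at most three
  of them. If \<open>W\<close> is a cover, each of its points has at most \<open>m\<close>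
  exchanges, and \<open>(t + 2) m + 1\<close> is reached only when each has exactly
  \<open>m\<close>. For \<open>t \<ge> 3\<close> the exchange points then form a single set
  \<open>K\<close>, and \<open>M = W \<union> K\<close>.\<close>

lemma near_W_case:
  assumes W: "card W = t + 2" and W_near: "\<And>T. T \<in> TT \<Longrightarrow> t + 1 \<le> card (T \<inter> W)"
  shows "card TT < cmax \<or> sub_type2 n (t + m) t \<F>"
proof -
  have finW: "finite W" using W card.infinite by fastforce
  define Nw where "Nw w = {T \<in> TT. T \<inter> W = W - {w}}" for w
  have fin_Nw: "finite (Nw w)" for w using fin_TT by (simp add: Nw_def)
  have cU: "card (W - {w}) = t + 1" if "w \<in> W" for w using that W finW by simp
  have split: "T = W \<or> (\<exists>w\<in>W. T \<in> Nw w)" if T: "T \<in> TT" for T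
  proof (cases "W \<subseteq> T")
    case True
    then show ?thesis using card_subset_eq[OF fin_T[OF T] True] W TT_D(2)[OF T] by simp
  next
    case False
    have "card (W - T) \<le> 1" using card_Diff_subset_Int[of W T] finW W W_near[OF T] by (simp add: Int_commute)
    moreover have "W - T \<noteq> {}" using False by blast
    ultimately obtain w where w: "W - T = {w}"
      by (metis One_nat_def card_0_eq card_1_singletonE finW finite_Diff le_Suc_eq le_zero_eq)
    then have "T \<inter> W = W - {w}" "w \<in> W" by auto
    then show ?thesis using T by (auto simp: Nw_def)
  qed
  show ?thesis
  proof (cases "W \<in> TT")
    case False
    have "\<exists>F\<in>\<F>. card (W \<inter> F) < t"
    proof (cases "W \<subseteq> {1..n}")
      case True
      then show ?thesis using False W unfolding TT_def t_cover_def by fastforce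
    next
      case nsub: False
      then have "W \<inter> {1..n} \<subset> W" by blast
      then have "card (W \<inter> {1..n}) < t + 2" using psubset_card_mono[OF finW] W by metis
      then obtain F where F: "F \<in> \<F>" "card (W \<inter> {1..n} \<inter> F) < t" using small_not_cover[of "W \<inter> {1..n}"] finW by auto
      have "W \<inter> {1..n} \<inter> F = W \<inter> F" using F_sub[OF F(1)] by blast
      then show ?thesis using F by auto
    qed
    then obtain F where F: "F \<in> \<F>" "card (W \<inter> F) < t" by blast
    define P where "P = {w \<in> W. Nw w \<noteq> {}}"
    have P: "w \<notin> F \<and> card (W \<inter> F) = t - 1" if w: "w \<in> P" for w
    proof -
      obtain T where T: "T \<in> TT" "T \<inter> W = W - {w}" "w \<in> W" using w by (auto simp: P_def Nw_def)
      have "card (T - W) = 1" using card_Diff_subset_Int[of T W] finW fin_T[OF T(1)] TT_D(2)[OF T(1)] T(2) cU[OF T(3)] by simp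
      then obtain x where x: "T - W = {x}" by (metis card_1_singletonE)
      have "T \<inter> F \<subseteq> insert x ((W - {w}) \<inter> F)" using T(2) x by blast
      then have "card (T \<inter> F) \<le> card (insert x ((W - {w}) \<inter> F))" using finW by (intro card_mono) auto
      also have "\<dots> \<le> Suc (card ((W - {w}) \<inter> F))" using finW by (simp add: card_insert_if)
      finally have ge: "t \<le> Suc (card ((W - {w}) \<inter> F))" using TT_D(3)[OF T(1) F(1)] by simp
      have "w \<notin> F"
      proof
        assume "w \<in> F"
        then have "W \<inter> F = insert w ((W - {w}) \<inter> F)" using T(3) by blast
        then have "card (W \<inter> F) = Suc (card ((W - {w}) \<inter> F))" using finW by simp
        then show False using ge F(2) by simp
      qed
      moreover from this have "(W - {w}) \<inter> F = W \<inter> F" by blast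
      then have "card (W \<inter> F) = t - 1" using ge F(2) by simp
      ultimately show ?thesis by simp
    qed
    have cP: "card P \<le> 3"
    proof (cases "P = {}")
      case False
      then have "card (W \<inter> F) = t - 1" using P by blast
      then have "card (W - F) = 3" using card_Diff_subset_Int[of W F] finW W t_pos by simp
      moreover have "P \<subseteq> W - F" using P by (auto simp: P_def)
      ultimately show ?thesis using card_mono[of "W - F" P] finW by simp
    qed simp
    have finP: "finite P" using finW by (simp add: P_def)
    have Nw_le: "card (Nw w) \<le> m + 1" if w: "w \<in> P" for w
    proof -
      have "w \<in> W" using w by (simp add: P_def)
      have "Nw w \<subseteq> {T \<in> TT. W - {w} \<subseteq> T}" by (auto simp: Nw_def)
      then have "card (Nw w) \<le> card {T \<in> TT. W - {w} \<subseteq> T}" using fin_TT by (intro card_mono) auto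
      then show ?thesis using degree_le[OF cU[OF \<open>w \<in> W\<close>]] by simp
    qed
    have "TT \<subseteq> (\<Union>w\<in>P. Nw w)" using split False by (fastforce simp: P_def)
    then have "card TT \<le> card (\<Union>w\<in>P. Nw w)" using finP fin_Nw by (intro card_mono) auto
    also have "\<dots> \<le> (\<Sum>w\<in>P. card (Nw w))" by (rule card_UN_le[OF finP])
    also have "\<dots> \<le> (\<Sum>w\<in>P. m + 1)" by (rule sum_mono) (rule Nw_le)
    also have "\<dots> = card P * (m + 1)" by simp
    also have "\<dots> \<le> 3 * (m + 1)" using cP by (rule mult_le_mono1)
    finally show ?thesis using cmax_gt(8) by linarith
  next
    case WT: True
    have Nw_le: "card (Nw w) \<le> m" if w: "w \<in> W" for w
    proof -
      have "insert W (Nw w) \<subseteq> {T \<in> TT. W - {w} \<subseteq> T}" using WT by (auto simp: Nw_def)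
      then have "card (insert W (Nw w)) \<le> card {T \<in> TT. W - {w} \<subseteq> T}" using fin_TT by (intro card_mono) auto
      moreover have "W \<notin> Nw w" using w by (auto simp: Nw_def)
      ultimately show ?thesis using degree_le[OF cU[OF w]] fin_Nw[of w] by simp
    qed
    have "TT \<subseteq> insert W (\<Union>w\<in>W. Nw w)" using split by blast
    then have "card TT \<le> card (insert W (\<Union>w\<in>W. Nw w))" using finW fin_Nw by (intro card_mono) auto
    also have "\<dots> \<le> Suc (card (\<Union>w\<in>W. Nw w))" using finW fin_Nw by (simp add: card_insert_if)
    also have "card (\<Union>w\<in>W. Nw w) \<le> (\<Sum>w\<in>W. card (Nw w))" by (rule card_UN_le[OF finW])
    finally have le: "card TT \<le> Suc (\<Sum>w\<in>W. card (Nw w))" by simp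
    have "(\<Sum>w\<in>W. card (Nw w)) \<le> (\<Sum>w\<in>W. m)" by (rule sum_mono) (rule Nw_le)
    then have le2: "(\<Sum>w\<in>W. card (Nw w)) \<le> (t + 2) * m" using W by simp
    \<comment> \<open>For \<open>t < 3\<close> even \<open>(t + 2) m + 1\<close> is below
      \<open>cmax\<close>, so the structure has to be determined only for \<open>t \<ge> 3\<close>,
      the condition on which \<open>NK\<close> relies.\<close>
    show ?thesis
    proof (cases "(\<exists>w\<in>W. card (Nw w) < m) \<or> t < 3")
      case True
      then have "card TT < cmax"
      proof
        assume "t < 3"
        then show ?thesis using cmax_gt(7) le le2 by linarith
      next
        assume "\<exists>w\<in>W. card (Nw w) < m"
        then have "(\<Sum>w\<in>W. card (Nw w)) < (\<Sum>w\<in>W. m)" using Nw_le by (intro sum_strict_mono_ex1[OF finW]) auto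
        then have "card TT \<le> (t + 2) * m" using le W by simp
        then show ?thesis using cmax_gt(6) by linarith
      qed
      then show ?thesis by simp
    next
      case False
      then have t3: "3 \<le> t" and Nw_m: "\<And>w. w \<in> W \<Longrightarrow> card (Nw w) = m" using Nw_le by force+
      define N where "N w = {x. x \<notin> W \<and> insert x (W - {w}) \<in> TT}" for w
      have cN: "card (N w) = m" if w: "w \<in> W" for w
      proof -
        have "Nw w = (\<lambda>x. insert x (W - {w})) ` N w"
        proof
          show "Nw w \<subseteq> (\<lambda>x. insert x (W - {w})) ` N w"
          proof
            fix T assume "T \<in> Nw w"
            then have T: "T \<in> TT" "T \<inter> W = W - {w}" by (auto simp: Nw_def)
            have "card (T - W) = 1" using card_Diff_subset_Int[of T W] finW fin_T[OF T(1)] TT_D(2)[OF T(1)] T(2) cU[OF w] by simp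
            then obtain x where x: "T - W = {x}" by (metis card_1_singletonE)
            then have "T = insert x (W - {w})" "x \<notin> W" using T(2) by blast+
            then show "T \<in> (\<lambda>x. insert x (W - {w})) ` N w" using T(1) by (auto simp: N_def)
          qed
          show "(\<lambda>x. insert x (W - {w})) ` N w \<subseteq> Nw w" by (auto simp: N_def Nw_def)
        qed
        moreover have "inj_on (\<lambda>x. insert x (W - {w})) (N w)" by (auto simp: inj_on_def N_def)
        ultimately show ?thesis using Nw_m[OF w] card_image by metis
      qed
      have finN: "finite (N w)" if "w \<in> W" for w using cN[OF that] m card.infinite by fastforce
      \<comment> \<open>The cover \<open>insert x (W - {v})\<close> loses \<open>v\<close> from the
        \<open>t\<close> points of \<open>W \<inter> F\<close>, so \<open>x\<close> must lie in
        \<open>F\<close>. The \<open>m\<close> points of \<open>N v\<close> thus fill all of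
        \<open>F - W\<close>.\<close>
      have key: "F - W = N v" if F: "F \<in> \<F>" "card (W \<inter> F) = t" and v: "v \<in> W" "v \<in> F" for F v
      proof -
        have "N v \<subseteq> F - W"
        proof
          fix x assume x: "x \<in> N v"
          then have T: "insert x (W - {v}) \<in> TT" "x \<notin> W" by (auto simp: N_def)
          have "x \<in> F"
          proof (rule ccontr)
            assume "x \<notin> F"
            then have "insert x (W - {v}) \<inter> F = W \<inter> F - {v}" by blast
            then have "card (insert x (W - {v}) \<inter> F) = t - 1" using F(2) v finW by simp
            then show False using TT_D(3)[OF T(1) F(1)] t_pos by simp
          qed
          then show "x \<in> F - W" using T by simp
        qed
        moreover have "card (F - W) = m"
          using card_Diff_subset_Int[of F W] F_fin[OF F(1)] F_card[OF F(1)] F(2) by (simp add: Int_commute)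
        ultimately show ?thesis using card_subset_eq[of "F - W" "N v"] F_fin[OF F(1)] cN[OF v(1)] by simp
      qed
      \<comment> \<open>\<open>W - {w}\<close> is too small to be a cover while \<open>W\<close> is
        one; a member witnessing this has exactly \<open>t\<close> points in \<open>W\<close>, among
        them \<open>w\<close>.\<close>
      have wit: "\<exists>F\<in>\<F>. card (W \<inter> F) = t \<and> w \<in> F" if w: "w \<in> W" for w
      proof -
        obtain F where F: "F \<in> \<F>" "card ((W - {w}) \<inter> F) < t" using small_not_cover[of "W - {w}"] cU[OF w] finW by auto
        have ge: "t \<le> card (W \<inter> F)" using TT_D(3)[OF WT F(1)] .
        have wF: "w \<in> F"
        proof (rule ccontr)
          assume "w \<notin> F"
          then have "(W - {w}) \<inter> F = W \<inter> F" by blast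
          then show False using ge F(2) by simp
        qed
        then have "W \<inter> F = insert w ((W - {w}) \<inter> F)" using w by blast
        then have "card (W \<inter> F) = Suc (card ((W - {w}) \<inter> F))" using finW by simp
        then have "card (W \<inter> F) = t" using ge F(2) by linarith
        then show ?thesis using F(1) wF by blast
      qed
      obtain w0 where w0: "w0 \<in> W" using W by fastforce
      define K where "K = N w0"
      have NK: "N w = K" if w: "w \<in> W" for w
      proof -
        obtain F1 where F1: "F1 \<in> \<F>" "card (W \<inter> F1) = t" "w \<in> F1" using wit[OF w] by blast
        obtain F2 where F2: "F2 \<in> \<F>" "card (W \<inter> F2) = t" "w0 \<in> F2" using wit[OF w0] by blast
        \<comment> \<open>Each of the two members misses two of the at least five points of
          \<open>W\<close>, so they share a point \<open>v\<close> in \<open>W\<close>, and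
          \<open>key\<close> at \<open>v\<close> links \<open>N w\<close> to
          \<open>N w0\<close>.\<close>
        have "card (W - F1) = 2" "card (W - F2) = 2"
          using card_Diff_subset_Int[of W F1] card_Diff_subset_Int[of W F2] finW W F1 F2 by simp_all
        then have "card ((W - F1) \<union> (W - F2)) \<le> 4" using card_Un_le[of "W - F1" "W - F2"] by simp
        moreover have "5 \<le> card W" using W t3 by simp
        ultimately have "\<not> W \<subseteq> (W - F1) \<union> (W - F2)" using card_mono[of "(W - F1) \<union> (W - F2)" W] finW by fastforce
        then obtain v where v: "v \<in> W" "v \<in> F1" "v \<in> F2" by blast
        show ?thesis unfolding K_def
          using key[OF F1(1,2) w F1(3)] key[OF F1(1,2) v(1,2)] key[OF F2(1,2) w0 F2(3)] key[OF F2(1,2) v(1,3)] by simp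
      qed
      have WK: "W \<inter> K = {}" by (auto simp: K_def N_def)
      define M where "M = W \<union> K"
      have MW: "M - W = K" using WK by (auto simp: M_def)
      have cM: "card M = t + m + 2" using card_Un_disjoint[OF finW finN[OF w0]] WK W cN[OF w0] by (simp add: M_def K_def)
      obtain F0 where F0: "F0 \<in> \<F>" "card (W \<inter> F0) = t" "w0 \<in> F0" using wit[OF w0] by blast
      have "K \<subseteq> {1..n}" using key[OF F0(1,2) w0 F0(3)] F_sub[OF F0(1)] by (auto simp: K_def)
      then have Mn: "M \<subseteq> {1..n}" using TT_D(1)[OF WT] by (simp add: M_def)
      have "\<F> \<subseteq> type2_family n (t + m) t M W"
      proof
        fix F assume F: "F \<in> \<F>"
        have Fk: "F \<in> ksets n (t + m)" using F \<F>_sub by blast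
        have ge: "t \<le> card (W \<inter> F)" using TT_D(3)[OF WT F] .
        have "card (W \<inter> F) \<le> t + 2" using card_mono[OF finW, of "W \<inter> F"] W by simp
        then consider "card (W \<inter> F) = t" | "card (W \<inter> F) = t + 1" | "card (W \<inter> F) = t + 2" using ge by linarith
        then show "F \<in> type2_family n (t + m) t M W"
        proof cases
          case 1
          then obtain v where v: "v \<in> W" "v \<in> F" using t_pos by (metis Int_iff all_not_in_conv card.empty not_less_zero)
          have "F - W = K" using key[OF F 1 v] NK[OF v(1)] by simp
          then have "F \<subseteq> M" by (auto simp: M_def)
          then show ?thesis using 1 F_card[OF F] by (simp add: type2_family_def Int_commute)
        next
          case 2
          have "card (W - F) = 1" using card_Diff_subset_Int[of W F] finW W 2 by simp
          then obtain w where w: "W - F = {w}" by (metis card_1_singletonE)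
          then have wW: "w \<in> W" "w \<notin> F" by auto
          obtain F' where F': "F' \<in> \<F>" "card (W \<inter> F') = t" "w \<in> F'" using wit[OF wW(1)] by blast
          have "F' - W = K" using key[OF F'(1,2) wW(1) F'(3)] NK[OF wW(1)] by simp
          \<comment> \<open>\<open>F'\<close> has only the points of \<open>K\<close> outside
            \<open>W\<close>, and \<open>F\<close> misses \<open>w\<close>; without a point in
            \<open>K\<close>, only the \<open>t - 1\<close> other points of
            \<open>W \<inter> F'\<close> could be common.\<close>
          have "F \<inter> K \<noteq> {}"
          proof
            assume "F \<inter> K = {}"
            then have "F \<inter> F' \<subseteq> W \<inter> F' - {w}" using \<open>F' - W = K\<close> wW by blast
            then have "card (F \<inter> F') \<le> card (W \<inter> F' - {w})" using finW by (intro card_mono) auto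
            also have "\<dots> = t - 1" using F' wW finW by simp
            finally show False using inter[OF F F'(1)] t_pos by simp
          qed
          then show ?thesis using Fk 2 MW by (simp add: type2_family_def Int_commute)
        next
          case 3
          then have "W \<inter> F = W" using card_subset_eq[OF finW, of "W \<inter> F"] W by simp
          then have "W \<subseteq> F" by blast
          then show ?thesis using Fk by (simp add: type2_family_def)
        qed
      qed
      moreover have "is_type2 n (t + m) t (type2_family n (t + m) t M W)"
        unfolding is_type2_def using Mn cM W by (intro exI[of _ M] exI[of _ W]) (auto simp: M_def)
      ultimately show ?thesis unfolding sub_type2_def by blast
    qed
  qed
qed

end

context maximal_t_family
begin

text \<open>A cover not containing \<open>S\<close> misses one point \<open>s\<close> of it and
  leaves a pair outside; by \<open>TT_inter\<close> the graphs \<open>Es s\<close> for different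
  \<open>s\<close> are cross-intersecting. \<open>no_X\<close> supplies two nonempty graphs, and
  \<open>no_W\<close> excludes a point common to all edges. With the at most \<open>m + 1\<close>
  covers containing \<open>S\<close> this leads to the first three bounds of
  \<open>max_coeff_gt\<close>.\<close>

lemma near_S_case:
  assumes S: "card S = t + 1" and S_near: "\<And>T. T \<in> TT \<Longrightarrow> t \<le> card (T \<inter> S)"
    and no_X: "\<And>X. card X = t \<Longrightarrow> \<exists>T\<in>TT. \<not> X \<subseteq> T"
    and no_W: "\<And>W. card W = t + 2 \<Longrightarrow> \<exists>T\<in>TT. card (T \<inter> W) \<le> t"
  shows "card TT < cmax"
proof -
  have finS: "finite S" using S card.infinite by fastforce
  define TS where "TS = {T \<in> TT. S \<subseteq> T}"
  define Es where "Es s = {e. e \<inter> S = {} \<and> (S - {s}) \<union> e \<in> TT}" for s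
  have cS1: "card (S - {s}) = t" if "s \<in> S" for s using that S finS by simp
  have fin_e: "finite e" if "e \<in> Es s" for e s using that fin_T[of "S - {s} \<union> e"] by (simp add: Es_def)
  have card_e: "card e = 2" if s: "s \<in> S" and e: "e \<in> Es s" for s e
  proof -
    have "(S - {s}) \<inter> e = {}" using e by (auto simp: Es_def)
    then have "card (S - {s} \<union> e) = t + card e" using card_Un_disjoint[of "S - {s}" e] finS fin_e[OF e] cS1[OF s] by simp
    then show ?thesis using TT_D(2)[of "S - {s} \<union> e"] e by (simp add: Es_def)
  qed
  have cases_T: "T \<in> TS \<or> (\<exists>s\<in>S. \<exists>e\<in>Es s. T = S - {s} \<union> e)" if T: "T \<in> TT" for T
  proof (cases "S \<subseteq> T")
    case True
    then show ?thesis using T by (simp add: TS_def)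
  next
    case False
    have "card (S - T) \<le> 1" using card_Diff_subset_Int[of S T] finS S S_near[OF T] by (simp add: Int_commute)
    moreover have "S - T \<noteq> {}" using False by blast
    ultimately obtain s where s: "S - T = {s}"
      by (metis One_nat_def card_0_eq card_1_singletonE finS finite_Diff le_Suc_eq le_zero_eq)
    have eq: "T = S - {s} \<union> (T - S)" using s by blast
    then have "T - S \<in> Es s" using T by (auto simp: Es_def)
    then show ?thesis using eq s by blast
  qed
  have fin_Es: "finite (Es s)" for s
  proof -
    have "Es s \<subseteq> (\<lambda>T. T - S) ` TT"
    proof
      fix e assume "e \<in> Es s"
      then have "S - {s} \<union> e \<in> TT" "e = (S - {s} \<union> e) - S" by (auto simp: Es_def)
      then show "e \<in> (\<lambda>T. T - S) ` TT" by blast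
    qed
    then show ?thesis using finite_subset fin_TT by blast
  qed
  have finTS: "finite TS" using fin_TT by (simp add: TS_def)
  have TS_le: "card TS \<le> m + 1" unfolding TS_def by (rule degree_le[OF S])
  have total: "card TT \<le> card TS + (\<Sum>s\<in>S. card (Es s))"
  proof -
    have "TT \<subseteq> TS \<union> (\<Union>s\<in>S. (\<lambda>e. S - {s} \<union> e) ` Es s)" using cases_T by blast
    then have "card TT \<le> card (TS \<union> (\<Union>s\<in>S. (\<lambda>e. S - {s} \<union> e) ` Es s))" using finTS finS fin_Es by (intro card_mono) auto
    also have "\<dots> \<le> card TS + card (\<Union>s\<in>S. (\<lambda>e. S - {s} \<union> e) ` Es s)" by (rule card_Un_le)
    also have "card (\<Union>s\<in>S. (\<lambda>e. S - {s} \<union> e) ` Es s) \<le> (\<Sum>s\<in>S. card ((\<lambda>e. S - {s} \<union> e) ` Es s))" by (rule card_UN_le[OF finS])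
    also have "\<dots> \<le> (\<Sum>s\<in>S. card (Es s))" by (intro sum_mono card_image_le fin_Es)
    finally show ?thesis by simp
  qed
  have cross: "e \<inter> f \<noteq> {}" if "i \<in> S" "j \<in> S" "i \<noteq> j" "e \<in> Es i" "f \<in> Es j" for i j e f
  proof
    assume empty: "e \<inter> f = {}"
    have "(S - {i} \<union> e) \<inter> (S - {j} \<union> f) = S - {i, j}" using that empty by (auto simp: Es_def)
    moreover have "card (S - {i, j}) = t - 1" using that S finS by (simp add: card_Diff_subset)
    ultimately show False using TT_inter[of "S - {i} \<union> e" "S - {j} \<union> f"] that t_pos by (simp add: Es_def)
  qed
  have deg_sub: "card ((\<lambda>e. S - {s} \<union> e) ` {e \<in> Es s. v \<in> e}) = card {e \<in> Es s. v \<in> e}" for s v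
    by (rule card_image) (auto simp: inj_on_def Es_def)
  \<comment> \<open>Edges of \<open>Es s\<close> through \<open>v\<close> correspond to covers
    containing the \<open>(t + 1)\<close>-set \<open>U\<close>, of which there are at most
    \<open>m + 1\<close>; if \<open>insert v S\<close> is a cover, it takes one of these
    places.\<close>
  have deg: "card {e \<in> Es s. v \<in> e} \<le> m + 1" "insert v S \<in> TS \<Longrightarrow> card {e \<in> Es s. v \<in> e} \<le> m" if s: "s \<in> S" for s v
  proof -
    have "card {e \<in> Es s. v \<in> e} \<le> m + 1 \<and> (insert v S \<in> TS \<longrightarrow> card {e \<in> Es s. v \<in> e} \<le> m)"
    proof (cases "v \<in> S")
      case True
      then have "{e \<in> Es s. v \<in> e} = {}" by (auto simp: Es_def)
      then have "card {e \<in> Es s. v \<in> e} = 0" by (metis card.empty)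
      then show ?thesis by linarith
    next
      case False
      define U where "U = insert v (S - {s})"
      have cU: "card U = t + 1" using False cS1[OF s] finS by (simp add: U_def)
      let ?I = "(\<lambda>e. S - {s} \<union> e) ` {e \<in> Es s. v \<in> e}"
      have sub: "?I \<subseteq> {T \<in> TT. U \<subseteq> T}" by (auto simp: Es_def U_def)
      have finD: "finite {T \<in> TT. U \<subseteq> T}" using fin_TT by simp
      have "card ?I \<le> m + 1" using card_mono[OF finD sub] degree_le[OF cU] by simp
      moreover have "card ?I \<le> m" if vS: "insert v S \<in> TS"
      proof -
        have "insert v S \<notin> ?I" using s by (auto simp: Es_def)
        moreover have "insert (insert v S) ?I \<subseteq> {T \<in> TT. U \<subseteq> T}" using sub vS by (auto simp: TS_def U_def)
        then have "card (insert (insert v S) ?I) \<le> m + 1" by (rule order_trans[OF card_mono[OF finD] degree_le[OF cU]])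
        moreover have "finite ?I" using fin_Es by simp
        ultimately show ?thesis by simp
      qed
      ultimately show ?thesis unfolding deg_sub by blast
    qed
    then show "card {e \<in> Es s. v \<in> e} \<le> m + 1" "insert v S \<in> TS \<Longrightarrow> card {e \<in> Es s. v \<in> e} \<le> m" by auto
  qed
  have other: "\<exists>s'\<in>S. s' \<noteq> s \<and> Es s' \<noteq> {}" if s: "s \<in> S" for s
  proof -
    obtain T where T: "T \<in> TT" "\<not> S - {s} \<subseteq> T" using no_X[OF cS1[OF s]] by blast
    then have "T \<notin> TS" by (auto simp: TS_def)
    then obtain s' e where se: "s' \<in> S" "e \<in> Es s'" "T = S - {s'} \<union> e" using cases_T[OF T(1)] by blast
    have "s' \<noteq> s" using T(2) se(3) by blast
    then show ?thesis using se by blast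
  qed
  obtain s where s: "s \<in> S" using S by fastforce
  obtain i0 where i0: "i0 \<in> S" "Es i0 \<noteq> {}" using other[OF s] by blast
  obtain j0 where j0: "j0 \<in> S" "j0 \<noteq> i0" "Es j0 \<noteq> {}" using other[OF i0(1)] by blast
  have no_common: "\<exists>i\<in>S. \<exists>e\<in>Es i. v \<notin> e" for v
  proof (cases "v \<in> S")
    case True
    then show ?thesis using i0 by (auto simp: Es_def)
  next
    case False
    then have "card (insert v S) = t + 2" using S finS by simp
    then obtain T where T: "T \<in> TT" "card (T \<inter> insert v S) \<le> t" using no_W by blast
    have "T \<notin> TS"
    proof
      assume "T \<in> TS"
      then have "card S \<le> card (T \<inter> insert v S)" using fin_T[OF T(1)] by (intro card_mono) (auto simp: TS_def)
      then show False using T(2) S by simp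
    qed
    then obtain s e where se: "s \<in> S" "e \<in> Es s" "T = S - {s} \<union> e" using cases_T[OF T(1)] by blast
    have "v \<notin> e"
    proof
      assume "v \<in> e"
      then have "insert v (S - {s}) \<subseteq> T \<inter> insert v S" using se by blast
      then have "card (insert v (S - {s})) \<le> card (T \<inter> insert v S)" using fin_T[OF T(1)] by (intro card_mono) auto
      then show False using T(2) cS1[OF se(1)] False finS by simp
    qed
    then show ?thesis using se by blast
  qed
  have "(\<Sum>i\<in>S. card (Es i)) \<le> 3 * card S \<or> (\<Sum>i\<in>S. card (Es i)) \<le> m + 1 + 1 + 2 * (card S - 1)
    \<or> (\<exists>p\<in>S. \<exists>j\<in>S. j \<noteq> p \<and> Es j \<noteq> {} \<and> (\<forall>i\<in>S - {p}. card (Es i) \<le> 1))"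
    using finS fin_Es card_e cross deg(1) m i0 j0 no_common
    by (intro cross_intersecting_graphs[of S Es "m + 1" i0 j0]) auto
  then show ?thesis
  proof (elim disjE)
    assume "(\<Sum>i\<in>S. card (Es i)) \<le> 3 * card S"
    then show ?thesis using total TS_le S cmax_gt(1) by linarith
  next
    assume "(\<Sum>i\<in>S. card (Es i)) \<le> m + 1 + 1 + 2 * (card S - 1)"
    then show ?thesis using total TS_le S cmax_gt(2) by linarith
  next
    assume "\<exists>p\<in>S. \<exists>j\<in>S. j \<noteq> p \<and> Es j \<noteq> {} \<and> (\<forall>i\<in>S - {p}. card (Es i) \<le> 1)"
    then obtain p j e where pj: "p \<in> S" "j \<in> S" "j \<noteq> p" "e \<in> Es j" "\<And>i. i \<in> S - {p} \<Longrightarrow> card (Es i) \<le> 1" by blast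
    have hits: "card (Es p) \<le> card {f \<in> Es p. z \<in> f} + card {f \<in> Es p. z' \<in> f}" if "e = {z, z'}" for z z'
    proof -
      have "Es p \<subseteq> {f \<in> Es p. z \<in> f} \<union> {f \<in> Es p. z' \<in> f}" using cross[OF pj(1,2) pj(3)[symmetric] _ pj(4)] that by blast
      then have "card (Es p) \<le> card ({f \<in> Es p. z \<in> f} \<union> {f \<in> Es p. z' \<in> f})" using fin_Es[of p] by (intro card_mono) auto
      then show ?thesis using card_Un_le le_trans by blast
    qed
    \<comment> \<open>Every edge of \<open>Es p\<close> passes through an end of \<open>e\<close>,
      so there are at most \<open>2 (m + 1)\<close>. This suffices unless \<open>S\<close> has all
      \<open>m + 1\<close> extensions; then one end \<open>z\<close> of \<open>e\<close> is an
      extension point, and its degree drops to \<open>m\<close>.\<close>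
    have main: "card TS + card (Es p) \<le> 3 * m + 2"
    proof (cases "card TS \<le> m")
      case True
      obtain z z' where z: "e = {z, z'}" using card_e[OF pj(2,4)] by (auto simp: card_2_iff)
      show ?thesis using hits[OF z] deg(1)[OF pj(1), of z] deg(1)[OF pj(1), of z'] True by linarith
    next
      case False
      obtain F where F: "F \<in> \<F>" "card (S \<inter> F) < t" using small_not_cover[OF finS] S by auto
      have ext: "TS \<subseteq> (\<lambda>x. insert x S) ` (F - S)" "card (F - S) = m + 1"
      proof -
        have a: "\<And>T. T \<in> TS \<Longrightarrow> S \<subseteq> T" "\<And>T. T \<in> TS \<Longrightarrow> card T = card S + 1" "\<And>T. T \<in> TS \<Longrightarrow> t \<le> card (T \<inter> F)"
          using TT_D(2,3) F(1) S by (auto simp: TS_def)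
        have "TS \<noteq> {}" using False by auto
        then show "TS \<subseteq> (\<lambda>x. insert x S) ` (F - S)" "card (F - S) = m + 1"
          using one_point_extensions(1,2)[OF finS F_fin[OF F(1)] F_card[OF F(1)] _ F(2) a] by auto
      qed
      have finFS: "finite (F - S)" using F_fin[OF F(1)] by simp
      have "TS = (\<lambda>x. insert x S) ` (F - S)"
      proof (rule card_seteq[OF _ ext(1)])
        show "card ((\<lambda>x. insert x S) ` (F - S)) \<le> card TS" using card_image_le[OF finFS, of "\<lambda>x. insert x S"] ext(2) False by simp
      qed (use finFS in simp)
      \<comment> \<open>\<open>S\<close> meets \<open>F\<close> in fewer than \<open>t\<close>
        points, so the cover \<open>S - {j} \<union> e\<close> needs a point of \<open>e\<close> in
        \<open>F\<close>.\<close>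
      moreover have "e \<inter> F \<noteq> {}"
      proof
        assume "e \<inter> F = {}"
        then have "(S - {j} \<union> e) \<inter> F \<subseteq> S \<inter> F" by blast
        then have "card ((S - {j} \<union> e) \<inter> F) \<le> card (S \<inter> F)" using finS by (intro card_mono) auto
        then show False using TT_D(3)[of "S - {j} \<union> e" F] pj(4) F by (simp add: Es_def)
      qed
      then obtain z where z: "z \<in> e" "z \<in> F" by blast
      moreover have "z \<notin> S" using z pj(4) by (auto simp: Es_def)
      ultimately have zTS: "insert z S \<in> TS" by blast
      obtain z' where z': "e = {z, z'}" using other_of_pair[OF card_e[OF pj(2,4)] z(1)] by blast
      show ?thesis using hits[OF z'] deg(2)[OF pj(1) zTS] deg(1)[OF pj(1), of z'] TS_le by linarith
    qed
    have "(\<Sum>i\<in>S - {p}. card (Es i)) \<le> (\<Sum>i\<in>S - {p}. 1)" by (rule sum_mono) (rule pj(5))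
    also have "\<dots> = t" using cS1[OF pj(1)] by simp
    finally have "(\<Sum>i\<in>S. card (Es i)) \<le> card (Es p) + t"
      using sum.remove[OF finS pj(1), of "\<lambda>i. card (Es i)"] by simp
    then show ?thesis using total main cmax_gt(3) by linarith
  qed
qed

lemma few_covers_or_structured:
  assumes ne: "TT \<noteq> {}"
  shows "card TT < cmax \<or> sub_type1 n (t + m) t \<F> \<or> sub_type2 n (t + m) t \<F> \<or> sub_type3 n (t + m) t \<F>"
proof (cases "\<exists>X. card X = t \<and> (\<forall>T\<in>TT. X \<subseteq> T)")
  case True
  then show ?thesis using common_t_set_case[OF _ _ ne] cmax_gt(5) le_less_trans by blast
next
  case noX: False
  show ?thesis
  proof (cases "\<exists>W. card W = t + 2 \<and> (\<forall>T\<in>TT. t + 1 \<le> card (T \<inter> W))")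
    case True
    then show ?thesis using near_W_case by blast
  next
    case noW: False
    show ?thesis
    proof (cases "\<exists>S. card S = t + 1 \<and> (\<forall>T\<in>TT. t \<le> card (T \<inter> S))")
      case True
      then obtain S where S: "card S = t + 1" "\<And>T. T \<in> TT \<Longrightarrow> t \<le> card (T \<inter> S)" by blast
      have "card TT < cmax"
      proof (rule near_S_case[OF S])
        show "\<exists>T\<in>TT. \<not> X \<subseteq> T" if "card X = t" for X using noX that by blast
        show "\<exists>T\<in>TT. card (T \<inter> W) \<le> t" if "card W = t + 2" for W
          using noW that by (metis Suc_eq_plus1 not_less_eq_eq)
      qed
      then show ?thesis by simp
    next
      case False
      interpret t_system t TT
      proof
        show "0 < t" by (rule t_pos)
        show "finite TT" by (rule fin_TT)
        show "card T = t + 2" if "T \<in> TT" for T by (rule TT_D(2)[OF that])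
        show "t \<le> card (T \<inter> T')" if "T \<in> TT" "T' \<in> TT" for T T' by (rule TT_inter[OF that])
        show "\<exists>T\<in>TT. card (S \<inter> T) < t" if "card S = t + 1" for S
          using False that by (metis Int_commute not_le_imp_less)
      qed
      from card_or_complete[OF ne] show ?thesis
      proof (elim disjE exE conjE)
        assume "card TT \<le> 12"
        then show ?thesis using cmax_gt(4) by linarith
      next
        assume "card TT < (t + 4) choose 2"
        then have "card TT < cmax" unfolding cmax_def by linarith
        then show ?thesis by simp
      next
        fix Z assume Z: "card Z = t + 4" "TT = {T. T \<subseteq> Z \<and> card T = t + 2}"
        have finZ: "finite Z" using Z(1) card.infinite by fastforce
        have Zn: "Z \<subseteq> {1..n}"
        proof
          fix z assume z: "z \<in> Z"
          have "t + 1 \<le> card (Z - {z})" using z Z(1) finZ by simp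
          then obtain R where R: "R \<subseteq> Z - {z}" "card R = t + 1" "finite R" by (metis obtain_subset_with_card_n)
          have "card (insert z R) = t + 2" using R by (simp add: card_insert_if subset_Diff_insert)
          then have "insert z R \<in> TT" using R z Z(2) by blast
          then show "z \<in> {1..n}" using TT_D(1) by blast
        qed
        have "\<F> \<subseteq> type3_family n (t + m) t Z"
        proof
          fix F assume F: "F \<in> \<F>"
          have "t + 2 \<le> card (F \<inter> Z)"
          proof (rule ccontr)
            assume "\<not> t + 2 \<le> card (F \<inter> Z)"
            then have "3 \<le> card (Z - F)" using card_Diff_subset_Int[of Z F] finZ Z(1) by (simp add: Int_commute)
            \<comment> \<open>A \<open>(t + 2)\<close>-subset of \<open>Z\<close> through three
              points missed by \<open>F\<close> meets \<open>F\<close> in at most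
              \<open>t - 1\<close> points, so it cannot be a cover.\<close>
            then obtain R where R: "R \<subseteq> Z - F" "card R = 3" "finite R" by (metis obtain_subset_with_card_n)
            have "R \<subseteq> Z" using R by blast
            then have "t - 1 \<le> card (Z - R)" using card_Diff_subset[of R Z] R Z(1) by simp
            then obtain Q where Q: "Q \<subseteq> Z - R" "card Q = t - 1" "finite Q" by (metis obtain_subset_with_card_n)
            have "card (R \<union> Q) = t + 2" using card_Un_disjoint[of R Q] R Q t_pos by auto
            then have "R \<union> Q \<in> TT" using R Q Z(2) by blast
            then have "t \<le> card ((R \<union> Q) \<inter> F)" using TT_D(3) F by blast
            also have "\<dots> \<le> card Q" using R Q by (intro card_mono) auto
            finally show False using Q t_pos by simp
          qed
          then show "F \<in> type3_family n (t + m) t Z" using F \<F>_sub by (auto simp: type3_family_def)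
        qed
        moreover have "is_type3 n (t + m) t (type3_family n (t + m) t Z)"
          unfolding is_type3_def using Zn Z(1) by blast
        ultimately show ?thesis unfolding sub_type3_def by blast
      qed
    qed
  qed
qed

lemma small_or_structured:
  "int (card \<F>) < max (f1 n (t + m) t) (max (f2 n (t + m) t) (f3 n (t + m) t))
    \<or> sub_type1 n (t + m) t \<F> \<or> sub_type2 n (t + m) t \<F> \<or> sub_type3 n (t + m) t \<F>"
proof (cases "TT = {}")
  case True
  then show ?thesis using large_tau_case by simp
next
  case False
  show ?thesis
  proof (cases "card TT < cmax")
    case True
    then show ?thesis using few_covers_imp_small[OF m n t_pos card_\<F>_le[OF False]] unfolding cmax_def by simp
  qed (use few_covers_or_structured[OF False] in simp)
qed

end

section \<open>Sizes of the extremal families\<close>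

text \<open>An upper bound suffices for the final comparison, so overlaps between the parts may be
  ignored. The first part is counted as \<open>PBC - PC\<close>, the sets meeting \<open>C\<close>
  without those that miss \<open>B\<close>, which produces the second difference of
  \<open>f1_eq\<close>.\<close>

lemma card_type1:
  assumes F: "is_type1 n (t + m) t \<F>" and t: "0 < t" and m: "3 \<le> m" and n: "t + 2 * m + 1 \<le> n"
  shows "finite \<F>" "int (card \<F>) \<le> f1 n (t + m) t"
proof -
  obtain T A B C u where sub: "T \<subseteq> {1..n}" "A \<subseteq> {1..n}" "B \<subseteq> {1..n}" "C \<subseteq> {1..n}"
    and card: "card T = t" "card A = t" "card B = m" "card C = m" "card (T \<inter> A) = t - 1"
    and disj: "T \<inter> (B \<union> C) = {}" "A \<inter> B = {}" "A \<inter> C = {}" "B \<inter> C = {}" "u \<in> C"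
    and F_eq: "\<F> = type1_family n (t + m) T A B C u"
    using F unfolding is_type1_def diff_add_inverse by blast
  define k where "k = t + m"
  have fin: "finite T" "finite A" "finite B" "finite C"
    using sub[THEN finite_subset, OF finite_atLeastAtMost] by blast+
  have cTA: "card (A \<union> T) = t + 1"
    using card_Un_Int[OF fin(2,1)] card t by (simp add: Int_commute)
  define N where "N = n - t - 1"
  have nN: "n = N + t + 1" and N2: "2 * m \<le> N" using n by (auto simp: N_def)
  define PC where "PC = {F. F \<subseteq> {1..n} \<and> card F = k \<and> F \<inter> (A \<union> T \<union> B) = T \<and> F \<inter> C \<noteq> {}}"
  define PBC where "PBC = {F. F \<subseteq> {1..n} \<and> card F = k \<and> F \<inter> (A \<union> T) = T \<and> F \<inter> C \<noteq> {}}"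
  define Q where "Q = {F. F \<subseteq> {1..n} \<and> card F = k \<and> F \<inter> (A \<union> T) = A \<union> T \<and> F \<inter> (insert u B) \<noteq> {}}"
  let ?S1 = "{F \<in> ksets n k. F \<inter> (A \<union> T) = T \<and> F \<inter> B \<noteq> {} \<and> F \<inter> C \<noteq> {}}"
  let ?S2 = "{F \<in> ksets n k. A \<union> T \<subseteq> F \<and> F \<inter> (B \<union> {u}) \<noteq> {}}"
  have fin_all: "finite X" if "X \<subseteq> Pow {1..n}" for X :: "nat set set" using that finite_subset by blast
  have finPBC: "finite PBC" "finite PC" "finite ?S1" "finite ?S2" by (rule fin_all; auto simp: PBC_def PC_def ksets_def)+
  have dB: "B \<inter> (A \<union> T) = {}" and dC: "C \<inter> (A \<union> T) = {}" and dC': "C \<inter> (A \<union> T \<union> B) = {}"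
    using disj by blast+
  have cTAB: "card (A \<union> T \<union> B) = t + 1 + m"
    using card_Un_disjoint[of "A \<union> T" B] fin dB cTA card by (simp add: Int_commute)
  have kt: "card T \<le> k" "k - card T = m" "card (A \<union> T) \<le> k" "k - card (A \<union> T) = m - 1" "n - card (A \<union> T) = N"
    "n - card (A \<union> T \<union> B) = N - m"
    using card cTA cTAB m nN by (auto simp: k_def)
  have card_n: "card {1..n} = n" by simp
  have TA_n: "A \<union> T \<subseteq> {1..n}" and TAB_n: "A \<union> T \<union> B \<subseteq> {1..n}" using sub by blast+
  have T_sub: "T \<subseteq> A \<union> T" "T \<subseteq> A \<union> T \<union> B" by blast+
  have cPBC: "int (card PBC) = int (N choose m) - int ((N - m) choose m)"
    using card_ksubsets_trace_hit[OF finite_atLeastAtMost TA_n T_sub(1) kt(1) sub(4) dC]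
    unfolding PBC_def card_n kt(2,5) card(4) .
  have cPC: "int (card PC) = int ((N - m) choose m) - int ((N - m - m) choose m)"
    using card_ksubsets_trace_hit[OF finite_atLeastAtMost TAB_n T_sub(2) kt(1) sub(4) dC']
    unfolding PC_def card_n kt(2,6) card(4) .
  have S1_eq: "?S1 = PBC - PC"
  proof (rule set_eqI)
    fix F
    have "F \<inter> (A \<union> T) = T \<Longrightarrow> F \<inter> B = {} \<longleftrightarrow> F \<inter> (A \<union> T \<union> B) = T" using disj(1) by blast
    then show "F \<in> ?S1 \<longleftrightarrow> F \<in> PBC - PC" unfolding PBC_def PC_def ksets_def by blast
  qed
  have sub_PBC: "PC \<subseteq> PBC"
  proof
    fix F assume F: "F \<in> PC"
    then have "F \<inter> (A \<union> T \<union> B) = T" by (simp add: PC_def)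
    then have "F \<inter> (A \<union> T) = T" using disj(1) by blast
    then show "F \<in> PBC" using F by (simp add: PC_def PBC_def)
  qed
  have "card ?S1 = card PBC - card PC" unfolding S1_eq by (rule card_Diff_subset[OF finPBC(2) sub_PBC])
  moreover have "card PC \<le> card PBC" by (rule card_mono[OF finPBC(1) sub_PBC])
  ultimately have "int (card ?S1) = int (card PBC) - int (card PC)" by (simp only: of_nat_diff)
  moreover have "N - m - m = N - 2 * m" by simp
  ultimately have S1: "int (card ?S1) = int (N choose m) - 2 * int ((N - m) choose m) + int ((N - 2 * m) choose m)"
    unfolding cPBC cPC by (simp only:)
  have uB: "u \<notin> B" using disj by blast
  have uBn: "insert u B \<subseteq> {1..n}" and duB: "insert u B \<inter> (A \<union> T) = {}" using sub disj dB dC by blast+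
  have cuB: "card (insert u B) = m + 1" using uB fin card by simp
  have "int (card Q) = int (N choose (m - 1)) - int ((N - (m + 1)) choose (m - 1))"
    using card_ksubsets_trace_hit[OF finite_atLeastAtMost TA_n subset_refl kt(3) uBn duB]
    unfolding Q_def card_n kt(4,5) cuB .
  moreover have "?S2 = Q"
  proof (rule set_eqI)
    fix F
    show "F \<in> ?S2 \<longleftrightarrow> F \<in> Q" unfolding Q_def ksets_def by blast
  qed
  moreover have "N - (m + 1) = N - m - 1" by simp
  ultimately have S2: "int (card ?S2) = int (N choose (m - 1)) - int ((N - m - 1) choose (m - 1))" by (simp only:)
  let ?S3 = "{A \<union> B, A \<union> C, (T \<inter> A) \<union> B \<union> {u}}"
  have F': "\<F> = ?S1 \<union> ?S2 \<union> ?S3" unfolding F_eq type1_family_def k_def ..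
  have "card ?S3 \<le> 3" using card_set_le_length[of ?S3 "[A \<union> B, A \<union> C, (T \<inter> A) \<union> B \<union> {u}]"] by simp
  moreover have "card \<F> \<le> card (?S1 \<union> ?S2) + card ?S3" unfolding F' by (rule card_Un_le)
  moreover have "card (?S1 \<union> ?S2) \<le> card ?S1 + card ?S2" by (rule card_Un_le)
  ultimately have "int (card \<F>) \<le> int (card ?S1) + int (card ?S2) + 3" by linarith
  moreover have "f1 n (t + m) t = (int (N choose m) - 2 * int ((N - m) choose m) + int ((N - 2 * m) choose m))
    + (int (N choose (m - 1)) - int ((N - m - 1) choose (m - 1))) + 3"
    unfolding nN using m N2 by (intro f1_eq) auto
  ultimately show "int (card \<F>) \<le> f1 n (t + m) t" using S1 S2 by linarith
  show "finite \<F>" unfolding F' using finPBC by simp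
qed

lemma card_type2:
  assumes F: "is_type2 n (t + m) t \<F>" and m: "3 \<le> m" and n: "t + m + 2 \<le> n"
  shows "finite \<F>" "int (card \<F>) \<le> f2 n (t + m) t"
proof -
  obtain M W where M: "M \<subseteq> {1..n}" "card M = t + m + 2" "W \<subseteq> M" "card W = t + 2"
    and F_eq: "\<F> = type2_family n (t + m) t M W" using F unfolding is_type2_def by blast
  define k where "k = t + m"
  define N where "N = n - t - 2"
  have nN: "n = N + t + 2" and Nm: "m \<le> N" using n by (auto simp: N_def)
  have finM: "finite M" using finite_subset[OF M(1) finite_atLeastAtMost] .
  have fin: "finite M" "finite W" using finM finite_subset[OF M(3) finM] by auto
  have Wn: "W \<subseteq> {1..n}" using M by blast
  define S1 where "S1 = {F \<in> ksets n k. W \<subseteq> F}"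
  define S2 where "S2 = {F \<in> ksets n k. card (F \<inter> W) = t + 1 \<and> F \<inter> (M - W) \<noteq> {}}"
  define S3 where "S3 = {F. F \<subseteq> M \<and> card F = k \<and> card (F \<inter> W) = t}"
  have F': "\<F> = S1 \<union> S2 \<union> S3" unfolding F_eq type2_family_def k_def S1_def S2_def S3_def ..
  have finS: "finite S1" "finite S2" "finite S3" unfolding S1_def S2_def S3_def using finite_ksets fin by auto
  have kw: "card W \<le> k" "k - card W = m - 2" "n - card W = N" using M m by (auto simp: k_def N_def)
  have "card S1 \<le> N choose (m - 2)"
    using card_supersets_le[of "ksets n k" n k W] fin kw by (simp add: S1_def)
  define G where "G w = {F. F \<subseteq> {1..n} \<and> card F = k \<and> F \<inter> W = W - {w} \<and> F \<inter> (M - W) \<noteq> {}}" for w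
  have cMW: "card (M - W) = m" using M fin by (simp add: card_Diff_subset)
  have cG: "int (card (G w)) = int (N choose (m - 1)) - int ((N - m) choose (m - 1))" if w: "w \<in> W" for w
  proof -
    have "card (W - {w}) = t + 1" using w M fin by simp
    then have c: "card (W - {w}) \<le> k" "k - card (W - {w}) = m - 1" using m by (auto simp: k_def)
    have "W - {w} \<subseteq> W" "M - W \<subseteq> {1..n}" "(M - W) \<inter> W = {}" using M(1) by blast+
    moreover have "card {1..n} = n" by simp
    ultimately show ?thesis
      using card_ksubsets_trace_hit[OF finite_atLeastAtMost Wn _ c(1), of "M - W"] kw(3) cMW unfolding G_def c(2) by simp
  qed
  have "S2 \<subseteq> (\<Union>w\<in>W. G w)"
  proof
    fix F assume "F \<in> S2"
    then have F: "F \<subseteq> {1..n}" "card F = k" "card (F \<inter> W) = t + 1" "F \<inter> (M - W) \<noteq> {}" by (auto simp: S2_def ksets_def)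
    have "card (W - F) = 1" using card_Diff_subset_Int[of W F] fin F(3) M by (simp add: Int_commute)
    then obtain w where "W - F = {w}" by (metis card_1_singletonE)
    then have "w \<in> W" "F \<inter> W = W - {w}" by auto
    then show "F \<in> (\<Union>w\<in>W. G w)" using F by (auto simp: G_def)
  qed
  moreover have finG: "finite (G w)" for w by (rule finite_subset[of _ "Pow {1..n}"]) (auto simp: G_def)
  ultimately have "card S2 \<le> card (\<Union>w\<in>W. G w)" using fin by (intro card_mono) auto
  also have "\<dots> \<le> (\<Sum>w\<in>W. card (G w))" by (rule card_UN_le[OF fin(2)])
  finally have "int (card S2) \<le> (\<Sum>w\<in>W. int (card (G w)))" by (simp flip: of_nat_sum)
  also have "\<dots> = (\<Sum>w\<in>W. int (N choose (m - 1)) - int ((N - m) choose (m - 1)))" using cG by (rule sum.cong[OF refl])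
  also have "\<dots> = int (t + 2) * (int (N choose (m - 1)) - int ((N - m) choose (m - 1)))" using M by simp
  finally have S2: "int (card S2) \<le> int (t + 2) * (int (N choose (m - 1)) - int ((N - m) choose (m - 1)))" .
  have "card S3 \<le> (t + 2) choose 2"
  proof -
    \<comment> \<open>A set of the third kind misses two points of \<open>M\<close>, and since it
      has only \<open>t\<close> points in \<open>W\<close>, both of them lie in
      \<open>W\<close>.\<close>
    have "S3 \<subseteq> (\<lambda>p. M - p) ` {p. p \<subseteq> W \<and> card p = 2}"
    proof
      fix F assume "F \<in> S3"
      then have F: "F \<subseteq> M" "card F = k" "card (F \<inter> W) = t" by (auto simp: S3_def)
      have c2: "card (M - F) = 2" using F fin M finite_subset[OF F(1)] by (simp add: card_Diff_subset k_def)
      have "card (W - F) = 2" using card_Diff_subset_Int[of W F] fin F(3) M by (simp add: Int_commute)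
      then have "W - F = M - F" using card_subset_eq[of "M - F" "W - F"] c2 fin M by auto
      then have "F = M - (W - F)" using F(1) by blast
      then show "F \<in> (\<lambda>p. M - p) ` {p. p \<subseteq> W \<and> card p = 2}" using \<open>card (W - F) = 2\<close> by blast
    qed
    moreover have "finite {p. p \<subseteq> W \<and> card p = 2}" using fin by simp
    ultimately have "card S3 \<le> card {p. p \<subseteq> W \<and> card p = 2}" by (rule surj_card_le[rotated])
    then show ?thesis using n_subsets[OF fin(2), of 2] M by simp
  qed
  moreover have "card \<F> \<le> card (S1 \<union> S2) + card S3" unfolding F' by (rule card_Un_le)
  moreover have "card (S1 \<union> S2) \<le> card S1 + card S2" by (rule card_Un_le)
  moreover have "f2 n (t + m) t = int (N choose (m - 2))
    + int (t + 2) * (int (N choose (m - 1)) - int ((N - m) choose (m - 1))) + int ((t + 2) choose 2)"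
    unfolding nN using m Nm by (intro f2_eq) auto
  ultimately show "int (card \<F>) \<le> f2 n (t + m) t" using S2 \<open>card S1 \<le> N choose (m - 2)\<close> by linarith
  show "finite \<F>" unfolding F' using finS by simp
qed

lemma card_type3:
  assumes F: "is_type3 n (t + m) t \<F>" and m: "3 \<le> m" and n: "t + 4 \<le> n"
  shows "finite \<F>" "int (card \<F>) \<le> f3 n (t + m) t"
proof -
  obtain Z where Z: "Z \<subseteq> {1..n}" "card Z = t + 4" and F_eq: "\<F> = type3_family n (t + m) t Z"
    using F unfolding is_type3_def by blast
  define k where "k = t + m"
  define N where "N = n - t - 4"
  have nN: "n = N + t + 4" using n by (auto simp: N_def)
  have fin: "finite Z" using Z finite_subset by blast
  show finF: "finite \<F>" unfolding F_eq type3_family_def using finite_ksets by simp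
  define G where "G P = {F. F \<subseteq> {1..n} \<and> card F = k \<and> F \<inter> Z = P}" for P
  have cG: "card (G P) = N choose (k - card P)" if "P \<subseteq> Z" "card P \<le> k" for P
    using card_ksubsets_trace[of "{1..n}" Z P k] Z that nN by (simp add: G_def)
  have layer: "card (\<Union>P\<in>{P. P \<subseteq> Z \<and> card P = j}. G P) \<le> ((t + 4) choose j) * (N choose (k - j))" if j: "j \<le> k" for j
  proof -
    have finP: "finite {P. P \<subseteq> Z \<and> card P = j}" using fin by simp
    have "card (\<Union>P\<in>{P. P \<subseteq> Z \<and> card P = j}. G P) \<le> (\<Sum>P\<in>{P. P \<subseteq> Z \<and> card P = j}. card (G P))" by (rule card_UN_le[OF finP])
    also have "\<dots> = (\<Sum>P\<in>{P. P \<subseteq> Z \<and> card P = j}. N choose (k - j))" by (rule sum.cong) (use cG j in auto)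
    also have "\<dots> = ((t + 4) choose j) * (N choose (k - j))" using n_subsets[OF fin, of j] Z by simp
    finally show ?thesis .
  qed
  define L where "L j = (\<Union>P\<in>{P. P \<subseteq> Z \<and> card P = j}. G P)" for j
  \<comment> \<open>For \<open>m = 3\<close> the members have only \<open>t + 3\<close> points; this
    empty layer matches the case distinction in \<open>f3_eq\<close>.\<close>
  have L4: "L (t + 4) = {}" if "m = 3"
  proof -
    have "G P = {}" if P: "P \<subseteq> Z" "card P = t + 4" for P
    proof -
      have "card P \<le> card F" if "F \<in> G P" for F
        using that finite_subset[of F "{1..n}"] by (intro card_mono) (auto simp: G_def)
      then show ?thesis using P \<open>m = 3\<close> by (force simp: G_def k_def)
    qed
    then show ?thesis by (auto simp: L_def)
  qed
  have "\<F> \<subseteq> L (t + 2) \<union> L (t + 3) \<union> L (t + 4)"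
  proof
    fix F assume "F \<in> \<F>"
    then have F: "F \<subseteq> {1..n}" "card F = k" "t + 2 \<le> card (F \<inter> Z)" by (auto simp: F_eq type3_family_def ksets_def k_def)
    have "card (F \<inter> Z) \<le> t + 4" using card_mono[OF fin, of "F \<inter> Z"] Z by simp
    then have "card (F \<inter> Z) = t + 2 \<or> card (F \<inter> Z) = t + 3 \<or> card (F \<inter> Z) = t + 4" using F(3) by linarith
    moreover have "F \<in> L (card (F \<inter> Z))" using F by (auto simp: L_def G_def)
    ultimately show "F \<in> L (t + 2) \<union> L (t + 3) \<union> L (t + 4)" by auto
  qed
  moreover have finL: "finite (L j)" for j
    by (rule finite_subset[of _ "Pow {1..n}"]) (auto simp: L_def G_def)
  ultimately have "card \<F> \<le> card (L (t + 2) \<union> L (t + 3) \<union> L (t + 4))" by (intro card_mono) auto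
  also have "\<dots> \<le> card (L (t + 2) \<union> L (t + 3)) + card (L (t + 4))" by (rule card_Un_le)
  also have "card (L (t + 2) \<union> L (t + 3)) \<le> card (L (t + 2)) + card (L (t + 3))" by (rule card_Un_le)
  finally have total: "card \<F> \<le> card (L (t + 2)) + card (L (t + 3)) + card (L (t + 4))" by simp
  have l2: "card (L (t + 2)) \<le> ((t + 4) choose 2) * (N choose (m - 2))"
    using layer[of "t + 2"] m binomial_symmetric[of "t + 2" "t + 4"] by (simp add: L_def k_def)
  have l3: "card (L (t + 3)) \<le> (t + 4) * (N choose (m - 3))"
  proof -
    have "(t + 4) choose (t + 3) = t + 4" using binomial_symmetric[of "t + 3" "t + 4"] by simp
    then show ?thesis using layer[of "t + 3"] m by (simp add: L_def k_def)
  qed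
  have l4: "card (L (t + 4)) \<le> (if m = 3 then 0 else N choose (m - 4))"
    using L4 layer[of "t + 4"] m by (auto simp: L_def k_def)
  have "int (card \<F>) \<le> int (((t + 4) choose 2) * (N choose (m - 2))) + int ((t + 4) * (N choose (m - 3)))
    + int (if m = 3 then 0 else N choose (m - 4))"
    using total l2 l3 l4 by linarith
  then show "int (card \<F>) \<le> f3 n (t + m) t"
    unfolding nN f3_eq[OF m] of_nat_mult by (cases "m = 3") auto
qed

section \<open>Maximal extension and conclusion\<close>

lemma tau_le:
  assumes "t_cover n t \<F> S"
  shows "tau n t \<F> \<le> card S"
  unfolding tau_def using assms by (intro Least_le) blast

lemma extend_to_maximal:
  assumes "\<F> \<subseteq> ksets n k" "t_intersecting t \<F>" "t \<le> k"
  obtains \<F>' where "\<F> \<subseteq> \<F>'" "\<F>' \<subseteq> ksets n k" "t_intersecting t \<F>'"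
    "\<And>G. G \<in> ksets n k \<Longrightarrow> (\<And>F. F \<in> \<F>' \<Longrightarrow> t \<le> card (G \<inter> F)) \<Longrightarrow> G \<in> \<F>'"
proof -
  let ?A = "{\<F>'. \<F> \<subseteq> \<F>' \<and> \<F>' \<subseteq> ksets n k \<and> t_intersecting t \<F>'}"
  have "finite ?A" by (rule finite_subset[of _ "Pow (ksets n k)"]) (auto simp: finite_ksets)
  moreover have "?A \<noteq> {}" using assms by blast
  ultimately obtain M where M: "M \<in> ?A" "\<And>\<F>'. \<F>' \<in> ?A \<Longrightarrow> M \<subseteq> \<F>' \<Longrightarrow> M = \<F>'"
    using finite_has_maximal[of ?A] by meson
  show thesis
  proof (rule that[of M])
    show "\<F> \<subseteq> M" "M \<subseteq> ksets n k" "t_intersecting t M" using M(1) by auto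
    fix G assume G: "G \<in> ksets n k" "\<And>F. F \<in> M \<Longrightarrow> t \<le> card (G \<inter> F)"
    have "t_intersecting t (insert G M)"
      unfolding t_intersecting_def
    proof (intro ballI)
      fix F F' assume F: "F \<in> insert G M" "F' \<in> insert G M"
      have "t \<le> card (G \<inter> G)" using G(1) assms(3) by (simp add: ksets_def)
      then show "t \<le> card (F \<inter> F')"
        using F G(2) M(1) unfolding t_intersecting_def by (auto simp: Int_commute)
    qed
    then have "insert G M \<in> ?A" using M(1) G(1) by auto
    then show "G \<in> M" using M(2)[of "insert G M"] by blast
  qed
qed

theorem theorem1p1:
  fixes n k t :: nat and \<F> :: "nat set set"
  assumes "0 < t" and "t + 3 \<le> k"
    and "n \<ge> ((t + 3) choose 2) * (k - t + 1) ^ 4"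
    and "\<F> \<subseteq> ksets n k"
    and "t_intersecting t \<F>"
    and "tau n t \<F> \<ge> t + 2"
  shows "int (card \<F>) \<le> max (f1 n k t) (max (f2 n k t) (f3 n k t)) \<and>
         (int (card \<F>) = max (f1 n k t) (max (f2 n k t) (f3 n k t)) \<longrightarrow>
           is_type1 n k t \<F> \<or> is_type2 n k t \<F> \<or> is_type3 n k t \<F>)"
proof -
  define m where "m = k - t"
  have k: "k = t + m" and m: "3 \<le> m" using assms(2) by (auto simp: m_def)
  have "t \<le> k" using k by simp
  obtain \<M> where \<M>: "\<F> \<subseteq> \<M>" "\<M> \<subseteq> ksets n k" "t_intersecting t \<M>"
    "\<And>G. G \<in> ksets n k \<Longrightarrow> (\<And>F. F \<in> \<M> \<Longrightarrow> t \<le> card (G \<inter> F)) \<Longrightarrow> G \<in> \<M>"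
    using extend_to_maximal[OF assms(4,5) \<open>t \<le> k\<close>] by metis
  have fin\<M>: "finite \<M>" using \<M>(2) finite_ksets finite_subset by blast
  \<comment> \<open>A cover of the larger family is a cover of \<open>\<F>\<close>, so the
    hypothesis on \<open>tau\<close> carries over to \<open>\<M>\<close>.\<close>
  interpret maximal_t_family n m t \<M>
  proof
    show "((t + 3) choose 2) * (m + 1)^4 \<le> n" using assms(3) by (simp add: m_def)
    show "t \<le> card (F \<inter> F')" if "F \<in> \<M>" "F' \<in> \<M>" for F F' using \<M>(3) that by (simp add: t_intersecting_def)
    show "t + 2 \<le> card S" if "t_cover n t \<M> S" for S
    proof -
      have "t_cover n t \<F> S" using that \<M>(1) by (auto simp: t_cover_def)
      then show ?thesis using tau_le assms(6) le_trans by blast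
    qed
  qed (use assms(1) m \<M>(2,4) k in auto)
  let ?max = "max (f1 n k t) (max (f2 n k t) (f3 n k t))"
  have le: "card \<F> \<le> card \<M>" using card_mono[OF fin\<M> \<M>(1)] .
  \<comment> \<open>An extremal family containing \<open>\<M>\<close> contains \<open>\<F>\<close>.
    If \<open>\<F>\<close> has the maximum size, it cannot be a proper subfamily, which settles
    uniqueness for the original family directly.\<close>
  have squeeze: "int (card \<F>) \<le> ?max \<and> (int (card \<F>) = ?max \<longrightarrow> \<F> = \<F>')"
    if "\<M> \<subseteq> \<F>'" "finite \<F>'" "int (card \<F>') \<le> ?max" for \<F>'
  proof -
    have sub: "\<F> \<subseteq> \<F>'" using \<M>(1) that(1) by blast
    have "card \<F> \<le> card \<F>'" using card_mono[OF that(2) sub] .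
    moreover have "\<F> = \<F>'" if "int (card \<F>) = ?max"
      using card_seteq[OF \<open>finite \<F>'\<close> sub] that \<open>int (card \<F>') \<le> ?max\<close> by linarith
    ultimately show ?thesis using that(3) by linarith
  qed
  from small_or_structured show ?thesis unfolding k[symmetric]
  proof (elim disjE)
    assume "int (card \<M>) < ?max"
    then show ?thesis using le by linarith
  next
    assume "sub_type1 n k t \<M>"
    then obtain \<F>' where F': "is_type1 n k t \<F>'" "\<M> \<subseteq> \<F>'" by (auto simp: sub_type1_def)
    have "finite \<F>'" "int (card \<F>') \<le> ?max"
      using card_type1[OF F'(1)[unfolded k] assms(1) m] n_large unfolding k by auto
    from squeeze[OF F'(2) this] show ?thesis using F'(1) by blast
  next
    assume "sub_type2 n k t \<M>"
    then obtain \<F>' where F': "is_type2 n k t \<F>'" "\<M> \<subseteq> \<F>'" by (auto simp: sub_type2_def)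
    have "finite \<F>'" "int (card \<F>') \<le> ?max"
      using card_type2[OF F'(1)[unfolded k] m] n_large unfolding k by auto
    from squeeze[OF F'(2) this] show ?thesis using F'(1) by blast
  next
    assume "sub_type3 n k t \<M>"
    then obtain \<F>' where F': "is_type3 n k t \<F>'" "\<M> \<subseteq> \<F>'" by (auto simp: sub_type3_def)
    have "finite \<F>'" "int (card \<F>') \<le> ?max"
      using card_type3[OF F'(1)[unfolded k] m] n_large unfolding k by auto
    from squeeze[OF F'(2) this] show ?thesis using F'(1) by blast
  qed
qed

end
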